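(* On the set $L^\infty_+(\Omega) \subset H^{-1}_+(\Omega)$, the minimal and maximal solution maps of the impulse control problem (QVI) stated in the context are well-defined as operators $m, M\colon L^\infty_+(\Omega) \to H_0^1(\Omega)\cap L^\infty_+(\Omega)$. Further: (i) $m$ and $M$ are locally Lipschitz continuous on $L^\infty_\oplus(\Omega)$ in the sense that, for every $u \in L^\infty_\oplus(\Omega)$, there exist constants $C,r>0$ such that \[ \|m(v_1)-m(v_2)\|_{L^\infty(\Omega)} + \|M(v_1)-M(v_2)\|_{L^\infty(\Omega)} \leq C\|v_1-v_2\|_{L^\infty(\Omega)} \] for all $v_1,v_2 \in L^\infty_+(\Omega)$ satisfying $\|v_i-u\|_{L^\infty(\Omega)} \leq r$, $i=1,2$. (ii) $m$ and $M$ are weakly continuous on $L^\infty_\oplus(\Omega)$ in the sense that, for all $u \in L^\infty_\oplus(\Omega)$ and all $\{u_n\}\subset L^\infty_\oplus(\Omega)$ with $u_n \to u$ in $L^\infty(\Omega)$, we have $m(u_n)\rightharpoonup m(u)$ and $M(u_n)\rightharpoonup M(u)$ weakly in $H_0^1(\Omega)$. (iii) $M$ is Hadamard directionally differentiable on $L^\infty_\oplus(\Omega)$ in the sense that, for all $u \in L^\infty_\oplus(\Omega)$ and all $h \in L^\infty(\Omega)$, there exists a unique $M'(u;h) \in L^\infty(\Omega)$ such that, for all $\{\tau_n\}\subset(0,\infty)$, $\{h_n\}\subset L^\infty(\Omega)$ satisfying $\tau_n\to0$, $\|h-h_n\|_{L^\infty(\Omega)}\to0$, and $u+\tau_n h_n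 \in L^\infty_+(\Omega)$ for all $n$, we have \[ \frac{M(u+\tau_n h_n)-M(u)}{\tau_n} \to M'(u;h) \quad\text{in } L^q(\Omega) \text{ for all } 1 \leq q<\infty \] and \[ \frac{M(u+\tau_n h_n)-M(u)}{\tau_n} \stackrel{\star}{\rightharpoonup} M'(u;h) \quad\text{weakly-}\star\text{ in } L^\infty(\Omega). \] (iv) If $\kappa>0$, then (QVI) is uniquely solvable for all $u \in L^\infty_+(\Omega)$ and $m \equiv M \equiv \mathbb{S}$ on $L^\infty_+(\Omega)$, where $\mathbb{S}(u)$ denotes the unique solution. In this situation, the directional derivative $\mathbb{S}'(u;h)=M'(u;h)$ at a point $u \in L^\infty_\oplus(\Omega)$ in a direction $h \in L^\infty(\Omega)$ satisfying $u+\tau_0 h \in L^\infty_+(\Omega)$ for a $\tau_0>0$ is uniquely characterized by the condition that it is the smallest element (w.r.t. the a.e.-order) of the set of all $\zeta \in L^\infty(\Omega)$ for which there exist sequences $\{\zeta_n\}\subset L^\infty(\Omega)$ and $\{\tau_n\}\subset(0,\tau_0)$ such that - $\zeta_n\leq\zeta_{n+1}$ and $\tau_{n+1}\leq\tau_n$ for all $n$, - $\tau_n\to0$ for $n\to\infty$, and $\zeta_n\to\zeta$ in $L^q(\Omega)$ for all $q\in[1,\infty)$, - $\mathbb{S}(u)+\tau_n\zeta_n$ is a supersolution of $y = S(\Phi(y),u+\tau_n h)$ for all $n$, - $\Psi'((\mathbb{S}(u),u);(\zeta_n,h))-\zeta_n\to0$ a.e. in $\Omega$ for $n\to\infty$.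
   Context: Setting. $\Omega \subset \mathbb{R}^d$, $d \in \mathbb{N}$, is a bounded open nonempty set; $H_0^1(\Omega)$ and $H^{-1}(\Omega)$ are the usual Sobolev space and its dual, with dual pairing $\langle\cdot,\cdot\rangle$; $\Delta\colon H_0^1(\Omega)\to H^{-1}(\Omega)$ is the distributional Laplacian. $\kappa \geq 0$ is a constant, $c_0$ is a nonnegative real-valued Lebesgue measurable function on $\mathbb{R}^d$ (an a.e.-equivalence class), and $f\colon\mathbb{R}\to\mathbb{R}$ is nondecreasing, globally Lipschitz continuous and convex with $f(0)=0$, acting by superposition. $H^{-1}_+(\Omega) := \{z \in H^{-1}(\Omega) \mid \langle z,v\rangle \geq 0 \text{ for all } 0 \leq v \in H_0^1(\Omega)\}$. Inequalities between functions hold a.e. $L^q_+(\Omega)$ is the set of nonnegative elements of $L^q(\Omega)$, $L^0_+(\Omega)$ the set of a.e.-equivalence classes of nonnegative real-valued measurable functions, and $L^\infty_\oplus(\Omega) := \{v\in L^\infty(\Omega)\mid v\geq c \text{ a.e. for a constant } c>0\}$. For $y \in L^2(\Omega)$ with $y \geq -\kappa$, set \[ \Theta(y)(x) := \kappa + \operatorname*{ess\,inf}_{0 \leq \xi \in \mathbb{R}^d,\ x+\xi\in\Omega} \left( c_0(\xi) + y(x+\xi) \right) \quad \text{for a.a. } x \in \Omega, \] where $\xi \geq 0$ is understood componentwise; this is an element of $L^0_+(\Omega)$. (QVI) with parameter $u \in H^{-1}_+(\Omega)$: find $y \in H_0^1(\Omega)$ with $0 \leq y \leq \Theta(y)$ and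 $\langle -\Delta y + f(y) - u, v - y\rangle \geq 0$ for all $v \in H_0^1(\Omega)$ with $v \leq \Theta(y)$. For each such $u$, the solution set has a smallest element $m(u)$ and a largest element $M(u)$ w.r.t. the a.e.-order (minimal and maximal solution). $S$, $\Phi$, $\Psi$: for $p \in L^0_+(\Omega)\cup\{\infty\}$ and $u \in H^{-1}_+(\Omega)$, $S(p,u)$ is the unique $y \in H_0^1(\Omega)$ with $y\leq p$ and $\langle -\Delta y+f(y)-u,v-y\rangle\geq0$ for all $v\in H_0^1(\Omega)$ with $v\leq p$ (no constraint if $p=\infty$). $\Phi\colon L^2(\Omega)\to L^0_+(\Omega)$, $\Phi(v):=\Theta(\max(-\kappa,v))$, and $\Psi(v,u):=S(\Phi(v),u)$. A function $v\in L^2(\Omega)$ is a supersolution of $y=S(\Phi(y),w)$ if $v\geq S(\Phi(v),w)$ a.e. in $\Omega$. For $0 \le v\in L^2(\Omega)$, $u\in L^\infty_+(\Omega)$, $h_1\in L^\infty(\Omega)$ and $h_2\in L^\infty(\Omega)$ with $u+\tau_0h_2\in L^\infty_+(\Omega)$ for a $\tau_0>0$, $\Psi'((v,u);(h_1,h_2))$ denotes the $(-\infty,\infty]$-valued function that is the a.e. limit of $\tau_n^{-1}(\Psi(v+\tau_nh_1,u+\tau_nh_2)-\Psi(v,u))$ along every sequence $\{\tau_n\}\subset(0,\tau_0)$ with $\tau_n\to0$ (it exists and is unique when $\kappa>0$). *)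

theory Defs
  imports "HOL-Analysis.Analysis" "HOL-Probability.Essential_Supremum"
begin

text \<open>
  Elements of function spaces over a set \<Omega> are represented by functions on the whole space of
  which only the values on \<Omega>, up to Lebesgue null sets, matter: (in)equalities are read almost
  everywhere, and "unique" means unique up to equality almost everywhere.  Operators whose value
  is such a class are given by a chosen representative (SOME).
\<close>

section \<open>Lebesgue spaces\<close>

definition Lq :: "real \<Rightarrow> (real ^ 'n) set \<Rightarrow> (real ^ 'n \<Rightarrow> real) set" where
  "Lq q \<Omega> = {v. v \<in> borel_measurable (lebesgue_on \<Omega>)
                 \<and> integrable (lebesgue_on \<Omega>) (\<lambda>x. \<bar>v x\<bar> powr q)}"

definition Lq_norm :: "real \<Rightarrow> (real ^ 'n) set \<Rightarrow> (real ^ 'n \<Rightarrow> real) \<Rightarrow> real" where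
  "Lq_norm q \<Omega> v = (LINT x|lebesgue_on \<Omega>. \<bar>v x\<bar> powr q) powr (1 / q)"

definition Linf :: "(real ^ 'n) set \<Rightarrow> (real ^ 'n \<Rightarrow> real) set" where
  "Linf \<Omega> = {v. v \<in> borel_measurable (lebesgue_on \<Omega>)
                 \<and> esssup (lebesgue_on \<Omega>) (\<lambda>x. ereal \<bar>v x\<bar>) < \<infinity>}"

definition Linf_norm :: "(real ^ 'n) set \<Rightarrow> (real ^ 'n \<Rightarrow> real) \<Rightarrow> real" where
  "Linf_norm \<Omega> v = real_of_ereal (esssup (lebesgue_on \<Omega>) (\<lambda>x. ereal \<bar>v x\<bar>))"

definition Linf_plus :: "(real ^ 'n) set \<Rightarrow> (real ^ 'n \<Rightarrow> real) set" where
  "Linf_plus \<Omega> = {v \<in> Linf \<Omega>. AE x in lebesgue_on \<Omega>. 0 \<le> v x}"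

definition Linf_oplus :: "(real ^ 'n) set \<Rightarrow> (real ^ 'n \<Rightarrow> real) set" where
  "Linf_oplus \<Omega> = {v \<in> Linf \<Omega>. \<exists>c>0. AE x in lebesgue_on \<Omega>. c \<le> v x}"

definition Lq_tendsto ::
  "real \<Rightarrow> (real ^ 'n) set \<Rightarrow> (nat \<Rightarrow> real ^ 'n \<Rightarrow> real) \<Rightarrow> (real ^ 'n \<Rightarrow> real) \<Rightarrow> bool" where
  "Lq_tendsto q \<Omega> vs v \<longleftrightarrow> (\<forall>n. vs n \<in> Lq q \<Omega>) \<and> v \<in> Lq q \<Omega>
     \<and> (\<lambda>n. Lq_norm q \<Omega> (\<lambda>x. vs n x - v x)) \<longlonglongrightarrow> 0"

definition Linf_tendsto ::
  "(real ^ 'n) set \<Rightarrow> (nat \<Rightarrow> real ^ 'n \<Rightarrow> real) \<Rightarrow> (real ^ 'n \<Rightarrow> real) \<Rightarrow> bool" where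
  "Linf_tendsto \<Omega> vs v \<longleftrightarrow> (\<forall>n. vs n \<in> Linf \<Omega>) \<and> v \<in> Linf \<Omega>
     \<and> (\<lambda>n. Linf_norm \<Omega> (\<lambda>x. vs n x - v x)) \<longlonglongrightarrow> 0"

text \<open>Weak-star convergence, with the supremum-norm space as the dual of the integrable functions.\<close>

definition Linf_weak_star_tendsto ::
  "(real ^ 'n) set \<Rightarrow> (nat \<Rightarrow> real ^ 'n \<Rightarrow> real) \<Rightarrow> (real ^ 'n \<Rightarrow> real) \<Rightarrow> bool" where
  "Linf_weak_star_tendsto \<Omega> vs v \<longleftrightarrow> (\<forall>n. vs n \<in> Linf \<Omega>) \<and> v \<in> Linf \<Omega>
     \<and> (\<forall>w \<in> Lq 1 \<Omega>. (\<lambda>n. LINT x|lebesgue_on \<Omega>. vs n x * w x)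
            \<longlonglongrightarrow> (LINT x|lebesgue_on \<Omega>. v x * w x))"

definition is_ae_least ::
  "(real ^ 'n) set \<Rightarrow> (real ^ 'n \<Rightarrow> real) set \<Rightarrow> (real ^ 'n \<Rightarrow> real) \<Rightarrow> bool" where
  "is_ae_least \<Omega> A y \<longleftrightarrow> y \<in> A \<and> (\<forall>v\<in>A. AE x in lebesgue_on \<Omega>. y x \<le> v x)"

definition is_ae_greatest ::
  "(real ^ 'n) set \<Rightarrow> (real ^ 'n \<Rightarrow> real) set \<Rightarrow> (real ^ 'n \<Rightarrow> real) \<Rightarrow> bool" where
  "is_ae_greatest \<Omega> A y \<longleftrightarrow> y \<in> A \<and> (\<forall>v\<in>A. AE x in lebesgue_on \<Omega>. v x \<le> y x)"


section \<open>Sobolev spaces\<close>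

definition partial_deriv :: "'n \<Rightarrow> (real ^ 'n \<Rightarrow> real) \<Rightarrow> real ^ 'n \<Rightarrow> real" where
  "partial_deriv i \<phi> x = frechet_derivative \<phi> (at x) (axis i 1)"

text \<open>
  Smoothness: every iterated partial derivative is (Frechet) differentiable, hence continuous.
\<close>

definition smooth :: "(real ^ 'n \<Rightarrow> real) \<Rightarrow> bool" where
  "smooth \<phi> \<longleftrightarrow> (\<forall>is. \<forall>x. foldr partial_deriv is \<phi> differentiable (at x))"

definition test_functions :: "(real ^ 'n) set \<Rightarrow> (real ^ 'n \<Rightarrow> real) set" where
  "test_functions \<Omega> = {\<phi>. smooth \<phi> \<and> compact (closure {x. \<phi> x \<noteq> 0})
                            \<and> closure {x. \<phi> x \<noteq> 0} \<subseteq> \<Omega>}"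

definition is_weak_deriv ::
  "(real ^ 'n) set \<Rightarrow> 'n \<Rightarrow> (real ^ 'n \<Rightarrow> real) \<Rightarrow> (real ^ 'n \<Rightarrow> real) \<Rightarrow> bool" where
  "is_weak_deriv \<Omega> i y g \<longleftrightarrow>
     (\<forall>\<phi> \<in> test_functions \<Omega>.
        (LINT x|lebesgue_on \<Omega>. y x * partial_deriv i \<phi> x) = - (LINT x|lebesgue_on \<Omega>. g x * \<phi> x))"

definition weak_deriv :: "(real ^ 'n) set \<Rightarrow> 'n \<Rightarrow> (real ^ 'n \<Rightarrow> real) \<Rightarrow> real ^ 'n \<Rightarrow> real" where
  "weak_deriv \<Omega> i y = (SOME g. g \<in> Lq 2 \<Omega> \<and> is_weak_deriv \<Omega> i y g)"

definition H1 :: "(real ^ 'n) set \<Rightarrow> (real ^ 'n \<Rightarrow> real) set" where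
  "H1 \<Omega> = {y \<in> Lq 2 \<Omega>. \<forall>i. \<exists>g \<in> Lq 2 \<Omega>. is_weak_deriv \<Omega> i y g}"

definition H1_norm :: "(real ^ 'n) set \<Rightarrow> (real ^ 'n \<Rightarrow> real) \<Rightarrow> real" where
  "H1_norm \<Omega> y = sqrt ((Lq_norm 2 \<Omega> y)\<^sup>2 + (\<Sum>i\<in>UNIV. (Lq_norm 2 \<Omega> (weak_deriv \<Omega> i y))\<^sup>2))"

definition H10 :: "(real ^ 'n) set \<Rightarrow> (real ^ 'n \<Rightarrow> real) set" where
  "H10 \<Omega> = {y \<in> H1 \<Omega>. \<exists>\<phi>. (\<forall>n::nat. \<phi> n \<in> test_functions \<Omega>)
                           \<and> (\<lambda>n. H1_norm \<Omega> (\<lambda>x. \<phi> n x - y x)) \<longlonglongrightarrow> 0}"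

text \<open>
  Functionals act on representatives; boundedness makes them insensitive to null sets.
  The dual pairing of z and v is z v, and only the values of z on \<open>H10 \<Omega>\<close> matter.
\<close>

type_synonym 'n functional = "(real ^ 'n \<Rightarrow> real) \<Rightarrow> real"

definition Hm1 :: "(real ^ 'n) set \<Rightarrow> 'n functional set" where
  "Hm1 \<Omega> = {z. (\<forall>v\<in>H10 \<Omega>. \<forall>w\<in>H10 \<Omega>. z (\<lambda>x. v x + w x) = z v + z w)
              \<and> (\<forall>c. \<forall>v\<in>H10 \<Omega>. z (\<lambda>x. c * v x) = c * z v)
              \<and> (\<exists>C. \<forall>v\<in>H10 \<Omega>. \<bar>z v\<bar> \<le> C * H1_norm \<Omega> v)}"

definition Hm1_plus :: "(real ^ 'n) set \<Rightarrow> 'n functional set" where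
  "Hm1_plus \<Omega> = {z \<in> Hm1 \<Omega>. \<forall>v\<in>H10 \<Omega>. (AE x in lebesgue_on \<Omega>. 0 \<le> v x) \<longrightarrow> 0 \<le> z v}"

definition L2_functional :: "(real ^ 'n) set \<Rightarrow> (real ^ 'n \<Rightarrow> real) \<Rightarrow> 'n functional" where
  "L2_functional \<Omega> u v = (LINT x|lebesgue_on \<Omega>. u x * v x)"

definition laplacian :: "(real ^ 'n) set \<Rightarrow> (real ^ 'n \<Rightarrow> real) \<Rightarrow> 'n functional" where
  "laplacian \<Omega> y v =
     - (\<Sum>i\<in>UNIV. LINT x|lebesgue_on \<Omega>. weak_deriv \<Omega> i y x * weak_deriv \<Omega> i v x)"

definition H10_weak_tendsto ::
  "(real ^ 'n) set \<Rightarrow> (nat \<Rightarrow> real ^ 'n \<Rightarrow> real) \<Rightarrow> (real ^ 'n \<Rightarrow> real) \<Rightarrow> bool" where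
  "H10_weak_tendsto \<Omega> ys y \<longleftrightarrow> (\<forall>n. ys n \<in> H10 \<Omega>) \<and> y \<in> H10 \<Omega>
     \<and> (\<forall>z \<in> Hm1 \<Omega>. (\<lambda>n. z (ys n)) \<longlonglongrightarrow> z y)"


section \<open>The impulse control problem\<close>

definition essinf :: "'a measure \<Rightarrow> ('a \<Rightarrow> ereal) \<Rightarrow> ereal" where
  "essinf N g = - esssup N (\<lambda>x. - g x)"

text \<open>
  Obstacles are extended-real-valued, so that the absence of a constraint is the constant
  obstacle infinity.  The order on vectors is the componentwise one.
\<close>

definition Theta ::
  "(real ^ 'n) set \<Rightarrow> real \<Rightarrow> (real ^ 'n \<Rightarrow> real) \<Rightarrow> (real ^ 'n \<Rightarrow> real) \<Rightarrow> real ^ 'n \<Rightarrow> ereal" where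
  "Theta \<Omega> \<kappa> c0 y x =
     ereal \<kappa> + essinf (lebesgue_on {\<xi>. 0 \<le> \<xi> \<and> x + \<xi> \<in> \<Omega>}) (\<lambda>\<xi>. ereal (c0 \<xi> + y (x + \<xi>)))"

definition below ::
  "(real ^ 'n) set \<Rightarrow> (real ^ 'n \<Rightarrow> ereal) \<Rightarrow> (real ^ 'n \<Rightarrow> real) set" where
  "below \<Omega> p = {v \<in> H10 \<Omega>. AE x in lebesgue_on \<Omega>. ereal (v x) \<le> p x}"

text \<open>The functional \<open>-\<Delta>y + f(y) - z\<close>.\<close>

definition residual ::
  "(real ^ 'n) set \<Rightarrow> (real \<Rightarrow> real) \<Rightarrow> 'n functional \<Rightarrow> (real ^ 'n \<Rightarrow> real) \<Rightarrow> 'n functional" where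
  "residual \<Omega> f z y v = - laplacian \<Omega> y v + L2_functional \<Omega> (\<lambda>x. f (y x)) v - z v"

definition qvi_solutions ::
  "(real ^ 'n) set \<Rightarrow> real \<Rightarrow> (real ^ 'n \<Rightarrow> real) \<Rightarrow> (real \<Rightarrow> real) \<Rightarrow> 'n functional
     \<Rightarrow> (real ^ 'n \<Rightarrow> real) set" where
  "qvi_solutions \<Omega> \<kappa> c0 f z =
     {y \<in> H10 \<Omega>. (AE x in lebesgue_on \<Omega>. 0 \<le> y x)
        \<and> (AE x in lebesgue_on \<Omega>. ereal (y x) \<le> Theta \<Omega> \<kappa> c0 y x)
        \<and> (\<forall>v \<in> below \<Omega> (Theta \<Omega> \<kappa> c0 y). residual \<Omega> f z y (\<lambda>x. v x - y x) \<ge> 0)}"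

definition min_sol ::
  "(real ^ 'n) set \<Rightarrow> real \<Rightarrow> (real ^ 'n \<Rightarrow> real) \<Rightarrow> (real \<Rightarrow> real) \<Rightarrow> (real ^ 'n \<Rightarrow> real)
     \<Rightarrow> real ^ 'n \<Rightarrow> real" where
  "min_sol \<Omega> \<kappa> c0 f u =
     (SOME y. is_ae_least \<Omega> (qvi_solutions \<Omega> \<kappa> c0 f (L2_functional \<Omega> u)) y)"

definition max_sol ::
  "(real ^ 'n) set \<Rightarrow> real \<Rightarrow> (real ^ 'n \<Rightarrow> real) \<Rightarrow> (real \<Rightarrow> real) \<Rightarrow> (real ^ 'n \<Rightarrow> real)
     \<Rightarrow> real ^ 'n \<Rightarrow> real" where
  "max_sol \<Omega> \<kappa> c0 f u =
     (SOME y. is_ae_greatest \<Omega> (qvi_solutions \<Omega> \<kappa> c0 f (L2_functional \<Omega> u)) y)"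

definition the_sol ::
  "(real ^ 'n) set \<Rightarrow> real \<Rightarrow> (real ^ 'n \<Rightarrow> real) \<Rightarrow> (real \<Rightarrow> real) \<Rightarrow> (real ^ 'n \<Rightarrow> real)
     \<Rightarrow> real ^ 'n \<Rightarrow> real" where
  "the_sol \<Omega> \<kappa> c0 f u = (SOME y. y \<in> qvi_solutions \<Omega> \<kappa> c0 f (L2_functional \<Omega> u))"

definition obstacle_sol ::
  "(real ^ 'n) set \<Rightarrow> (real \<Rightarrow> real) \<Rightarrow> (real ^ 'n \<Rightarrow> ereal) \<Rightarrow> 'n functional
     \<Rightarrow> real ^ 'n \<Rightarrow> real" where
  "obstacle_sol \<Omega> f p z =
     (SOME y. y \<in> below \<Omega> p \<and> (\<forall>v \<in> below \<Omega> p. residual \<Omega> f z y (\<lambda>x. v x - y x) \<ge> 0))"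

definition Phi ::
  "(real ^ 'n) set \<Rightarrow> real \<Rightarrow> (real ^ 'n \<Rightarrow> real) \<Rightarrow> (real ^ 'n \<Rightarrow> real) \<Rightarrow> real ^ 'n \<Rightarrow> ereal" where
  "Phi \<Omega> \<kappa> c0 v = Theta \<Omega> \<kappa> c0 (\<lambda>x. max (- \<kappa>) (v x))"

definition Psi ::
  "(real ^ 'n) set \<Rightarrow> real \<Rightarrow> (real ^ 'n \<Rightarrow> real) \<Rightarrow> (real \<Rightarrow> real)
     \<Rightarrow> (real ^ 'n \<Rightarrow> real) \<Rightarrow> 'n functional \<Rightarrow> real ^ 'n \<Rightarrow> real" where
  "Psi \<Omega> \<kappa> c0 f v z = obstacle_sol \<Omega> f (Phi \<Omega> \<kappa> c0 v) z"

definition is_supersolution ::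
  "(real ^ 'n) set \<Rightarrow> real \<Rightarrow> (real ^ 'n \<Rightarrow> real) \<Rightarrow> (real \<Rightarrow> real)
     \<Rightarrow> 'n functional \<Rightarrow> (real ^ 'n \<Rightarrow> real) \<Rightarrow> bool" where
  "is_supersolution \<Omega> \<kappa> c0 f z v \<longleftrightarrow> v \<in> Lq 2 \<Omega>
     \<and> (AE x in lebesgue_on \<Omega>. obstacle_sol \<Omega> f (Phi \<Omega> \<kappa> c0 v) z x \<le> v x)"

text \<open>
  The exceptional null set may depend on the sequence of step sizes; the value infinity is allowed.
\<close>

definition is_Psi_deriv ::
  "(real ^ 'n) set \<Rightarrow> real \<Rightarrow> (real ^ 'n \<Rightarrow> real) \<Rightarrow> (real \<Rightarrow> real) \<Rightarrow> real
     \<Rightarrow> (real ^ 'n \<Rightarrow> real) \<Rightarrow> (real ^ 'n \<Rightarrow> real)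
     \<Rightarrow> (real ^ 'n \<Rightarrow> real) \<Rightarrow> (real ^ 'n \<Rightarrow> real) \<Rightarrow> (real ^ 'n \<Rightarrow> ereal) \<Rightarrow> bool" where
  "is_Psi_deriv \<Omega> \<kappa> c0 f \<tau>0 v u h1 h2 d \<longleftrightarrow>
     (AE x in lebesgue_on \<Omega>. - \<infinity> < d x) \<and>
     (\<forall>\<tau>::nat \<Rightarrow> real. (\<forall>n. 0 < \<tau> n \<and> \<tau> n < \<tau>0) \<and> \<tau> \<longlonglongrightarrow> 0 \<longrightarrow>
        (AE x in lebesgue_on \<Omega>.
           (\<lambda>n. ereal ((Psi \<Omega> \<kappa> c0 f (\<lambda>x. v x + \<tau> n * h1 x)
                             (L2_functional \<Omega> (\<lambda>x. u x + \<tau> n * h2 x)) x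
                         - Psi \<Omega> \<kappa> c0 f v (L2_functional \<Omega> u) x) / \<tau> n))
           \<longlonglongrightarrow> d x))"

definition Psi_deriv ::
  "(real ^ 'n) set \<Rightarrow> real \<Rightarrow> (real ^ 'n \<Rightarrow> real) \<Rightarrow> (real \<Rightarrow> real) \<Rightarrow> real
     \<Rightarrow> (real ^ 'n \<Rightarrow> real) \<Rightarrow> (real ^ 'n \<Rightarrow> real)
     \<Rightarrow> (real ^ 'n \<Rightarrow> real) \<Rightarrow> (real ^ 'n \<Rightarrow> real) \<Rightarrow> real ^ 'n \<Rightarrow> ereal" where
  "Psi_deriv \<Omega> \<kappa> c0 f \<tau>0 v u h1 h2 = (SOME d. is_Psi_deriv \<Omega> \<kappa> c0 f \<tau>0 v u h1 h2 d)"

definition has_hadamard_deriv ::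
  "(real ^ 'n) set \<Rightarrow> ((real ^ 'n \<Rightarrow> real) \<Rightarrow> real ^ 'n \<Rightarrow> real)
     \<Rightarrow> (real ^ 'n \<Rightarrow> real) \<Rightarrow> (real ^ 'n \<Rightarrow> real) \<Rightarrow> (real ^ 'n \<Rightarrow> real) \<Rightarrow> bool" where
  "has_hadamard_deriv \<Omega> T u h D \<longleftrightarrow> D \<in> Linf \<Omega> \<and>
     (\<forall>\<tau> hs. (\<forall>n::nat. 0 < \<tau> n) \<and> \<tau> \<longlonglongrightarrow> (0::real) \<and> Linf_tendsto \<Omega> hs h
        \<and> (\<forall>n. (\<lambda>x. u x + \<tau> n * hs n x) \<in> Linf_plus \<Omega>) \<longrightarrow>
        (let quot = (\<lambda>n x. (T (\<lambda>x. u x + \<tau> n * hs n x) x - T u x) / \<tau> n)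
         in (\<forall>q\<ge>1. Lq_tendsto q \<Omega> quot D) \<and> Linf_weak_star_tendsto \<Omega> quot D))"

definition deriv_candidates ::
  "(real ^ 'n) set \<Rightarrow> real \<Rightarrow> (real ^ 'n \<Rightarrow> real) \<Rightarrow> (real \<Rightarrow> real) \<Rightarrow> real
     \<Rightarrow> (real ^ 'n \<Rightarrow> real) \<Rightarrow> (real ^ 'n \<Rightarrow> real) \<Rightarrow> (real ^ 'n \<Rightarrow> real) set" where
  "deriv_candidates \<Omega> \<kappa> c0 f \<tau>0 u h =
     {\<zeta> \<in> Linf \<Omega>. \<exists>(\<zeta>s :: nat \<Rightarrow> real ^ 'n \<Rightarrow> real) (\<tau> :: nat \<Rightarrow> real).
        (\<forall>n. \<zeta>s n \<in> Linf \<Omega>) \<and> (\<forall>n. 0 < \<tau> n \<and> \<tau> n < \<tau>0)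
        \<and> (\<forall>n. (AE x in lebesgue_on \<Omega>. \<zeta>s n x \<le> \<zeta>s (Suc n) x) \<and> \<tau> (Suc n) \<le> \<tau> n)
        \<and> \<tau> \<longlonglongrightarrow> 0 \<and> (\<forall>q\<ge>1. Lq_tendsto q \<Omega> \<zeta>s \<zeta>)
        \<and> (\<forall>n. is_supersolution \<Omega> \<kappa> c0 f (L2_functional \<Omega> (\<lambda>x. u x + \<tau> n * h x))
                 (\<lambda>x. the_sol \<Omega> \<kappa> c0 f u x + \<tau> n * \<zeta>s n x))
        \<and> (AE x in lebesgue_on \<Omega>.
             (\<lambda>n. Psi_deriv \<Omega> \<kappa> c0 f \<tau>0 (the_sol \<Omega> \<kappa> c0 f u) u (\<zeta>s n) h x - ereal (\<zeta>s n x))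
             \<longlonglongrightarrow> 0)}"

end

theory Submission
  imports Defs
begin

text \<open>
  The obstacle problem defines a map \<open>(p, u) \<mapsto> S(p, u)\<close> that is nondecreasing in the obstacle and in the
  datum.  It is also jointly concave: since \<open>f\<close> is convex, a convex combination of two solutions is a
  subsolution that stays below the combined obstacle (\<open>subsolution_convex\<close>), and such a subsolution lies
  below the solution (\<open>comparison\<close>).  The obstacle \<open>\<Phi>(v)\<close> is nondecreasing in \<open>v\<close>, and for \<open>v \<ge> - \<kappa>\<close> it is
  an essential infimum of affine functions of \<open>v\<close>, hence concave.  So
  \<open>\<Psi>(v, u) = S(\<Phi>(v), u)\<close> is nondecreasing, jointly concave where \<open>v \<ge> - \<kappa>\<close>, nonnegative for
  \<open>u \<ge> 0\<close>, and bounded by a multiple of the supremum norm of \<open>u\<close>.  The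
  quasi-variational inequality is the fixed point equation \<open>y = \<Psi>(y, u)\<close>, and from here on the argument is
  order theory.

  \<^item> A Tarski fixed point theorem (\<open>least_prefixed_point\<close>) yields a solution \<open>m(u)\<close> below all
    supersolutions and a solution \<open>M(u)\<close> above all subsolutions.
  \<^item> If \<open>t u2 \<le> u1\<close> with \<open>0 < t \<le> 1\<close>, then concavity and \<open>\<Psi>(0, 0) \<ge> 0\<close> make \<open>t M(u2)\<close> a subsolution for \<open>u1\<close> and
    \<open>m(u1) / t\<close> a supersolution for \<open>u2\<close>, so \<open>t M(u2) \<le> M(u1)\<close> and \<open>t m(u2) \<le> m(u1)\<close>.  For data above a
    constant \<open>c > 0\<close> one may take \<open>1 - t\<close> proportional to the distance of the data, which is the local
    Lipschitz estimate (\<open>selection_stable\<close>).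
  \<^item> The same scaling makes \<open>t m(u1)\<close> admissible in the inequality for \<open>m(u2)\<close> and conversely.  Testing with
    each other bounds the energy of the difference (\<open>energy_stability\<close>), so the solutions converge
    strongly in the energy norm, in particular weakly.
  \<^item> \<open>M\<close> is concave, so its difference quotients increase as the step decreases, and they are bounded by
    the Lipschitz estimate.  Their limit is the directional derivative (\<open>dir_limit_exists\<close>); another use
    of the Lipschitz estimate absorbs perturbations of the direction.
  \<^item> If \<open>\<kappa> > 0\<close> and \<open>t M(u) \<le> m(u)\<close>, the gap in the obstacle lets a larger factor \<open>t\<close> be used, and
    iterating gives \<open>M(u) \<le> m(u)\<close> (\<open>smax_le_smin\<close>).
  \<^item> The quotients \<open>\<zeta>\<^sub>n\<close> of the solution map satisfy
    \<open>\<zeta>\<^sub>n \<le> \<Psi>'((y, u); (\<zeta>\<^sub>n, h)) \<le> M'(u; h)\<close>, so their limit is an admissible candidate; every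
    candidate dominates it because supersolutions dominate \<open>m\<close>.

  The required facts about functions with zero boundary values are the Poincare inequality, positive
  parts of differences with a smooth barrier, and completeness.  The first two come from approximation
  by test functions, the last from the Riesz--Fischer theorem.  The obstacle problem is then solved by
  minimising a uniformly convex functional.
\<close>

section \<open>Smooth functions\<close>

lemma partial_deriv_eq:
  assumes "(\<phi> has_derivative \<phi>') (at x)"
  shows "partial_deriv i \<phi> x = \<phi>' (axis i 1)"
  using frechet_derivative_at[OF assms] by (simp add: partial_deriv_def)

lemma smooth_differentiable: "smooth \<phi> \<Longrightarrow> \<phi> differentiable (at x)"
  unfolding smooth_def by (metis foldr_Nil id_apply)

lemma smooth_has_derivative:
  "smooth \<phi> \<Longrightarrow> (\<phi> has_derivative frechet_derivative \<phi> (at x)) (at x)"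
  using smooth_differentiable frechet_derivative_works by blast

lemma smooth_partial_deriv:
  assumes "smooth \<phi>" shows "smooth (partial_deriv i \<phi>)"
  unfolding smooth_def
proof (intro allI)
  fix js x
  have "foldr partial_deriv (js @ [i]) \<phi> differentiable (at x)"
    using assms unfolding smooth_def by blast
  then show "foldr partial_deriv js (partial_deriv i \<phi>) differentiable (at x)" by simp
qed

lemma smooth_continuous_on: "smooth \<phi> \<Longrightarrow> continuous_on S \<phi>"
  by (meson continuous_at_imp_continuous_on differentiable_imp_continuous_within smooth_differentiable)

text \<open>
  Smoothness is the greatest class of functions that are differentiable and whose partial
  derivatives stay in the class, so membership in any such class suffices.
\<close>

lemma smooth_coinduct:
  assumes "\<phi> \<in> X"
    and diff: "\<And>\<phi> x. \<phi> \<in> X \<Longrightarrow> \<phi> differentiable (at x)"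
    and step: "\<And>\<phi> i. \<phi> \<in> X \<Longrightarrow> partial_deriv i \<phi> \<in> X"
  shows "smooth \<phi>"
proof -
  have "foldr partial_deriv js \<phi> \<in> X" for js
    by (induction js) (use assms in auto)
  then show ?thesis unfolding smooth_def using diff by blast
qed

lemma partial_deriv_const: "partial_deriv i (\<lambda>_. c) = (\<lambda>_. 0)"
  by (intro ext, subst partial_deriv_eq[OF has_derivative_const]) simp

lemma smooth_const: "smooth (\<lambda>_. c :: real)"
proof (rule smooth_coinduct[of _ "range (\<lambda>c _. c)"])
  fix \<phi> :: "real ^ 'a \<Rightarrow> real" and i
  assume "\<phi> \<in> range (\<lambda>c _. c)"
  then show "partial_deriv i \<phi> \<in> range (\<lambda>c _. c)" by (auto simp: partial_deriv_const)
qed auto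

lemma has_derivative_coord: "((\<lambda>x. x $ i) has_derivative (\<lambda>h. h $ i)) (at x)"
  by (rule bounded_linear_imp_has_derivative[OF bounded_linear_vec_nth])

lemma partial_deriv_coord: "partial_deriv j (\<lambda>x. x $ i) = (\<lambda>_. if i = j then 1 else 0)"
  by (intro ext) (simp add: partial_deriv_eq[OF has_derivative_coord] axis_def)

lemma smooth_coord: "smooth (\<lambda>x. x $ i)"
proof -
  let ?X = "insert (\<lambda>x. x $ i) (range (\<lambda>c _. c))"
  have "smooth \<phi>" if "\<phi> \<in> ?X" for \<phi> :: "real ^ 'a \<Rightarrow> real"
  proof (rule smooth_coinduct[OF that])
    fix \<phi> :: "real ^ 'a \<Rightarrow> real" and x
    assume "\<phi> \<in> ?X"
    then show "\<phi> differentiable (at x)"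
      using has_derivative_coord differentiable_def by fastforce
  next
    fix \<phi> :: "real ^ 'a \<Rightarrow> real" and j
    assume "\<phi> \<in> ?X"
    then consider "\<phi> = (\<lambda>x. x $ i)" | c where "\<phi> = (\<lambda>_. c)" by auto
    then show "partial_deriv j \<phi> \<in> ?X"
    proof cases
      case 1 then show ?thesis by (simp add: partial_deriv_coord)
    next
      case (2 c)
      then show ?thesis by (simp add: partial_deriv_const)
    qed
  qed
  then show ?thesis by blast
qed

text \<open>
  The building block of all cut-offs below is \<open>exp (-1/t)\<close>, continued by zero to the left of the
  origin.  Multiplying it by a polynomial in \<open>1/t\<close> gives a family of functions that is closed under
  differentiation.
\<close>

definition flat :: "real poly \<Rightarrow> real \<Rightarrow> real" where
  "flat p t = (if t > 0 then poly p (1 / t) * exp (- (1 / t)) else 0)"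

lemma poly_times_exp_tendsto_0: "((\<lambda>s. poly p s * exp (- s)) \<longlongrightarrow> 0) (at_top :: real filter)"
proof -
  have "((\<lambda>s. \<Sum>i\<le>degree p. coeff p i * (s ^ i / exp s)) \<longlongrightarrow> (\<Sum>i\<le>degree p. coeff p i * 0))
          (at_top :: real filter)"
    by (intro tendsto_sum tendsto_mult tendsto_const tendsto_power_div_exp_0)
  moreover have "(\<Sum>i\<le>degree p. coeff p i * (s ^ i / exp s)) = poly p s * exp (- s)" for s
    by (simp add: poly_altdef sum_distrib_right exp_minus divide_inverse mult.assoc)
  ultimately show ?thesis by simp
qed

lemma DERIV_flat: "(flat p has_real_derivative flat ([:0,0,1:] * (p - pderiv p)) t) (at t)"
proof -
  consider "t > 0" | "t < 0" | "t = 0" by linarith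
  then show ?thesis
  proof cases
    case 1
    have "((\<lambda>t. poly p (1 / t) * exp (- (1 / t))) has_real_derivative
            flat ([:0,0,1:] * (p - pderiv p)) t) (at t)"
      using 1
      by (auto intro!: derivative_eq_intros simp: flat_def field_simps power2_eq_square)
    then show ?thesis
      by (rule has_field_derivative_transform_within_open[of _ _ _ "{0<..}"]) (use 1 in \<open>auto simp: flat_def\<close>)
  next
    case 2
    have "((\<lambda>t. 0) has_real_derivative 0) (at t)" by simp
    then have "(flat p has_real_derivative 0) (at t)"
      by (rule has_field_derivative_transform_within_open[of _ _ _ "{..<0}"]) (use 2 in \<open>auto simp: flat_def\<close>)
    then show ?thesis using 2 by (simp add: flat_def)
  next
    case 3
    have "((\<lambda>h. poly (pCons 0 p) (inverse h) * exp (- (inverse h))) \<longlongrightarrow> 0) (at_right (0::real))"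
      by (rule filterlim_compose[OF poly_times_exp_tendsto_0 filterlim_inverse_at_top_right])
    then have r: "((\<lambda>h. flat p h / h) \<longlongrightarrow> 0) (at_right 0)"
      by (rule Lim_transform_eventually)
         (auto simp: eventually_at_right_field flat_def field_simps intro!: exI[of _ 1])
    have l: "((\<lambda>h. flat p h / h) \<longlongrightarrow> 0) (at_left 0)"
      by (rule Lim_transform_eventually[OF tendsto_const])
         (auto simp: eventually_at_left_field flat_def intro!: exI[of _ "-1"])
    have "((\<lambda>h. flat p h / h) \<longlongrightarrow> 0) (at 0)"
      using l r by (simp add: filterlim_split_at)
    then show ?thesis
      using 3 by (simp add: has_field_derivative_iff flat_def)
  qed
qed

text \<open>
  Coinduction applies to the class generated by the smooth functions under the operations of
  interest, which turns out to contain nothing new.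
\<close>

inductive_set smooth_closure :: "(real ^ 'n \<Rightarrow> real) set" where
  base: "smooth \<phi> \<Longrightarrow> \<phi> \<in> smooth_closure"
| add: "\<phi> \<in> smooth_closure \<Longrightarrow> \<psi> \<in> smooth_closure \<Longrightarrow> (\<lambda>x. \<phi> x + \<psi> x) \<in> smooth_closure"
| mult: "\<phi> \<in> smooth_closure \<Longrightarrow> \<psi> \<in> smooth_closure \<Longrightarrow> (\<lambda>x. \<phi> x * \<psi> x) \<in> smooth_closure"
| flat: "\<phi> \<in> smooth_closure \<Longrightarrow> (\<lambda>x. flat p (\<phi> x)) \<in> smooth_closure"

lemma smooth_closure_deriv:
  assumes "\<phi> \<in> smooth_closure"
  shows "(\<forall>x. \<phi> differentiable (at x)) \<and> (\<forall>i. partial_deriv i \<phi> \<in> smooth_closure)"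
  using assms
proof induction
  case (base \<phi>)
  then show ?case
    using smooth_differentiable smooth_partial_deriv smooth_closure.base by blast
next
  case (add \<phi> \<psi>)
  then have d: "(\<phi> has_derivative frechet_derivative \<phi> (at x)) (at x)"
    "(\<psi> has_derivative frechet_derivative \<psi> (at x)) (at x)" for x
    using frechet_derivative_works by blast+
  have "partial_deriv i (\<lambda>x. \<phi> x + \<psi> x) = (\<lambda>x. partial_deriv i \<phi> x + partial_deriv i \<psi> x)" for i
    by (intro ext, subst partial_deriv_eq[OF has_derivative_add[OF d]]) (simp add: partial_deriv_def)
  moreover have "(\<lambda>x. partial_deriv i \<phi> x + partial_deriv i \<psi> x) \<in> smooth_closure" for i
    using add by (intro smooth_closure.add) auto
  ultimately show ?case using add by (auto intro: differentiable_add)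
next
  case (mult \<phi> \<psi>)
  then have d: "(\<phi> has_derivative frechet_derivative \<phi> (at x)) (at x)"
    "(\<psi> has_derivative frechet_derivative \<psi> (at x)) (at x)" for x
    using frechet_derivative_works by blast+
  have "partial_deriv i (\<lambda>x. \<phi> x * \<psi> x)
      = (\<lambda>x. \<phi> x * partial_deriv i \<psi> x + partial_deriv i \<phi> x * \<psi> x)" for i
    by (intro ext, subst partial_deriv_eq[OF has_derivative_mult[OF d]]) (simp add: partial_deriv_def)
  moreover have "(\<lambda>x. \<phi> x * partial_deriv i \<psi> x + partial_deriv i \<phi> x * \<psi> x) \<in> smooth_closure" for i
    using mult by (intro smooth_closure.add smooth_closure.mult) auto
  ultimately show ?case using mult by (auto intro: differentiable_mult)
next
  case (flat \<phi> p)
  let ?q = "[:0,0,1:] * (p - pderiv p)"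
  from flat have d: "(\<phi> has_derivative frechet_derivative \<phi> (at x)) (at x)" for x
    using frechet_derivative_works by blast
  have D: "((\<lambda>x. flat p (\<phi> x)) has_derivative
              (\<lambda>h. frechet_derivative \<phi> (at x) h * flat ?q (\<phi> x))) (at x)" for x
    by (rule DERIV_compose_FDERIV[OF DERIV_flat d])
  have "partial_deriv i (\<lambda>x. flat p (\<phi> x)) = (\<lambda>x. partial_deriv i \<phi> x * flat ?q (\<phi> x))" for i
    by (intro ext, subst partial_deriv_eq[OF D]) (simp add: partial_deriv_def)
  moreover have "(\<lambda>x. partial_deriv i \<phi> x * flat ?q (\<phi> x)) \<in> smooth_closure" for i
    using flat by (intro smooth_closure.mult smooth_closure.flat) auto
  moreover have "(\<lambda>x. flat p (\<phi> x)) differentiable (at x)" for x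
    unfolding differentiable_def using D by blast
  ultimately show ?case by simp
qed

lemma smooth_closure_iff: "\<phi> \<in> smooth_closure \<longleftrightarrow> smooth \<phi>"
  using smooth_closure_deriv smooth_closure.base
  by (metis (no_types, lifting) smooth_coinduct[of \<phi> smooth_closure])

lemma smooth_add: "smooth \<phi> \<Longrightarrow> smooth \<psi> \<Longrightarrow> smooth (\<lambda>x. \<phi> x + \<psi> x)"
  and smooth_mult: "smooth \<phi> \<Longrightarrow> smooth \<psi> \<Longrightarrow> smooth (\<lambda>x. \<phi> x * \<psi> x)"
  and smooth_flat: "smooth \<phi> \<Longrightarrow> smooth (\<lambda>x. flat p (\<phi> x))"
  using smooth_closure.add smooth_closure.mult smooth_closure.flat by (metis smooth_closure_iff)+

lemma smooth_cmult: "smooth \<phi> \<Longrightarrow> smooth (\<lambda>x. c * \<phi> x)"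
  by (rule smooth_mult[OF smooth_const])

lemma smooth_diff: "smooth \<phi> \<Longrightarrow> smooth \<psi> \<Longrightarrow> smooth (\<lambda>x. \<phi> x - \<psi> x)"
  using smooth_add[OF _ smooth_cmult[of _ "-1"]] by simp

lemma smooth_prod:
  assumes "finite S" "\<And>j. j \<in> S \<Longrightarrow> smooth (\<phi> j)"
  shows "smooth (\<lambda>x. \<Prod>j\<in>S. \<phi> j x)"
  using assms by (induction S) (auto intro: smooth_const smooth_mult)

lemma partial_deriv_add:
  "smooth \<phi> \<Longrightarrow> smooth \<psi> \<Longrightarrow>
   partial_deriv i (\<lambda>x. \<phi> x + \<psi> x) x = partial_deriv i \<phi> x + partial_deriv i \<psi> x"
  by (subst partial_deriv_eq[OF has_derivative_add[OF smooth_has_derivative smooth_has_derivative]])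
     (auto simp: partial_deriv_def)

lemma partial_deriv_mult:
  "smooth \<phi> \<Longrightarrow> smooth \<psi> \<Longrightarrow>
   partial_deriv i (\<lambda>x. \<phi> x * \<psi> x) x = \<phi> x * partial_deriv i \<psi> x + partial_deriv i \<phi> x * \<psi> x"
  by (subst partial_deriv_eq[OF has_derivative_mult[OF smooth_has_derivative smooth_has_derivative]])
     (auto simp: partial_deriv_def)

lemma partial_deriv_cmult:
  "smooth \<phi> \<Longrightarrow> partial_deriv i (\<lambda>x. c * \<phi> x) x = c * partial_deriv i \<phi> x"
  by (subst partial_deriv_eq[OF has_derivative_mult_right[OF smooth_has_derivative]])
     (auto simp: partial_deriv_def)

lemma partial_deriv_compose:
  assumes "smooth \<phi>" and "(G has_real_derivative G') (at (\<phi> x))"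
  shows "partial_deriv i (\<lambda>x. G (\<phi> x)) x = G' * partial_deriv i \<phi> x"
  by (subst partial_deriv_eq[OF DERIV_compose_FDERIV[OF assms(2) smooth_has_derivative[OF assms(1)]]])
     (auto simp: partial_deriv_def)

lemma DERIV_along_axis:
  fixes \<phi> :: "real ^ 'n \<Rightarrow> real"
  assumes "smooth \<phi>"
  shows "((\<lambda>t. \<phi> (x + t *\<^sub>R axis i 1)) has_real_derivative partial_deriv i \<phi> (x + t *\<^sub>R axis i 1)) (at t)"
proof -
  have "((\<lambda>t. x + t *\<^sub>R axis i 1) has_derivative (\<lambda>t. t *\<^sub>R axis i 1)) (at t)"
    by (auto intro!: derivative_eq_intros)
  from has_derivative_compose[OF this smooth_has_derivative[OF assms]]
  have D: "((\<lambda>t. \<phi> (x + t *\<^sub>R axis i 1)) has_derivative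
      (\<lambda>s. frechet_derivative \<phi> (at (x + t *\<^sub>R axis i 1)) (s *\<^sub>R axis i 1))) (at t)" .
  have "linear (frechet_derivative \<phi> (at (x + t *\<^sub>R axis i 1)))"
    using linear_frechet_derivative smooth_differentiable assms by blast
  then have "(\<lambda>s. frechet_derivative \<phi> (at (x + t *\<^sub>R axis i 1)) (s *\<^sub>R axis i 1))
     = (*) (partial_deriv i \<phi> (x + t *\<^sub>R axis i 1))"
    by (auto simp: linear_scale partial_deriv_def)
  with D show ?thesis by (simp add: has_field_derivative_def)
qed


section \<open>Test functions\<close>

lemma test_functionsI:
  assumes "smooth \<phi>" "compact K" "K \<subseteq> \<Omega>" "\<And>x. x \<notin> K \<Longrightarrow> \<phi> x = 0"
  shows "\<phi> \<in> test_functions \<Omega>"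
proof -
  have "closure {x. \<phi> x \<noteq> 0} \<subseteq> K"
    using assms by (intro closure_minimal) (auto simp: compact_imp_closed)
  then show ?thesis
    using assms compact_Int_closed[of K "closure {x. \<phi> x \<noteq> 0}"]
    by (auto simp: test_functions_def Int_absorb1 Int_commute)
qed

lemma test_functionsE:
  assumes "\<phi> \<in> test_functions \<Omega>"
  obtains K where "smooth \<phi>" "compact K" "K \<subseteq> \<Omega>" "\<And>x. x \<notin> K \<Longrightarrow> \<phi> x = 0"
  using assms closure_subset[of "{x. \<phi> x \<noteq> 0}"]
  unfolding test_functions_def by blast

text \<open>
  The complement of the closed set is an open neighbourhood on which the function vanishes.
\<close>

lemma partial_deriv_outside:
  assumes "closed K" "\<And>x. x \<notin> K \<Longrightarrow> \<phi> x = 0" "x \<notin> K"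
  shows "partial_deriv i \<phi> x = 0"
proof -
  have "((\<lambda>_. 0) has_derivative (\<lambda>_. 0)) (at x)" by simp
  then have "(\<phi> has_derivative (\<lambda>_. 0)) (at x)"
    by (rule has_derivative_transform_within_open[of _ _ _ _ "- K"]) (use assms in auto)
  then show ?thesis by (rule partial_deriv_eq)
qed

lemma test_smooth: "\<phi> \<in> test_functions \<Omega> \<Longrightarrow> smooth \<phi>"
  by (simp add: test_functions_def)

lemma test_partial_deriv:
  assumes "\<phi> \<in> test_functions \<Omega>" shows "partial_deriv i \<phi> \<in> test_functions \<Omega>"
proof (rule test_functionsE[OF assms])
  fix K assume K: "smooth \<phi>" "compact K" "K \<subseteq> \<Omega>" "\<And>x. x \<notin> K \<Longrightarrow> \<phi> x = 0"
  show ?thesis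
    by (rule test_functionsI[OF smooth_partial_deriv K(2,3)])
       (use K in \<open>auto intro: partial_deriv_outside[OF compact_imp_closed]\<close>)
qed

lemma test_mult:
  assumes "\<phi> \<in> test_functions \<Omega>" "smooth \<psi>" shows "(\<lambda>x. \<psi> x * \<phi> x) \<in> test_functions \<Omega>"
proof (rule test_functionsE[OF assms(1)])
  fix K assume K: "smooth \<phi>" "compact K" "K \<subseteq> \<Omega>" "\<And>x. x \<notin> K \<Longrightarrow> \<phi> x = 0"
  show ?thesis
    by (rule test_functionsI[OF smooth_mult K(2,3)]) (use K assms in auto)
qed

lemma test_add:
  assumes "\<phi> \<in> test_functions \<Omega>" "\<psi> \<in> test_functions \<Omega>"
  shows "(\<lambda>x. \<phi> x + \<psi> x) \<in> test_functions \<Omega>"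
proof (rule test_functionsE[OF assms(1)], rule test_functionsE[OF assms(2)])
  fix K L assume K: "smooth \<phi>" "compact K" "K \<subseteq> \<Omega>" "\<And>x. x \<notin> K \<Longrightarrow> \<phi> x = 0"
    and L: "smooth \<psi>" "compact L" "L \<subseteq> \<Omega>" "\<And>x. x \<notin> L \<Longrightarrow> \<psi> x = 0"
  show ?thesis
    by (rule test_functionsI[OF smooth_add compact_Un[OF K(2) L(2)]]) (use K L assms in auto)
qed

lemma test_zero: "(\<lambda>_. 0) \<in> test_functions \<Omega>"
  by (rule test_functionsI[of _ "{}"]) (auto intro: smooth_const)

lemma smooth_bounded_on_compact:
  assumes "smooth \<phi>" "compact K"
  obtains B where "B > 0" "\<And>x. x \<in> K \<Longrightarrow> \<bar>\<phi> x\<bar> \<le> B"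
proof -
  have "bounded (\<phi> ` K)"
    by (intro compact_imp_bounded compact_continuous_image smooth_continuous_on assms)
  then show ?thesis using that by (auto simp: bounded_pos)
qed

lemma test_bounded:
  assumes "\<phi> \<in> test_functions \<Omega>"
  obtains B where "B > 0" "\<And>x. \<bar>\<phi> x\<bar> \<le> B"
proof (rule test_functionsE[OF assms])
  fix K assume K: "smooth \<phi>" "compact K" "K \<subseteq> \<Omega>" "\<And>x. x \<notin> K \<Longrightarrow> \<phi> x = 0"
  obtain B where B: "B > 0" "\<And>x. x \<in> K \<Longrightarrow> \<bar>\<phi> x\<bar> \<le> B"
    using smooth_bounded_on_compact[OF K(1,2)] by blast
  show thesis by (rule that[OF B(1)]) (use K(4) B in \<open>metis abs_zero less_imp_le\<close>)
qed

lemma smooth_borel_measurable: "smooth \<phi> \<Longrightarrow> \<phi> \<in> borel_measurable borel"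
  by (intro borel_measurable_continuous_onI smooth_continuous_on)

text \<open>
  Translation invariance gives every difference quotient of a test function the integral zero.
\<close>

lemma integral_partial_deriv_lborel:
  fixes \<phi> :: "real ^ 'n \<Rightarrow> real"
  assumes "\<phi> \<in> test_functions \<Omega>"
  shows "(LINT x|lborel. partial_deriv i \<phi> x) = 0"
proof (rule test_functionsE[OF assms])
  fix K assume K: "smooth \<phi>" "compact K" "K \<subseteq> \<Omega>" "\<And>x. x \<notin> K \<Longrightarrow> \<phi> x = 0"
  let ?e = "axis i 1 :: real ^ 'n"
  obtain B where B: "B > 0" "\<And>x. \<bar>partial_deriv i \<phi> x\<bar> \<le> B"
    using test_bounded[OF test_partial_deriv[OF assms]] by blast
  obtain R where R: "\<And>x. x \<in> K \<Longrightarrow> norm x \<le> R"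
    using compact_imp_bounded[OF K(2)] by (auto simp: bounded_iff)
  define t where "t n = 1 / (real n + 1)" for n :: nat
  have t: "t n > 0" "t n \<le> 1" for n by (auto simp: t_def)
  have t0: "t \<longlonglongrightarrow> 0"
    unfolding t_def using LIMSEQ_inverse_real_of_nat by (simp add: inverse_eq_divide add.commute)
  define s where "s n x = (\<phi> (x + t n *\<^sub>R ?e) - \<phi> x) / t n" for n x
  have [measurable]: "\<phi> \<in> borel_measurable borel" "partial_deriv i \<phi> \<in> borel_measurable borel"
    using K smooth_borel_measurable smooth_partial_deriv by blast+
  have int\<phi>: "integrable lborel \<phi>"
  proof -
    have "integrable lborel (\<lambda>x. indicator K x *\<^sub>R \<phi> x)"
      using borel_integrable_compact[OF K(2) smooth_continuous_on[OF K(1)]]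
      by (simp add: if_distrib indicator_def cong: if_cong)
    moreover have "(\<lambda>x. indicator K x *\<^sub>R \<phi> x) = \<phi>" using K(4) by (intro ext) (auto simp: indicator_def)
    ultimately show ?thesis by simp
  qed
  have shift: "integrable lborel (\<lambda>x. \<phi> (x + c))" "(LINT x|lborel. \<phi> (x + c)) = (LINT x|lborel. \<phi> x)" for c
  proof -
    have "integrable (distr lborel borel ((+) c)) \<phi>" using int\<phi> by (simp add: lborel_distr_plus)
    then show "integrable lborel (\<lambda>x. \<phi> (x + c))"
      by (subst (asm) integrable_distr_eq) (auto simp: add.commute)
    have "(LINT x|distr lborel borel ((+) c). \<phi> x) = (LINT x|lborel. \<phi> (c + x))"
      by (subst integral_distr) auto
    then show "(LINT x|lborel. \<phi> (x + c)) = (LINT x|lborel. \<phi> x)"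
      by (simp add: lborel_distr_plus add.commute)
  qed
  have "(\<lambda>n. LINT x|lborel. s n x) \<longlonglongrightarrow> (LINT x|lborel. partial_deriv i \<phi> x)"
  proof (rule integral_dominated_convergence[where w="\<lambda>x. B * indicator (cball 0 (R + 1)) x"])
    show "AE x in lborel. (\<lambda>n. s n x) \<longlonglongrightarrow> partial_deriv i \<phi> x"
    proof (rule AE_I2)
      fix x
      have "(\<lambda>h. (\<phi> (x + h *\<^sub>R ?e) - \<phi> x) / h) \<midarrow>0\<rightarrow> partial_deriv i \<phi> x"
        using DERIV_along_axis[OF K(1), of x i 0] by (simp add: has_field_derivative_iff)
      moreover have "filterlim t (at 0) sequentially"
        using t0 t(1) by (auto simp: filterlim_at less_imp_neq[symmetric])
      ultimately show "(\<lambda>n. s n x) \<longlonglongrightarrow> partial_deriv i \<phi> x"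
        unfolding s_def using filterlim_compose by blast
    qed
    show "AE x in lborel. norm (s n x) \<le> B * indicator (cball 0 (R + 1)) x" for n
    proof (rule AE_I2)
      fix x
      show "norm (s n x) \<le> B * indicator (cball 0 (R + 1)) x"
      proof (cases "x \<in> cball 0 (R + 1)")
        case True
        obtain z where "\<phi> (x + t n *\<^sub>R ?e) - \<phi> (x + 0 *\<^sub>R ?e) = (t n - 0) * partial_deriv i \<phi> (x + z *\<^sub>R ?e)"
          using MVT2[OF t(1) DERIV_along_axis[OF K(1)], of n x i] by blast
        then have "s n x = partial_deriv i \<phi> (x + z *\<^sub>R ?e)" using t(1)[of n] by (simp add: s_def)
        then show ?thesis using B True by simp
      next
        case False
        have "norm (t n *\<^sub>R ?e) \<le> 1" using t[of n] by (simp add: norm_axis_1)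
        then have "norm x \<le> norm (x + t n *\<^sub>R ?e) + 1"
          using norm_triangle_ineq4[of "x + t n *\<^sub>R ?e" "t n *\<^sub>R ?e"] by simp
        then have "x \<notin> K" "x + t n *\<^sub>R ?e \<notin> K" using False R by force+
        then show ?thesis using K(4) B(1) by (simp add: s_def)
      qed
    qed
    show "integrable lborel (\<lambda>x. B * indicator (cball 0 (R + 1)) x)"
      by (intro integrable_mult_right integrable_real_indicator)
          (use emeasure_lborel_cball_finite[of 0 "R + 1"] in \<open>auto simp: less_top\<close>)
  qed (auto simp: s_def)
  moreover have "(LINT x|lborel. s n x) = 0" for n
    unfolding s_def using shift int\<phi> by simp
  ultimately show ?thesis by (simp add: LIMSEQ_const_iff)
qed

section \<open>Square-integrable functions\<close>

locale bounded_domain =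
  fixes \<Omega> :: "(real ^ 'n) set"
  assumes open_domain: "open \<Omega>" and bounded_dom: "bounded \<Omega>" and nonempty_domain: "\<Omega> \<noteq> {}"
begin

abbreviation "\<mu> \<equiv> lebesgue_on \<Omega>"

abbreviation "L2 \<equiv> Lq 2 \<Omega>"

lemma domain_lmeasurable: "\<Omega> \<in> lmeasurable"
  by (rule lmeasurable_open[OF bounded_dom open_domain])

lemma domain_sets: "\<Omega> \<in> sets lebesgue"
  using domain_lmeasurable by blast

sublocale finite_measure \<mu>
  by (rule finite_measure_lebesgue_on[OF domain_lmeasurable])

text \<open>
  Lebesgue measure is complete, so altering a function on a null set preserves measurability.
\<close>

lemma measurable_AE_cong:
  assumes "v \<in> borel_measurable \<mu>" "AE x in \<mu>. v x = w x"
  shows "(w :: _ \<Rightarrow> real) \<in> borel_measurable \<mu>"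
proof -
  have "(\<lambda>x. if x \<in> \<Omega> then v x else 0) \<in> borel_measurable lebesgue"
    using borel_measurable_if_I[OF assms(1)] domain_sets by simp
  moreover have "AE x in lebesgue. (if x \<in> \<Omega> then v x else 0) = (if x \<in> \<Omega> then w x else 0)"
    using assms(2) domain_sets by (subst (asm) AE_restrict_space_iff) (auto elim: eventually_mono)
  ultimately have "(\<lambda>x. if x \<in> \<Omega> then w x else 0) \<in> borel_measurable lebesgue"
    by (rule borel_measurable_AE)
  then show ?thesis using borel_measurable_if_D domain_sets by blast
qed

text \<open>
  Working with the square of the norm replaces the triangle inequality by
  \<open>\<parallel>v + w\<parallel>\<^sup>2 \<le> 2 \<parallel>v\<parallel>\<^sup>2 + 2 \<parallel>w\<parallel>\<^sup>2\<close>, which is enough for every limit below.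
\<close>

definition sq_norm :: "(real ^ 'n \<Rightarrow> real) \<Rightarrow> real" where
  "sq_norm v = (LINT x|\<mu>. (v x)\<^sup>2)"

lemma abs_powr_2: "\<bar>t\<bar> powr 2 = t\<^sup>2" for t :: real
  using powr_realpow[of "\<bar>t\<bar>" 2] by (cases "t = 0") auto

lemma L2_iff: "v \<in> L2 \<longleftrightarrow> v \<in> borel_measurable \<mu> \<and> integrable \<mu> (\<lambda>x. (v x)\<^sup>2)"
  by (simp add: Lq_def abs_powr_2)

lemma L2_measurable: "v \<in> L2 \<Longrightarrow> v \<in> borel_measurable \<mu>"
  by (simp add: L2_iff)

lemma sq_norm_nonneg: "0 \<le> sq_norm v"
  by (simp add: sq_norm_def)

lemma Lq_norm_2: "Lq_norm 2 \<Omega> v = sqrt (sq_norm v)"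
  by (simp add: Lq_norm_def abs_powr_2 sq_norm_def powr_half_sqrt)

lemma L2_times_integrable:
  assumes "v \<in> L2" "w \<in> L2" shows "integrable \<mu> (\<lambda>x. v x * w x)"
proof (rule Bochner_Integration.integrable_bound)
  show "integrable \<mu> (\<lambda>x. (v x)\<^sup>2 + (w x)\<^sup>2)" using assms by (simp add: L2_iff)
  have "\<bar>a * b\<bar> \<le> a\<^sup>2 + b\<^sup>2" for a b :: real
  proof -
    have "0 \<le> \<bar>a * b\<bar>" "2 * \<bar>a * b\<bar> \<le> a\<^sup>2 + b\<^sup>2"
      using sum_squares_bound[of "\<bar>a\<bar>" "\<bar>b\<bar>"] by (simp_all add: abs_mult)
    then show ?thesis by linarith
  qed
  then show "AE x in \<mu>. norm (v x * w x) \<le> norm ((v x)\<^sup>2 + (w x)\<^sup>2)" by auto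
  show "(\<lambda>x. v x * w x) \<in> borel_measurable \<mu>"
    using assms by (intro borel_measurable_times) (simp_all add: L2_iff)
qed

lemma L2_dominated:
  assumes "w \<in> L2" "v \<in> borel_measurable \<mu>" "AE x in \<mu>. \<bar>v x\<bar> \<le> \<bar>w x\<bar>"
  shows "v \<in> L2"
proof -
  have "integrable \<mu> (\<lambda>x. (v x)\<^sup>2)"
  proof (rule Bochner_Integration.integrable_bound)
    show "integrable \<mu> (\<lambda>x. (w x)\<^sup>2)" using assms(1) by (simp add: L2_iff)
    show "AE x in \<mu>. norm ((v x)\<^sup>2) \<le> norm ((w x)\<^sup>2)"
      using assms(3) by eventually_elim (simp add: abs_le_square_iff)
  qed (use assms in simp)
  then show ?thesis using assms by (simp add: L2_iff)
qed

lemma L2_AE_cong: "v \<in> L2 \<Longrightarrow> AE x in \<mu>. v x = w x \<Longrightarrow> w \<in> L2"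
  by (rule L2_dominated[of v]) (erule measurable_AE_cong[OF L2_measurable] | auto elim: eventually_mono)+

lemma L2_bounded:
  assumes "v \<in> borel_measurable \<mu>" "AE x in \<mu>. \<bar>v x\<bar> \<le> B" shows "v \<in> L2"
  by (rule L2_dominated[of "\<lambda>_. B"]) (use assms in \<open>auto simp: L2_iff elim: eventually_mono\<close>)

lemma L2_const: "(\<lambda>_. c) \<in> L2"
  by (rule L2_bounded[of _ "\<bar>c\<bar>"]) auto

lemma L2_add: assumes "v \<in> L2" "w \<in> L2" shows "(\<lambda>x. v x + w x) \<in> L2"
  using assms L2_times_integrable[OF assms] borel_measurable_add[of v \<mu> w]
  by (simp add: L2_iff power2_sum mult.assoc)

lemma L2_cmult: "v \<in> L2 \<Longrightarrow> (\<lambda>x. c * v x) \<in> L2"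
  using borel_measurable_times[of "\<lambda>_. c" \<mu> v] by (simp add: L2_iff power_mult_distrib)

lemma L2_diff: assumes "v \<in> L2" "w \<in> L2" shows "(\<lambda>x. v x - w x) \<in> L2"
  using L2_add[OF assms(1) L2_cmult[OF assms(2), of "-1"]] by simp

lemma L2_integrable: "v \<in> L2 \<Longrightarrow> integrable \<mu> v"
  using L2_times_integrable[OF _ L2_const[of 1]] by simp

lemma sq_norm_AE_cong:
  assumes "AE x in \<mu>. v x = w x" "v \<in> borel_measurable \<mu>" shows "sq_norm v = sq_norm w"
  unfolding sq_norm_def
  by (rule integral_cong_AE) (use assms measurable_AE_cong[OF assms(2,1)] in \<open>auto elim: eventually_mono\<close>)

lemma sq_norm_eq_0_iff: "v \<in> L2 \<Longrightarrow> sq_norm v = 0 \<longleftrightarrow> (AE x in \<mu>. v x = 0)"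
  unfolding sq_norm_def by (subst integral_nonneg_eq_0_iff_AE) (auto simp: L2_iff)

lemma sq_norm_cmult: "sq_norm (\<lambda>x. c * v x) = c\<^sup>2 * sq_norm v"
  by (simp add: sq_norm_def power_mult_distrib)

lemma sq_norm_minus_commute: "sq_norm (\<lambda>x. v x - w x) = sq_norm (\<lambda>x. w x - v x)"
  by (simp add: sq_norm_def power2_commute)

lemma sq_norm_mono:
  assumes "AE x in \<mu>. \<bar>v x\<bar> \<le> \<bar>w x\<bar>" "v \<in> L2" "w \<in> L2" shows "sq_norm v \<le> sq_norm w"
  unfolding sq_norm_def
  by (rule integral_mono_AE) (use assms in \<open>auto simp: L2_iff abs_le_square_iff elim: eventually_mono\<close>)

lemma sq_norm_add_le:
  assumes "v \<in> L2" "w \<in> L2"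
  shows "sq_norm (\<lambda>x. v x + w x) \<le> 2 * sq_norm v + 2 * sq_norm w"
proof -
  have "(a + b)\<^sup>2 \<le> 2 * a\<^sup>2 + 2 * b\<^sup>2" for a b :: real
    using zero_le_power2[of "a - b"] by (simp add: power2_sum power2_diff)
  then have "sq_norm (\<lambda>x. v x + w x) \<le> (LINT x|\<mu>. 2 * (v x)\<^sup>2 + 2 * (w x)\<^sup>2)"
    unfolding sq_norm_def using assms L2_add[OF assms] by (intro integral_mono) (auto simp: L2_iff)
  also have "\<dots> = 2 * sq_norm v + 2 * sq_norm w"
    using assms by (simp add: sq_norm_def L2_iff)
  finally show ?thesis .
qed

text \<open>
  Nonnegativity of \<open>\<parallel>v - t w\<parallel>\<^sup>2\<close> at the minimising \<open>t\<close>.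
\<close>

lemma Cauchy_Schwarz_L2:
  assumes "v \<in> L2" "w \<in> L2"
  shows "\<bar>LINT x|\<mu>. v x * w x\<bar> \<le> sqrt (sq_norm v) * sqrt (sq_norm w)"
proof -
  let ?I = "LINT x|\<mu>. v x * w x"
  have "?I\<^sup>2 \<le> sq_norm v * sq_norm w"
  proof (cases "sq_norm w = 0")
    case True
    then have "AE x in \<mu>. w x = 0" using assms sq_norm_eq_0_iff by blast
    then have "?I = (LINT x|\<mu>. 0)"
      using assms by (intro integral_cong_AE) (auto simp: L2_iff elim: eventually_mono)
    then show ?thesis using True by simp
  next
    case False
    define t where "t = ?I / sq_norm w"
    have "0 \<le> sq_norm (\<lambda>x. v x - t * w x)" by (rule sq_norm_nonneg)
    also have "\<dots> = (LINT x|\<mu>. (v x)\<^sup>2 - 2 * t * (v x * w x) + t\<^sup>2 * (w x)\<^sup>2)"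
      unfolding sq_norm_def by (simp add: power2_diff power_mult_distrib algebra_simps)
    also have "\<dots> = sq_norm v - 2 * t * ?I + t\<^sup>2 * sq_norm w"
      using assms L2_times_integrable[OF assms] by (simp add: sq_norm_def L2_iff)
    also have "\<dots> = sq_norm v - ?I\<^sup>2 / sq_norm w"
      using False by (simp add: t_def power2_eq_square)
    finally show ?thesis
      using False sq_norm_nonneg[of w] by (simp add: field_simps)
  qed
  then have "sqrt (?I\<^sup>2) \<le> sqrt (sq_norm v * sq_norm w)" by (rule real_sqrt_le_mono)
  then show ?thesis by (simp add: real_sqrt_mult)
qed

definition L2_tendsto :: "(nat \<Rightarrow> real ^ 'n \<Rightarrow> real) \<Rightarrow> (real ^ 'n \<Rightarrow> real) \<Rightarrow> bool" where
  "L2_tendsto vs v \<longleftrightarrow> (\<forall>n. vs n \<in> L2) \<and> v \<in> L2 \<and> (\<lambda>n. sq_norm (\<lambda>x. vs n x - v x)) \<longlonglongrightarrow> 0"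

lemma L2_tendsto_L2: "L2_tendsto vs v \<Longrightarrow> vs n \<in> L2" "L2_tendsto vs v \<Longrightarrow> v \<in> L2"
  by (auto simp: L2_tendsto_def)

lemma L2_tendsto_squeeze:
  assumes "\<And>n. vs n \<in> L2" "v \<in> L2" "\<And>n. sq_norm (\<lambda>x. vs n x - v x) \<le> c n" "c \<longlonglongrightarrow> 0"
  shows "L2_tendsto vs v"
  unfolding L2_tendsto_def
  using assms by (auto intro!: tendsto_sandwich[OF _ _ tendsto_const assms(4)] sq_norm_nonneg always_eventually)

lemma L2_tendsto_const: "v \<in> L2 \<Longrightarrow> L2_tendsto (\<lambda>_. v) v"
  by (simp add: L2_tendsto_def sq_norm_def)

lemma L2_tendsto_add:
  assumes "L2_tendsto vs v" "L2_tendsto ws w"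
  shows "L2_tendsto (\<lambda>n x. vs n x + ws n x) (\<lambda>x. v x + w x)"
proof (rule L2_tendsto_squeeze)
  show "sq_norm (\<lambda>x. vs n x + ws n x - (v x + w x))
      \<le> 2 * sq_norm (\<lambda>x. vs n x - v x) + 2 * sq_norm (\<lambda>x. ws n x - w x)" for n
    using sq_norm_add_le[OF L2_diff L2_diff, of "vs n" v "ws n" w] assms
    by (simp add: L2_tendsto_def algebra_simps)
  show "(\<lambda>n. 2 * sq_norm (\<lambda>x. vs n x - v x) + 2 * sq_norm (\<lambda>x. ws n x - w x)) \<longlonglongrightarrow> 0"
    using assms by (auto simp: L2_tendsto_def intro!: tendsto_eq_intros)
qed (use assms in \<open>auto simp: L2_tendsto_def intro: L2_add\<close>)

lemma L2_tendsto_cmult: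
  assumes "L2_tendsto vs v" shows "L2_tendsto (\<lambda>n x. c * vs n x) (\<lambda>x. c * v x)"
proof (rule L2_tendsto_squeeze)
  show "sq_norm (\<lambda>x. c * vs n x - c * v x) \<le> c\<^sup>2 * sq_norm (\<lambda>x. vs n x - v x)" for n
    using sq_norm_cmult[of c "\<lambda>x. vs n x - v x"] by (simp add: right_diff_distrib)
  show "(\<lambda>n. c\<^sup>2 * sq_norm (\<lambda>x. vs n x - v x)) \<longlonglongrightarrow> 0"
    using assms by (auto simp: L2_tendsto_def intro!: tendsto_eq_intros)
qed (use assms in \<open>auto simp: L2_tendsto_def intro: L2_cmult\<close>)

lemma L2_tendsto_diff:
  assumes "L2_tendsto vs v" "L2_tendsto ws w"
  shows "L2_tendsto (\<lambda>n x. vs n x - ws n x) (\<lambda>x. v x - w x)"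
  using L2_tendsto_add[OF assms(1) L2_tendsto_cmult[OF assms(2), of "-1"]] by simp

lemma L2_tendsto_inner:
  assumes "L2_tendsto vs v" "L2_tendsto ws w"
  shows "(\<lambda>n. LINT x|\<mu>. vs n x * ws n x) \<longlonglongrightarrow> (LINT x|\<mu>. v x * w x)"
proof -
  let ?N = "\<lambda>vs v n. sqrt (sq_norm (\<lambda>x. vs n x - v x))"
  have L: "vs n \<in> L2" "ws n \<in> L2" "v \<in> L2" "w \<in> L2" for n using assms by (auto simp: L2_tendsto_def)
  have N0: "?N vs v \<longlonglongrightarrow> 0" "?N ws w \<longlonglongrightarrow> 0"
    using assms tendsto_real_sqrt[of "\<lambda>n. sq_norm (\<lambda>x. vs n x - v x)" 0]
      tendsto_real_sqrt[of "\<lambda>n. sq_norm (\<lambda>x. ws n x - w x)" 0] by (simp_all add: L2_tendsto_def)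
  have bound: "\<bar>(LINT x|\<mu>. vs n x * ws n x) - (LINT x|\<mu>. v x * w x)\<bar>
     \<le> ?N vs v n * ?N ws w n + ?N vs v n * sqrt (sq_norm w) + sqrt (sq_norm v) * ?N ws w n" for n
  proof -
    have "(LINT x|\<mu>. vs n x * ws n x) - (LINT x|\<mu>. v x * w x) =
       (LINT x|\<mu>. (vs n x - v x) * (ws n x - w x) + (vs n x - v x) * w x + v x * (ws n x - w x))"
      by (subst Bochner_Integration.integral_diff[symmetric], intro L2_times_integrable L, intro
          L2_times_integrable L)
        (rule arg_cong[where f="integral\<^sup>L \<mu>"], intro ext, simp add: algebra_simps)
    also have "\<dots> = (LINT x|\<mu>. (vs n x - v x) * (ws n x - w x)) + (LINT x|\<mu>. (vs n x - v x) * w x)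
        + (LINT x|\<mu>. v x * (ws n x - w x))"
      using L by (simp add: L2_times_integrable L2_diff)
    finally have eq: "(LINT x|\<mu>. vs n x * ws n x) - (LINT x|\<mu>. v x * w x)
      = (LINT x|\<mu>. (vs n x - v x) * (ws n x - w x)) + (LINT x|\<mu>. (vs n x - v x) * w x)
        + (LINT x|\<mu>. v x * (ws n x - w x))" .
    have "\<bar>LINT x|\<mu>. (vs n x - v x) * (ws n x - w x)\<bar> \<le> ?N vs v n * ?N ws w n"
      "\<bar>LINT x|\<mu>. (vs n x - v x) * w x\<bar> \<le> ?N vs v n * sqrt (sq_norm w)"
      "\<bar>LINT x|\<mu>. v x * (ws n x - w x)\<bar> \<le> sqrt (sq_norm v) * ?N ws w n"
      by (intro Cauchy_Schwarz_L2 L2_diff L)+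
    then show ?thesis unfolding eq by linarith
  qed
  have lim: "(\<lambda>n. ?N vs v n * ?N ws w n + ?N vs v n * sqrt (sq_norm w) + sqrt (sq_norm v) * ?N ws w n) \<longlonglongrightarrow> 0"
    using tendsto_add[OF tendsto_add[OF tendsto_mult[OF N0] tendsto_mult_right[OF N0(1), of "sqrt (sq_norm w)"]]
        tendsto_mult_left[OF N0(2), of "sqrt (sq_norm v)"]]
    unfolding mult_zero_left mult_zero_right add_0_right .
  have "(\<lambda>n. (LINT x|\<mu>. vs n x * ws n x) - (LINT x|\<mu>. v x * w x)) \<longlonglongrightarrow> 0"
    by (rule Lim_null_comparison[OF always_eventually lim]) (use bound in simp)
  then show ?thesis by (rule LIM_zero_cancel)
qed

lemma L2_tendsto_subseq:
  assumes "L2_tendsto vs v" "strict_mono r" shows "L2_tendsto (\<lambda>n. vs (r n)) v"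
  using assms LIMSEQ_subseq_LIMSEQ[of _ 0 r] by (auto simp: L2_tendsto_def o_def)

lemma L2_tendsto_AE_subseq:
  assumes "L2_tendsto vs v"
  obtains r where "strict_mono (r :: nat \<Rightarrow> nat)" "AE x in \<mu>. (\<lambda>n. vs (r n) x) \<longlonglongrightarrow> v x"
proof -
  have "\<exists>r::nat\<Rightarrow>nat. strict_mono r \<and> (AE x in \<mu>. (\<lambda>n. (vs (r n) x - v x)\<^sup>2) \<longlonglongrightarrow> 0)"
  proof (rule tendsto_L1_AE_subseq[of \<mu> "\<lambda>n x. (vs n x - v x)\<^sup>2"])
    show "integrable \<mu> (\<lambda>x. (vs n x - v x)\<^sup>2)" for n
      using L2_diff assms by (auto simp: L2_tendsto_def L2_iff)
  qed (use assms in \<open>simp add: L2_tendsto_def sq_norm_def\<close>)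
  then obtain r where r: "strict_mono (r :: nat \<Rightarrow> nat)" "AE x in \<mu>. (\<lambda>n. (vs (r n) x - v x)\<^sup>2) \<longlonglongrightarrow> 0" by blast
  have "AE x in \<mu>. (\<lambda>n. vs (r n) x) \<longlonglongrightarrow> v x"
    using r(2)
  proof eventually_elim
    case (elim x)
    then have "(\<lambda>n. sqrt ((vs (r n) x - v x)\<^sup>2)) \<longlonglongrightarrow> 0" using tendsto_real_sqrt by fastforce
    then show ?case by (simp add: tendsto_rabs_zero_iff LIM_zero_iff)
  qed
  with r(1) that show thesis by blast
qed

lemma L2_tendsto_dominated:
  assumes "w \<in> L2" "\<And>n. vs n \<in> borel_measurable \<mu>" "v \<in> borel_measurable \<mu>"
    and lim: "AE x in \<mu>. (\<lambda>n. vs n x) \<longlonglongrightarrow> v x"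
    and dom: "\<And>n. AE x in \<mu>. \<bar>vs n x\<bar> \<le> w x"
  shows "L2_tendsto vs v"
proof -
  have dom': "AE x in \<mu>. \<forall>n. \<bar>vs n x\<bar> \<le> w x" using dom by (simp add: AE_all_countable)
  have v: "AE x in \<mu>. \<bar>v x\<bar> \<le> w x"
    using lim dom' by eventually_elim (auto intro!: LIMSEQ_le_const2[OF tendsto_rabs])
  have L: "vs n \<in> L2" for n
    by (rule L2_dominated[OF assms(1,2)]) (rule eventually_mono[OF dom[of n]], simp)
  have Lv: "v \<in> L2"
    by (rule L2_dominated[OF assms(1,3)]) (rule eventually_mono[OF v], simp)
  have "(\<lambda>n. LINT x|\<mu>. (vs n x - v x)\<^sup>2) \<longlonglongrightarrow> (LINT x|\<mu>. 0)"
  proof (rule integral_dominated_convergence[where w="\<lambda>x. (2 * w x)\<^sup>2"])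
    show "integrable \<mu> (\<lambda>x. (2 * w x)\<^sup>2)" using assms(1) by (simp add: L2_iff power_mult_distrib)
    show "AE x in \<mu>. (\<lambda>n. (vs n x - v x)\<^sup>2) \<longlonglongrightarrow> 0"
      using lim by eventually_elim (auto intro!: tendsto_eq_intros)
    show "AE x in \<mu>. norm ((vs n x - v x)\<^sup>2) \<le> (2 * w x)\<^sup>2" for n
      using dom[of n] v
    proof eventually_elim
      case (elim x)
      then have "\<bar>vs n x - v x\<bar> \<le> \<bar>2 * w x\<bar>" by linarith
      then show ?case by (simp add: abs_le_square_iff)
    qed
  qed (use assms in auto)
  then show ?thesis using L Lv by (simp add: L2_tendsto_def sq_norm_def)
qed

text \<open>
  Riesz--Fischer: on a finite measure space the sequence is Cauchy in mean, so a subsequence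
  converges almost everywhere, and Fatou's lemma carries the Cauchy estimate over to its limit.
\<close>

lemma L2_complete:
  assumes L: "\<And>n. vs n \<in> L2"
    and Cauchy: "\<And>e. e > 0 \<Longrightarrow> \<exists>M. \<forall>m\<ge>M. \<forall>n\<ge>M. sq_norm (\<lambda>x. vs m x - vs n x) < e"
  obtains v where "L2_tendsto vs v"
proof -
  have meas [measurable]: "vs n \<in> borel_measurable \<mu>" for n using L L2_measurable by blast
  obtain r where r: "strict_mono r" "AE x in \<mu>. Cauchy (\<lambda>i. vs (r i) x)"
  proof (rule cauchy_L1_AE_cauchy_subseq[of \<mu> vs])
    fix e :: real assume e: "e > 0"
    \<comment> \<open>the norm of the constant one bounds the mean by the square norm; adding one makes it positive\<close>
    define c where "c = sqrt (sq_norm (\<lambda>_. 1)) + 1"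
    have c: "c > 0" using sq_norm_nonneg by (simp add: c_def add_nonneg_pos)
    obtain M where M: "\<And>m n. m \<ge> M \<Longrightarrow> n \<ge> M \<Longrightarrow> sq_norm (\<lambda>x. vs m x - vs n x) < (e / c)\<^sup>2"
      using Cauchy[of "(e / c)\<^sup>2"] e c by auto
    have "(LINT x|\<mu>. norm (vs i x - vs j x)) < e" if "i \<ge> M" "j \<ge> M" for i j
    proof -
      have L': "(\<lambda>x. \<bar>vs i x - vs j x\<bar>) \<in> L2"
        by (rule L2_dominated[OF L2_diff[OF L L]]) auto
      have "(LINT x|\<mu>. norm (vs i x - vs j x)) \<le> sqrt (sq_norm (\<lambda>x. \<bar>vs i x - vs j x\<bar>)) * sqrt
          (sq_norm (\<lambda>_. 1))"
        using Cauchy_Schwarz_L2[OF L' L2_const[of 1]] by simp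
      also have "sq_norm (\<lambda>x. \<bar>vs i x - vs j x\<bar>) = sq_norm (\<lambda>x. vs i x - vs j x)" by (simp add: sq_norm_def)
      also have "sqrt (sq_norm (\<lambda>x. vs i x - vs j x)) * sqrt (sq_norm (\<lambda>_. 1))
            \<le> sqrt (sq_norm (\<lambda>x. vs i x - vs j x)) * c"
        by (rule mult_left_mono) (auto simp: c_def sq_norm_nonneg)
      also have "\<dots> < (e / c) * c"
        using c e M[OF that] by (intro mult_strict_right_mono real_less_lsqrt) auto
      finally show ?thesis using c by simp
    qed
    then show "\<exists>M. \<forall>i\<ge>M. \<forall>j\<ge>M. (LINT x|\<mu>. norm (vs i x - vs j x)) < e" by blast
  qed (use L L2_integrable in auto)
  define v where "v x = lim (\<lambda>i. vs (r i) x)" for x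
  have [measurable]: "v \<in> borel_measurable \<mu>" unfolding v_def by measurable
  have lim: "AE x in \<mu>. (\<lambda>i. vs (r i) x) \<longlonglongrightarrow> v x"
    using r(2) by eventually_elim (simp add: v_def Cauchy_convergent_iff convergent_LIMSEQ_iff)
  have est: "integrable \<mu> (\<lambda>x. (vs m x - v x)\<^sup>2) \<and> sq_norm (\<lambda>x. vs m x - v x) \<le> e"
    if e: "e > 0" and M: "\<And>m n. m \<ge> M \<Longrightarrow> n \<ge> M \<Longrightarrow> sq_norm (\<lambda>x. vs m x - vs n x) < e" and m: "m \<ge> M" for e M m
  proof -
    have "(\<integral>\<^sup>+x. ennreal ((vs m x - v x)\<^sup>2) \<partial>\<mu>) = (\<integral>\<^sup>+x. liminf (\<lambda>k. ennreal ((vs m x - vs (r k) x)\<^sup>2)) \<partial>\<mu>)"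
    proof (rule nn_integral_cong_AE)
      show "AE x in \<mu>. ennreal ((vs m x - v x)\<^sup>2) = liminf (\<lambda>k. ennreal ((vs m x - vs (r k) x)\<^sup>2))"
        using lim
      proof eventually_elim
        case (elim x)
        then have "(\<lambda>k. ennreal ((vs m x - vs (r k) x)\<^sup>2)) \<longlonglongrightarrow> ennreal ((vs m x - v x)\<^sup>2)"
          by (intro tendsto_ennrealI tendsto_intros)
        from lim_imp_Liminf[OF trivial_limit_sequentially this] show ?case by (rule sym)
      qed
    qed
    also have "\<dots> \<le> liminf (\<lambda>k. \<integral>\<^sup>+x. ennreal ((vs m x - vs (r k) x)\<^sup>2) \<partial>\<mu>)"
      by (rule nn_integral_liminf) auto
    also have "\<dots> \<le> ennreal e"
    proof (rule Liminf_le)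
      have "(\<integral>\<^sup>+x. ennreal ((vs m x - vs (r k) x)\<^sup>2) \<partial>\<mu>) \<le> ennreal e" if "k \<ge> M" for k
      proof -
        have "r k \<ge> M" using seq_suble[OF r(1), of k] that by simp
        then have "sq_norm (\<lambda>x. vs m x - vs (r k) x) \<le> e" using M m less_imp_le by blast
        moreover have "(\<integral>\<^sup>+x. ennreal ((vs m x - vs (r k) x)\<^sup>2) \<partial>\<mu>)
            = ennreal (sq_norm (\<lambda>x. vs m x - vs (r k) x))"
          unfolding sq_norm_def using L2_diff[OF L L] by (intro nn_integral_eq_integral) (auto simp: L2_iff)
        ultimately show ?thesis by (simp add: ennreal_leI)
      qed
      then show "\<forall>\<^sub>F k in sequentially. (\<integral>\<^sup>+x. ennreal ((vs m x - vs (r k) x)\<^sup>2) \<partial>\<mu>) \<le> ennreal e"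
        by (auto simp: eventually_sequentially)
    qed simp
    finally have *: "(\<integral>\<^sup>+x. ennreal ((vs m x - v x)\<^sup>2) \<partial>\<mu>) \<le> ennreal e" .
    have i: "integrable \<mu> (\<lambda>x. (vs m x - v x)\<^sup>2)"
      by (rule integrableI_bounded) (use * in \<open>auto simp: le_less_trans[OF * ennreal_less_top]\<close>)
    moreover have "sq_norm (\<lambda>x. vs m x - v x) \<le> e"
      using * e nn_integral_eq_integral[OF i] by (simp add: sq_norm_def)
    ultimately show ?thesis by blast
  qed
  have "v \<in> L2"
  proof -
    obtain M where M: "\<And>m n. m \<ge> M \<Longrightarrow> n \<ge> M \<Longrightarrow> sq_norm (\<lambda>x. vs m x - vs n x) < 1"
      using Cauchy[of 1] by auto
    have "(\<lambda>x. vs M x - v x) \<in> L2" using est[OF _ M, of M] by (simp add: L2_iff)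
    from L2_diff[OF L[of M] this] show ?thesis by simp
  qed
  moreover have "(\<lambda>n. sq_norm (\<lambda>x. vs n x - v x)) \<longlonglongrightarrow> 0"
  proof (rule LIMSEQ_I)
    fix e :: real assume e: "e > 0"
    then obtain M where M: "\<And>m n. m \<ge> M \<Longrightarrow> n \<ge> M \<Longrightarrow> sq_norm (\<lambda>x. vs m x - vs n x) < e / 2"
      using Cauchy[of "e/2"] by auto
    have "norm (sq_norm (\<lambda>x. vs n x - v x) - 0) < e" if "n \<ge> M" for n
      using est[OF _ M that] e sq_norm_nonneg[of "\<lambda>x. vs n x - v x"] by auto
    then show "\<exists>no. \<forall>n\<ge>no. norm (sq_norm (\<lambda>x. vs n x - v x) - 0) < e" by blast
  qed
  ultimately show thesis using that L by (auto simp: L2_tendsto_def)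
qed

end

section \<open>Weak derivatives and the space of functions with zero boundary values\<close>

context bounded_domain
begin

lemma smooth_measurable: "smooth \<phi> \<Longrightarrow> \<phi> \<in> borel_measurable \<mu>"
  by (intro measurable_restrict_space1 measurable_completion) (simp add: smooth_borel_measurable)

lemma smooth_bounded:
  assumes "smooth \<phi>" obtains B where "B > 0" "\<And>x. x \<in> \<Omega> \<Longrightarrow> \<bar>\<phi> x\<bar> \<le> B"
proof -
  have "compact (closure \<Omega>)" using bounded_dom by (simp add: compact_closure)
  then show thesis
    using smooth_bounded_on_compact[OF assms] that closure_subset by (metis subsetD)
qed

lemma smooth_L2: assumes "smooth \<phi>" shows "\<phi> \<in> L2"
proof -
  obtain B where "B > 0" "\<And>x. x \<in> \<Omega> \<Longrightarrow> \<bar>\<phi> x\<bar> \<le> B"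
    using smooth_bounded[OF assms] by blast
  then show ?thesis by (intro L2_bounded[of _ B] smooth_measurable assms AE_I2) auto
qed

lemma test_L2: "\<phi> \<in> test_functions \<Omega> \<Longrightarrow> \<phi> \<in> L2"
  by (intro smooth_L2 test_smooth)

lemma test_deriv_L2: "\<phi> \<in> test_functions \<Omega> \<Longrightarrow> partial_deriv i \<phi> \<in> L2"
  by (intro test_L2 test_partial_deriv)

lemma integral_partial_deriv:
  assumes "\<phi> \<in> test_functions \<Omega>" shows "(LINT x|\<mu>. partial_deriv i \<phi> x) = 0"
proof -
  have "partial_deriv i \<phi> x = 0" if "x \<notin> \<Omega>" for x
    using test_functionsE[OF test_partial_deriv[OF assms]] that by (metis subsetD)
  then have eq: "indicator \<Omega> x *\<^sub>R partial_deriv i \<phi> x = partial_deriv i \<phi> x" for x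
    by (cases "x \<in> \<Omega>") auto
  have "(LINT x|\<mu>. partial_deriv i \<phi> x) = (LINT x|lebesgue. partial_deriv i \<phi> x)"
    using domain_sets by (subst integral_restrict_space) (simp_all only: eq, simp)
  also have "\<dots> = (LINT x|lborel. partial_deriv i \<phi> x)"
    using smooth_borel_measurable[OF smooth_partial_deriv[OF test_smooth[OF assms]]]
    by (intro integral_completion) simp
  finally show ?thesis using integral_partial_deriv_lborel[OF assms] by simp
qed

text \<open>
  The product of a test function and a smooth function is a test function, whose derivative has
  integral zero.
\<close>

lemma integration_by_parts:
  assumes "\<phi> \<in> test_functions \<Omega>" "smooth \<psi>"
  shows "(LINT x|\<mu>. \<psi> x * partial_deriv i \<phi> x) = - (LINT x|\<mu>. partial_deriv i \<psi> x * \<phi> x)"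
proof -
  note s = test_smooth[OF assms(1)] assms(2)
  have "0 = (LINT x|\<mu>. \<psi> x * partial_deriv i \<phi> x + partial_deriv i \<psi> x * \<phi> x)"
    using integral_partial_deriv[OF test_mult[OF assms], of i] s by (simp add: partial_deriv_mult)
  also have "\<dots> = (LINT x|\<mu>. \<psi> x * partial_deriv i \<phi> x) + (LINT x|\<mu>. partial_deriv i \<psi> x * \<phi> x)"
    using s by (intro Bochner_Integration.integral_add L2_times_integrable)
        (auto intro: smooth_L2 smooth_partial_deriv)
  finally show ?thesis by linarith
qed

text \<open>
  Integrating the derivative of \<open>x\<^sub>i \<phi>\<^sup>2\<close> gives the Poincare inequality: the factor \<open>x\<^sub>i\<close> is bounded
  on the domain and has derivative one.
\<close>

definition poincare_const :: real where
  "poincare_const = (SOME C. C > 0 \<and> (\<forall>i. \<forall>x\<in>\<Omega>. (2 * \<bar>x $ i\<bar>)\<^sup>2 \<le> C))"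

lemma poincare_const: "poincare_const > 0" "x \<in> \<Omega> \<Longrightarrow> (2 * \<bar>x $ i\<bar>)\<^sup>2 \<le> poincare_const"
proof -
  obtain R where R: "R > 0" "\<And>x. x \<in> \<Omega> \<Longrightarrow> norm x \<le> R"
    using bounded_dom by (auto simp: bounded_pos)
  have "(2 * \<bar>x $ i\<bar>)\<^sup>2 \<le> (2 * R)\<^sup>2" if "x \<in> \<Omega>" for x i
    using R(2)[OF that] component_le_norm_cart[of x i] by (intro power_mono) auto
  then have "\<exists>C. C > 0 \<and> (\<forall>i. \<forall>x\<in>\<Omega>. (2 * \<bar>x $ i\<bar>)\<^sup>2 \<le> C)"
    using R(1) by (intro exI[of _ "(2 * R)\<^sup>2"]) auto
  from someI_ex[OF this]
  show "poincare_const > 0" "x \<in> \<Omega> \<Longrightarrow> (2 * \<bar>x $ i\<bar>)\<^sup>2 \<le> poincare_const"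
    unfolding poincare_const_def by auto
qed

lemma poincare_test:
  assumes "\<phi> \<in> test_functions \<Omega>"
  shows "sq_norm \<phi> \<le> poincare_const * sq_norm (partial_deriv i \<phi>)"
proof -
  note s = test_smooth[OF assms]
  let ?C = poincare_const
  have L: "\<phi> \<in> L2" "partial_deriv i \<phi> \<in> L2" using assms test_L2 test_deriv_L2 by auto
  have "partial_deriv i (\<lambda>x. x $ i * \<phi> x * \<phi> x) x = (\<phi> x)\<^sup>2 + 2 * (x $ i) * \<phi> x * partial_deriv i \<phi> x" for x
    using s by (simp add: partial_deriv_mult smooth_mult smooth_coord partial_deriv_coord power2_eq_square
        algebra_simps)
  then have "0 = (LINT x|\<mu>. (\<phi> x)\<^sup>2 + 2 * (x $ i) * \<phi> x * partial_deriv i \<phi> x)"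
    using integral_partial_deriv[OF test_mult[OF assms smooth_mult[OF smooth_coord s]], of i i] by simp
  moreover have "(LINT x|\<mu>. (1/2) * (\<phi> x)\<^sup>2 - (?C / 2) * (partial_deriv i \<phi> x)\<^sup>2)
      \<le> (LINT x|\<mu>. (\<phi> x)\<^sup>2 + 2 * (x $ i) * \<phi> x * partial_deriv i \<phi> x)"
  proof (rule integral_mono)
    show "integrable \<mu> (\<lambda>x. 1 / 2 * (\<phi> x)\<^sup>2 - ?C / 2 * (partial_deriv i \<phi> x)\<^sup>2)"
      using L by (simp add: L2_iff)
    have "(\<lambda>x. 2 * (x $ i) * \<phi> x) \<in> L2"
      using smooth_L2[OF smooth_mult[OF smooth_mult[OF smooth_const[of 2] smooth_coord[of i]] s]] by simp
    then show "integrable \<mu> (\<lambda>x. (\<phi> x)\<^sup>2 + 2 * x $ i * \<phi> x * partial_deriv i \<phi> x)"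
      using L L2_times_integrable by (simp add: L2_iff)
    fix x assume "x \<in> space \<mu>"
    then have "(2 * \<bar>x $ i\<bar>)\<^sup>2 \<le> ?C" using poincare_const(2) by simp
    then have "(2 * \<bar>x $ i\<bar>)\<^sup>2 * (partial_deriv i \<phi> x)\<^sup>2 \<le> ?C * (partial_deriv i \<phi> x)\<^sup>2"
      by (rule mult_right_mono) simp
    moreover have "0 \<le> (\<phi> x + 2 * (x $ i) * partial_deriv i \<phi> x)\<^sup>2" by simp
    ultimately show "1 / 2 * (\<phi> x)\<^sup>2 - ?C / 2 * (partial_deriv i \<phi> x)\<^sup>2
        \<le> (\<phi> x)\<^sup>2 + 2 * x $ i * \<phi> x * partial_deriv i \<phi> x"
      by (simp add: power2_sum power_mult_distrib) (simp add: algebra_simps)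
  qed
  ultimately have "(1/2) * sq_norm \<phi> - (?C / 2) * sq_norm (partial_deriv i \<phi>) \<le> 0"
    using L by (simp add: sq_norm_def L2_iff)
  then show ?thesis by simp
qed

text \<open>
  Products of one-dimensional cut-offs increase to the indicator of an open box.
\<close>

definition bump :: "real ^ 'n \<Rightarrow> real ^ 'n \<Rightarrow> nat \<Rightarrow> real ^ 'n \<Rightarrow> real" where
  "bump a b k x = (\<Prod>j\<in>UNIV. flat 1 (Suc k * (x $ j - a $ j)) * flat 1 (Suc k * (b $ j - x $ j)))"

lemma flat_1_bounds: "0 \<le> flat 1 t" "flat 1 t \<le> 1"
  by (auto simp: flat_def)

lemma bump_bounds: "0 \<le> bump a b k x" "bump a b k x \<le> 1"
  unfolding bump_def by (auto intro!: prod_nonneg prod_le_1 mult_nonneg_nonneg mult_le_one flat_1_bounds)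

lemma bump_eq_0: "x \<notin> box a b \<Longrightarrow> bump a b k x = 0"
  by (auto simp: bump_def mem_box_cart flat_def prod_zero_iff zero_less_mult_iff)

lemma bump_tendsto: "(\<lambda>k. bump a b k x) \<longlonglongrightarrow> indicator (box a b) x"
proof (cases "x \<in> box a b")
  case True
  have 1: "(\<lambda>k. flat 1 (Suc k * s)) \<longlonglongrightarrow> 1" if "s > 0" for s :: real
  proof -
    have "(\<lambda>k. exp (- (inverse (real (Suc k)) * (1 / s)))) \<longlonglongrightarrow> exp (- (0 * (1 / s)))"
      by (intro tendsto_intros LIMSEQ_inverse_real_of_nat)
    moreover have "exp (- (inverse (real (Suc k)) * (1 / s))) = flat 1 (Suc k * s)" for k
      using that by (simp add: flat_def zero_less_mult_iff divide_inverse del: of_nat_Suc)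
    ultimately show ?thesis by simp
  qed
  have "(\<lambda>k. bump a b k x) \<longlonglongrightarrow> (\<Prod>j\<in>(UNIV :: 'n set). 1 * 1)"
    unfolding bump_def using True by (intro tendsto_prod tendsto_mult 1) (auto simp: mem_box_cart)
  then show ?thesis using True by simp
next
  case False
  then show ?thesis by (simp add: bump_eq_0)
qed

lemma bump_test:
  assumes "cbox a b \<subseteq> \<Omega>" shows "bump a b k \<in> test_functions \<Omega>"
proof (rule test_functionsI[of _ "cbox a b"])
  show "smooth (bump a b k)"
    unfolding bump_def
    by (intro smooth_prod smooth_mult smooth_flat smooth_diff smooth_cmult smooth_const smooth_coord) auto
  show "bump a b k x = 0" if "x \<notin> cbox a b" for x
    using that box_subset_cbox bump_eq_0 by blast
qed (use assms in auto)

text \<open>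
  A function that annihilates the test functions has vanishing integrals over small boxes, and so
  vanishes by Lebesgue differentiation.
\<close>

lemma fundamental_lemma:
  assumes int: "integrable \<mu> g"
    and zero: "\<And>\<phi>. \<phi> \<in> test_functions \<Omega> \<Longrightarrow> (LINT x|\<mu>. g x * \<phi> x) = 0"
  shows "AE x in \<mu>. g x = 0"
proof -
  define g0 where "g0 x = indicator \<Omega> x *\<^sub>R g x" for x
  have g0: "integrable lebesgue g0"
    using int domain_sets by (simp add: g0_def[abs_def] integrable_restrict_space)
  have box0: "(LINT x|\<mu>. g x * indicator (box a b) x) = 0" if "cbox a b \<subseteq> \<Omega>" for a b
  proof -
    have "(\<lambda>k. LINT x|\<mu>. g x * bump a b k x) \<longlonglongrightarrow> (LINT x|\<mu>. g x * indicator (box a b) x)"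
    proof (rule integral_dominated_convergence[where w="\<lambda>x. \<bar>g x\<bar>"])
      show "AE x in \<mu>. (\<lambda>k. g x * bump a b k x) \<longlonglongrightarrow> g x * indicator (box a b) x"
        by (intro AE_I2 tendsto_mult_left bump_tendsto)
      show "AE x in \<mu>. norm (g x * bump a b k x) \<le> \<bar>g x\<bar>" for k
        using bump_bounds[of a b k] by (intro AE_I2) (auto simp: abs_mult intro: mult_left_le)
      have [measurable]: "bump a b k \<in> borel_measurable \<mu>" for k
        using smooth_measurable test_smooth bump_test[OF that] by blast
      show "(\<lambda>x. g x * bump a b k x) \<in> borel_measurable \<mu>" for k
        using int by (intro borel_measurable_times) auto
      have "box a b \<inter> \<Omega> \<in> sets \<mu>" using domain_sets by (auto simp: sets_restrict_space)
      then have "(indicator (box a b) :: _ \<Rightarrow> real) \<in> borel_measurable \<mu>"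
        by (intro borel_measurable_indicator_iff[THEN iffD2]) (simp add: Int_commute)
      then show "(\<lambda>x. g x * indicator (box a b) x) \<in> borel_measurable \<mu>"
        using int by (intro borel_measurable_times) auto
      show "integrable \<mu> (\<lambda>x. \<bar>g x\<bar>)" using int by simp
    qed
    then show ?thesis using zero[OF bump_test[OF that]] by (simp add: LIMSEQ_const_iff)
  qed
  have g0on: "integrable (lebesgue_on S) g0" if "S \<in> sets lebesgue" for S
    using integrable_restrict_space[of S lebesgue g0] that integrable_mult_indicator[OF that g0] by simp
  have int_box: "integral (cbox a b) g0 = 0" if "cbox a b \<subseteq> \<Omega>" for a b
  proof -
    have "integral (cbox a b) g0 = integral (box a b) g0" by (simp add: integral_open_interval)
    also have "\<dots> = (LINT x|lebesgue_on (box a b). g0 x)"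
      by (rule lebesgue_integral_eq_integral[symmetric]) (auto intro: g0on)
    also have "\<dots> = (LINT x|lebesgue. indicator (box a b) x *\<^sub>R g0 x)"
      by (subst integral_restrict_space) auto
    also have "\<dots> = (LINT x|lebesgue. indicator \<Omega> x *\<^sub>R (g x * indicator (box a b) x))"
      by (rule arg_cong[where f="integral\<^sup>L lebesgue"]) (auto simp: g0_def)
    also have "\<dots> = (LINT x|\<mu>. g x * indicator (box a b) x)"
      using domain_sets by (subst integral_restrict_space) auto
    finally show ?thesis using box0[OF that] by simp
  qed
  have "g0 integrable_on cbox a b" for a b
    using g0on[of "cbox a b"] by (intro integrable_on_lebesgue_on) auto
  then obtain N where N: "negligible N"
    "\<And>x e. x \<notin> N \<Longrightarrow> 0 < e \<Longrightarrow> \<exists>d>0. \<forall>h. 0 < h \<and> h < d \<longrightarrow>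
        norm (integral (cbox x (x + h *\<^sub>R One)) g0 /\<^sub>R h ^ DIM(real ^ 'n) - g0 x) < e"
    using integrable_ccontinuous_explicit[of g0] by metis
  have "g x = 0" if x: "x \<in> \<Omega>" and xN: "x \<notin> N" for x
  proof (rule ccontr)
    assume "g x \<noteq> 0"
    then have "0 < \<bar>g x\<bar>" by simp
    from N(2)[OF xN this] obtain d where d: "d > 0"
      "\<And>h. 0 < h \<Longrightarrow> h < d \<Longrightarrow> norm (integral (cbox x (x + h *\<^sub>R One)) g0 /\<^sub>R h ^ DIM(real ^ 'n) - g0 x) < \<bar>g x\<bar>"
      by blast
    obtain r where r: "r > 0" "ball x r \<subseteq> \<Omega>"
      by (rule openE[OF open_domain x])
    \<comment> \<open>the cube of edge \<open>h\<close> at \<open>x\<close> has diameter less than \<open>h K\<close>\<close>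
    define K where "K = norm (One :: real ^ 'n) + 1"
    have K: "K > 0" by (simp add: K_def add_nonneg_pos)
    define h where "h = min (d / 2) (r / (2 * K))"
    have h: "0 < h" "h < d" "h \<le> r / (2 * K)" using d(1) r(1) K by (auto simp: h_def)
    have "cbox x (x + h *\<^sub>R One) \<subseteq> ball x r"
    proof
      fix z assume z: "z \<in> cbox x (x + h *\<^sub>R One)"
      have "norm (z - x) \<le> norm (h *\<^sub>R (One :: real ^ 'n))"
      proof (rule norm_le_componentwise)
        fix b :: "real ^ 'n" assume b: "b \<in> Basis"
        then have "x \<bullet> b \<le> z \<bullet> b" "z \<bullet> b \<le> x \<bullet> b + h" "(One :: real ^ 'n) \<bullet> b = 1"
          using z by (auto simp: mem_box inner_add_left)
        then show "\<bar>(z - x) \<bullet> b\<bar> \<le> \<bar>(h *\<^sub>R (One :: real ^ 'n)) \<bullet> b\<bar>"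
          using h(1) by (simp add: inner_diff_left)
      qed
      also have "\<dots> \<le> h * K" using h(1) by (simp add: K_def)
      also have "\<dots> \<le> r / (2 * K) * K" using K h(3) by (intro mult_right_mono) auto
      also have "\<dots> < r" using r(1) K by simp
      finally show "z \<in> ball x r" by (simp add: dist_norm norm_minus_commute)
    qed
    then have "integral (cbox x (x + h *\<^sub>R One)) g0 = 0" using int_box r(2) by blast
    then show False using d(2)[OF h(1,2)] x by (simp add: g0_def)
  qed
  moreover have "AE x in lebesgue. x \<notin> N"
    using N(1) by (intro AE_not_in) (simp add: negligible_iff_null_sets)
  ultimately have "AE x in lebesgue. x \<in> \<Omega> \<longrightarrow> g x = 0" by (auto elim: eventually_mono)
  then show ?thesis using domain_sets by (subst AE_restrict_space_iff) simp_all
qed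

text \<open>
  Together with the next lemmas, this makes the representative chosen by \<open>weak_deriv\<close> linear up to
  null sets.
\<close>

lemma weak_deriv_unique:
  assumes "is_weak_deriv \<Omega> i y g" "is_weak_deriv \<Omega> i y h" "g \<in> L2" "h \<in> L2"
  shows "AE x in \<mu>. g x = h x"
proof -
  have "AE x in \<mu>. g x - h x = 0"
  proof (rule fundamental_lemma)
    show "integrable \<mu> (\<lambda>x. g x - h x)" using assms L2_integrable by simp
    fix \<phi> assume \<phi>: "\<phi> \<in> test_functions \<Omega>"
    have "(LINT x|\<mu>. (g x - h x) * \<phi> x) = (LINT x|\<mu>. g x * \<phi> x) - (LINT x|\<mu>. h x * \<phi> x)"
      using assms \<phi> test_L2 L2_times_integrable by (simp add: left_diff_distrib)
    also have "\<dots> = 0" using assms(1,2) \<phi> unfolding is_weak_deriv_def by fastforce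
    finally show "(LINT x|\<mu>. (g x - h x) * \<phi> x) = 0" .
  qed
  then show ?thesis by simp
qed

text \<open>
  The pair of a function and its gradient is a limit of test functions and their gradients.  This
  form of membership in \<open>H10 \<Omega>\<close> keeps the gradient explicit and is closed under limits.
\<close>

definition H10_grad :: "(real ^ 'n \<Rightarrow> real) \<Rightarrow> ('n \<Rightarrow> real ^ 'n \<Rightarrow> real) \<Rightarrow> bool" where
  "H10_grad y g \<longleftrightarrow> (\<exists>\<phi>. (\<forall>n. \<phi> n \<in> test_functions \<Omega>) \<and> L2_tendsto \<phi> y
     \<and> (\<forall>i. L2_tendsto (\<lambda>n. partial_deriv i (\<phi> n)) (g i)))"

lemma H10_grad_L2: "H10_grad y g \<Longrightarrow> y \<in> L2" "H10_grad y g \<Longrightarrow> g i \<in> L2"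
  unfolding H10_grad_def using L2_tendsto_L2(2) by blast+

text \<open>
  Integration by parts passes to the limit.  With \<open>\<psi>\<close> not vanishing on the boundary this uses
  that \<open>y\<close> does.
\<close>

lemma H10_grad_by_parts:
  assumes "H10_grad y g" "smooth \<psi>"
  shows "(LINT x|\<mu>. \<psi> x * g i x) = - (LINT x|\<mu>. partial_deriv i \<psi> x * y x)"
proof -
  obtain \<phi> where \<phi>: "\<And>n. \<phi> n \<in> test_functions \<Omega>" "L2_tendsto \<phi> y"
    "L2_tendsto (\<lambda>n. partial_deriv i (\<phi> n)) (g i)"
    using assms(1) unfolding H10_grad_def by blast
  have "(\<lambda>n. LINT x|\<mu>. \<psi> x * partial_deriv i (\<phi> n) x) \<longlonglongrightarrow> (LINT x|\<mu>. \<psi> x * g i x)"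
    by (rule L2_tendsto_inner[OF L2_tendsto_const[OF smooth_L2[OF assms(2)]] \<phi>(3)])
  moreover have "(\<lambda>n. - (LINT x|\<mu>. partial_deriv i \<psi> x * \<phi> n x)) \<longlonglongrightarrow> - (LINT x|\<mu>. partial_deriv i \<psi> x * y x)"
    by (intro tendsto_minus L2_tendsto_inner[OF L2_tendsto_const \<phi>(2)] smooth_L2 smooth_partial_deriv assms)
  ultimately show ?thesis
    using integration_by_parts[OF \<phi>(1) assms(2)] LIMSEQ_unique by simp
qed

lemma H10_grad_is_weak_deriv: "H10_grad y g \<Longrightarrow> is_weak_deriv \<Omega> i y (g i)"
  unfolding is_weak_deriv_def
  using H10_grad_by_parts[OF _ test_smooth] by (auto simp: mult.commute)

lemma test_H10_grad: "\<phi> \<in> test_functions \<Omega> \<Longrightarrow> H10_grad \<phi> (\<lambda>i. partial_deriv i \<phi>)"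
  unfolding H10_grad_def by (intro exI[of _ "\<lambda>_. \<phi>"]) (auto intro: L2_tendsto_const test_L2 test_deriv_L2)

lemma weak_deriv_eq:
  assumes "is_weak_deriv \<Omega> i y g" "g \<in> L2"
  shows "AE x in \<mu>. weak_deriv \<Omega> i y x = g x" "weak_deriv \<Omega> i y \<in> L2" "is_weak_deriv \<Omega> i y (weak_deriv \<Omega> i y)"
proof -
  have "\<exists>g. g \<in> L2 \<and> is_weak_deriv \<Omega> i y g" using assms by blast
  from someI_ex[OF this]
  show *: "weak_deriv \<Omega> i y \<in> L2" "is_weak_deriv \<Omega> i y (weak_deriv \<Omega> i y)"
    unfolding weak_deriv_def by auto
  show "AE x in \<mu>. weak_deriv \<Omega> i y x = g x"
    by (rule weak_deriv_unique[OF *(2) assms(1) *(1) assms(2)])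
qed

lemma is_weak_deriv_add:
  assumes "is_weak_deriv \<Omega> i y g" "is_weak_deriv \<Omega> i z h" "y \<in> L2" "z \<in> L2" "g \<in> L2" "h \<in> L2"
  shows "is_weak_deriv \<Omega> i (\<lambda>x. y x + z x) (\<lambda>x. g x + h x)"
  unfolding is_weak_deriv_def
proof
  fix \<phi> assume \<phi>: "\<phi> \<in> test_functions \<Omega>"
  have "(LINT x|\<mu>. (y x + z x) * partial_deriv i \<phi> x)
      = (LINT x|\<mu>. y x * partial_deriv i \<phi> x) + (LINT x|\<mu>. z x * partial_deriv i \<phi> x)"
    using assms \<phi> by (simp add: distrib_right L2_times_integrable test_deriv_L2)
  also have "\<dots> = - (LINT x|\<mu>. g x * \<phi> x) - (LINT x|\<mu>. h x * \<phi> x)"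
    using assms(1,2) \<phi> by (simp add: is_weak_deriv_def)
  also have "\<dots> = - (LINT x|\<mu>. (g x + h x) * \<phi> x)"
    using assms \<phi> by (simp add: distrib_right L2_times_integrable test_L2)
  finally show "(LINT x|\<mu>. (y x + z x) * partial_deriv i \<phi> x) = - (LINT x|\<mu>. (g x + h x) * \<phi> x)" .
qed

lemma is_weak_deriv_cmult:
  assumes "is_weak_deriv \<Omega> i y g" shows "is_weak_deriv \<Omega> i (\<lambda>x. c * y x) (\<lambda>x. c * g x)"
  using assms unfolding is_weak_deriv_def by (simp add: mult.assoc)

lemma H1_norm_squared:
  "H1_norm \<Omega> y = sqrt (sq_norm y + (\<Sum>i\<in>UNIV. sq_norm (weak_deriv \<Omega> i y)))"
  by (simp add: H1_norm_def Lq_norm_2 sq_norm_nonneg)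

lemma H1_tendsto_iff:
  "(\<lambda>n. H1_norm \<Omega> (ys n)) \<longlonglongrightarrow> 0 \<longleftrightarrow>
     (\<lambda>n. sq_norm (ys n)) \<longlonglongrightarrow> 0 \<and> (\<forall>i. (\<lambda>n. sq_norm (weak_deriv \<Omega> i (ys n))) \<longlonglongrightarrow> 0)"
proof
  let ?S = "\<lambda>n. sq_norm (ys n) + (\<Sum>i\<in>UNIV. sq_norm (weak_deriv \<Omega> i (ys n)))"
  assume "(\<lambda>n. H1_norm \<Omega> (ys n)) \<longlonglongrightarrow> 0"
  then have "(\<lambda>n. (H1_norm \<Omega> (ys n))\<^sup>2) \<longlonglongrightarrow> 0\<^sup>2" by (rule tendsto_power)
  then have S: "?S \<longlonglongrightarrow> 0"
    by (simp add: H1_norm_squared sq_norm_nonneg sum_nonneg add_nonneg_nonneg)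
  have "sq_norm (ys n) \<le> ?S n" for n by (simp add: sq_norm_nonneg sum_nonneg)
  moreover have "sq_norm (weak_deriv \<Omega> i (ys n)) \<le> ?S n" for n i
    using member_le_sum[of i UNIV "\<lambda>i. sq_norm (weak_deriv \<Omega> i (ys n))"] sq_norm_nonneg
    by (metis UNIV_I add_increasing finite)
  ultimately show "(\<lambda>n. sq_norm (ys n)) \<longlonglongrightarrow> 0 \<and> (\<forall>i. (\<lambda>n. sq_norm (weak_deriv \<Omega> i (ys n))) \<longlonglongrightarrow> 0)"
    by (auto intro!: tendsto_sandwich[OF _ _ tendsto_const S] always_eventually sq_norm_nonneg)
next
  assume a: "(\<lambda>n. sq_norm (ys n)) \<longlonglongrightarrow> 0 \<and> (\<forall>i. (\<lambda>n. sq_norm (weak_deriv \<Omega> i (ys n))) \<longlonglongrightarrow> 0)"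
  then have "(\<lambda>n. sqrt (sq_norm (ys n) + (\<Sum>i\<in>UNIV. sq_norm (weak_deriv \<Omega> i (ys n)))))
      \<longlonglongrightarrow> sqrt (0 + (\<Sum>i\<in>(UNIV :: 'n set). 0))"
    by (intro tendsto_intros) auto
  then show "(\<lambda>n. H1_norm \<Omega> (ys n)) \<longlonglongrightarrow> 0" by (simp add: H1_norm_squared)
qed

lemma weak_deriv_test_diff:
  assumes "\<phi> \<in> test_functions \<Omega>" "is_weak_deriv \<Omega> i y g" "y \<in> L2" "g \<in> L2"
  shows "AE x in \<mu>. weak_deriv \<Omega> i (\<lambda>x. \<phi> x - y x) x = partial_deriv i \<phi> x - g x"
    "weak_deriv \<Omega> i (\<lambda>x. \<phi> x - y x) \<in> L2"
proof -
  have "is_weak_deriv \<Omega> i (\<lambda>x. \<phi> x + - 1 * y x) (\<lambda>x. partial_deriv i \<phi> x + - 1 * g x)"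
  proof (rule is_weak_deriv_add)
    show "is_weak_deriv \<Omega> i \<phi> (partial_deriv i \<phi>)"
      using H10_grad_is_weak_deriv[OF test_H10_grad[OF assms(1)]] .
  qed (intro is_weak_deriv_cmult L2_cmult test_L2 test_deriv_L2 assms)+
  then have "is_weak_deriv \<Omega> i (\<lambda>x. \<phi> x - y x) (\<lambda>x. partial_deriv i \<phi> x - g x)" by simp
  from weak_deriv_eq[OF this] assms
  show "AE x in \<mu>. weak_deriv \<Omega> i (\<lambda>x. \<phi> x - y x) x = partial_deriv i \<phi> x - g x"
    "weak_deriv \<Omega> i (\<lambda>x. \<phi> x - y x) \<in> L2"
    using L2_diff test_deriv_L2 by auto
qed

text \<open>
  Uniqueness of weak derivatives identifies the derivative of \<open>\<phi> n - y\<close>, which enters the Sobolev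
  norm through a choice, with the difference of the two gradients.
\<close>

lemma H10_grad_imp_H10:
  assumes "H10_grad y g" shows "y \<in> H10 \<Omega>"
proof -
  obtain \<phi> where \<phi>: "\<And>n. \<phi> n \<in> test_functions \<Omega>" "L2_tendsto \<phi> y"
    "\<And>i. L2_tendsto (\<lambda>n. partial_deriv i (\<phi> n)) (g i)"
    using assms unfolding H10_grad_def by blast
  note wd = H10_grad_is_weak_deriv[OF assms] and L = H10_grad_L2[OF assms]
  have "y \<in> H1 \<Omega>" using wd L unfolding H1_def by blast
  moreover have "sq_norm (weak_deriv \<Omega> i (\<lambda>x. \<phi> n x - y x)) = sq_norm (\<lambda>x. partial_deriv i (\<phi> n) x - g i x)"
      for n i
    using weak_deriv_test_diff[OF \<phi>(1) wd L(1) L(2)] by (intro sq_norm_AE_cong L2_measurable) auto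
  then have "(\<lambda>n. H1_norm \<Omega> (\<lambda>x. \<phi> n x - y x)) \<longlonglongrightarrow> 0"
    unfolding H1_tendsto_iff using \<phi> by (simp add: L2_tendsto_def)
  ultimately show ?thesis using \<phi>(1) unfolding H10_def by blast
qed

lemma H10_imp_H10_grad:
  assumes "y \<in> H10 \<Omega>" shows "H10_grad y (\<lambda>i. weak_deriv \<Omega> i y)"
proof -
  obtain \<phi> where \<phi>: "\<And>n. \<phi> n \<in> test_functions \<Omega>" "(\<lambda>n. H1_norm \<Omega> (\<lambda>x. \<phi> n x - y x)) \<longlonglongrightarrow> 0"
    and y: "y \<in> L2" "\<And>i. \<exists>g\<in>L2. is_weak_deriv \<Omega> i y g"
    using assms unfolding H10_def H1_def by blast
  have wd: "is_weak_deriv \<Omega> i y (weak_deriv \<Omega> i y)" "weak_deriv \<Omega> i y \<in> L2" for i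
    using y(2)[of i] weak_deriv_eq by blast+
  have "sq_norm (weak_deriv \<Omega> i (\<lambda>x. \<phi> n x - y x))
      = sq_norm (\<lambda>x. partial_deriv i (\<phi> n) x - weak_deriv \<Omega> i y x)" for n i
    using weak_deriv_test_diff[OF \<phi>(1) wd(1) y(1) wd(2)] by (intro sq_norm_AE_cong L2_measurable) auto
  then show ?thesis
    using \<phi> y wd unfolding H1_tendsto_iff H10_grad_def L2_tendsto_def
    by (intro exI[of _ \<phi>]) (auto intro: test_L2 test_deriv_L2)
qed

lemma H10_grad_weak_deriv: "H10_grad y g \<Longrightarrow> AE x in \<mu>. weak_deriv \<Omega> i y x = g i x"
  by (rule weak_deriv_eq(1)[OF H10_grad_is_weak_deriv H10_grad_L2(2)])

end

section \<open>Positive parts\<close>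

lemma test_functions_support:
  assumes "\<phi> \<in> test_functions \<Omega>"
  shows "\<exists>K. compact K \<and> K \<subseteq> \<Omega> \<and> (\<forall>x. x \<notin> K \<longrightarrow> \<phi> x = 0)"
  by (rule test_functionsE[OF assms]) blast

text \<open>
  Extending a smooth function by zero: the result agrees near each point with a smooth function.
\<close>

lemma smooth_glue:
  fixes w \<phi> :: "real ^ 'n \<Rightarrow> real"
  assumes "smooth \<phi>" "open A" "open B" "A \<union> B = UNIV"
    "\<And>x. x \<in> A \<Longrightarrow> w x = \<phi> x" "\<And>x. x \<in> B \<Longrightarrow> w x = 0"
  shows "smooth w"
proof -
  define X where "X = {w :: real ^ 'n \<Rightarrow> real. \<exists>\<phi>. smooth \<phi> \<and> (\<forall>x\<in>A. w x = \<phi> x) \<and> (\<forall>x\<in>B. w x = 0)}"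
  have local: "\<exists>U \<psi>. open U \<and> x \<in> U \<and> smooth \<psi> \<and> (\<forall>z\<in>U. w z = \<psi> z)" if "w \<in> X" for w x
  proof (cases "x \<in> A")
    case True
    then show ?thesis using that assms(2) unfolding X_def by blast
  next
    case False
    then have "x \<in> B" using assms(4) by blast
    then show ?thesis using that assms(3) smooth_const[of 0] unfolding X_def by blast
  qed
  have D: "(w has_derivative frechet_derivative \<psi> (at x)) (at x)"
    if "open U" "x \<in> U" "smooth \<psi>" "\<And>z. z \<in> U \<Longrightarrow> w z = \<psi> z" for w \<psi> :: "real ^ 'n \<Rightarrow> real" and U x
    by (rule has_derivative_transform_within_open[OF smooth_has_derivative[OF that(3)] that(1,2)])
        (simp add: that(4))
  show ?thesis
  proof (rule smooth_coinduct[of w X])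
    show "w \<in> X" using assms unfolding X_def by blast
    fix v :: "real ^ 'n \<Rightarrow> real" assume v: "v \<in> X"
    show "v differentiable (at x)" for x
      using local[OF v] D unfolding differentiable_def by metis
    show "partial_deriv i v \<in> X" for i
    proof -
      obtain \<phi> where \<phi>: "smooth \<phi>" "\<And>x. x \<in> A \<Longrightarrow> v x = \<phi> x" "\<And>x. x \<in> B \<Longrightarrow> v x = 0"
        using v unfolding X_def by blast
      have "partial_deriv i v x = partial_deriv i \<phi> x" if "x \<in> A" for x
        using partial_deriv_eq[OF D[OF assms(2) that \<phi>(1,2)]] by (simp add: partial_deriv_def)
      moreover have "partial_deriv i v x = 0" if "x \<in> B" for x
        using partial_deriv_eq[OF D[OF assms(3) that smooth_const[of 0] \<phi>(3)]]
            fun_cong[OF partial_deriv_const[of i 0], of x]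
        by (simp add: partial_deriv_def)
      ultimately show ?thesis using smooth_partial_deriv[OF \<phi>(1)] unfolding X_def by blast
    qed
  qed
qed

text \<open>
  Smooth approximations of the positive part with slopes between zero and one.
\<close>

definition ramp :: "nat \<Rightarrow> real \<Rightarrow> real" where
  "ramp k t = t * flat 1 (real (Suc k) * t)"

definition ramp_deriv :: "nat \<Rightarrow> real \<Rightarrow> real" where
  "ramp_deriv k t = (if t > 0 then (1 + 1 / (real (Suc k) * t)) * exp (- (1 / (real (Suc k) * t))) else 0)"

lemma pos_Suc_mult: "0 < real (Suc k) * t \<longleftrightarrow> 0 < t"
  by (simp add: zero_less_mult_iff)

lemma ramp_altdef: "ramp k t = (if t > 0 then t * exp (- (1 / (real (Suc k) * t))) else 0)"
  unfolding ramp_def flat_def pos_Suc_mult by simp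

lemma DERIV_ramp: "(ramp k has_real_derivative ramp_deriv k t) (at t)"
proof -
  let ?c = "real (Suc k)"
  have "((\<lambda>t. t * flat 1 (?c * t)) has_real_derivative
      1 * flat 1 (?c * t) + flat ([:0,0,1:] * (1 - pderiv 1)) (?c * t) * ?c * t) (at t)"
    by (intro DERIV_mult DERIV_ident DERIV_chain2[OF DERIV_flat])
      (rule DERIV_cmult_Id)
  moreover have "1 * flat 1 (?c * t) + flat ([:0,0,1:] * (1 - pderiv 1)) (?c * t) * ?c * t = ramp_deriv k t"
  proof (cases "t > 0")
    case True
    then have c: "?c * t > 0" by (simp only: pos_Suc_mult)
    define s where "s = ?c * t"
    have s: "s > 0" using c by (simp only: s_def)
    have "flat ([:0,0,1:] * (1 - pderiv 1)) s * ?c * t = flat [:0,0,1:] s * s"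
      by (simp add: s_def)
    also have "\<dots> = (1 / s) * exp (- (1 / s))"
      using s by (simp add: flat_def)
    finally show ?thesis
      using True s unfolding ramp_deriv_def s_def[symmetric] by (simp add: flat_def distrib_right)
  next
    case False
    then have n: "\<not> ?c * t > 0" using pos_Suc_mult by blast
    have "flat p (?c * t) = 0" for p unfolding flat_def by (simp only: n if_False)
    then show ?thesis using False unfolding ramp_deriv_def by (simp only:) simp
  qed
  ultimately show ?thesis by (simp add: ramp_def[abs_def])
qed

lemma ramp_deriv_bounds: "0 \<le> ramp_deriv k t" "ramp_deriv k t \<le> 1"
proof -
  \<comment> \<open>with \<open>s = 1 / (Suc k * t)\<close> the slope is \<open>(1 + s) exp (- s)\<close>\<close>
  have "(1 + s) * exp (- s) \<le> 1" for s :: real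
  proof -
    have "(1 + s) * exp (- s) \<le> exp s * exp (- s)"
      by (intro mult_right_mono exp_ge_add_one_self) auto
    then show ?thesis by (simp add: exp_minus)
  qed
  then show "ramp_deriv k t \<le> 1" by (auto simp: ramp_deriv_def)
  show "0 \<le> ramp_deriv k t" by (auto simp: ramp_deriv_def intro!: mult_nonneg_nonneg add_nonneg_nonneg)
qed

lemma ramp_lipschitz: "\<bar>ramp k s - ramp k t\<bar> \<le> \<bar>s - t\<bar>"
proof -
  have *: "\<bar>ramp k b - ramp k a\<bar> \<le> b - a" if ab: "a < b" for a b
  proof -
    obtain z where "ramp k b - ramp k a = (b - a) * ramp_deriv k z"
      using MVT2[OF ab DERIV_ramp] by blast
    then show ?thesis using ab ramp_deriv_bounds[of k z] by (simp add: abs_mult mult_left_le)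
  qed
  show ?thesis using *[of s t] *[of t s] by (cases s t rule: linorder_cases) auto
qed

lemma ramp_nonpos: "t \<le> 0 \<Longrightarrow> ramp k t = 0"
  by (simp add: ramp_altdef)

lemma isCont_ramp_deriv: "isCont (ramp_deriv k) t"
proof -
  have "ramp_deriv k = (\<lambda>t. flat (1 + [:0,1:]) (real (Suc k) * t))"
    unfolding ramp_deriv_def flat_def pos_Suc_mult by (auto simp: fun_eq_iff)
  then show ?thesis
    by (auto intro!: isCont_o2[OF _ DERIV_isCont[OF DERIV_flat]] continuous_intros)
qed

lemma ramp_limits:
  "(\<lambda>k. ramp k t) \<longlonglongrightarrow> max t 0"
  "(\<lambda>k. ramp_deriv k t) \<longlonglongrightarrow> (if t > 0 then 1 else 0)"
proof -
  have s: "(\<lambda>k. inverse (real (Suc k)) * (1 / t)) \<longlonglongrightarrow> 0 * (1 / t)"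
    by (intro tendsto_intros LIMSEQ_inverse_real_of_nat)
  have eq: "1 / (real (Suc k) * t) = inverse (real (Suc k)) * (1 / t)" for k
    by (simp add: divide_inverse del: of_nat_Suc)
  have "(\<lambda>k. t * exp (- (inverse (real (Suc k)) * (1 / t)))) \<longlonglongrightarrow> t * exp (- (0 * (1 / t)))"
    by (intro tendsto_intros s)
  then show "(\<lambda>k. ramp k t) \<longlonglongrightarrow> max t 0"
    unfolding ramp_altdef eq by (cases "t > 0") auto
  have "(\<lambda>k. (1 + (inverse (real (Suc k)) * (1 / t))) * exp (- (inverse (real (Suc k)) * (1 / t))))
      \<longlonglongrightarrow> (1 + 0 * (1 / t)) * exp (- (0 * (1 / t)))"
    by (intro tendsto_intros s)
  then show "(\<lambda>k. ramp_deriv k t) \<longlonglongrightarrow> (if t > 0 then 1 else 0)"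
    unfolding ramp_deriv_def eq by (cases "t > 0") auto
qed

context bounded_domain
begin

lemma L2_tendsto_AE_cong:
  assumes "L2_tendsto vs v" "\<And>n. AE x in \<mu>. vs n x = ws n x" "AE x in \<mu>. v x = w x"
  shows "L2_tendsto ws w"
proof -
  have L: "vs n \<in> L2" "v \<in> L2" for n using assms(1) L2_tendsto_L2 by auto
  have "sq_norm (\<lambda>x. vs n x - v x) = sq_norm (\<lambda>x. ws n x - w x)" for n
    using assms(2)[of n] assms(3) L by (intro sq_norm_AE_cong L2_measurable L2_diff) auto
  then show ?thesis
    using assms(1) L2_AE_cong[OF L(1) assms(2)] L2_AE_cong[OF L(2) assms(3)] by (simp add: L2_tendsto_def)
qed

lemma H10_grad_AE_cong:
  assumes "H10_grad y g" "AE x in \<mu>. y x = z x" "\<And>i. AE x in \<mu>. g i x = h i x"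
  shows "H10_grad z h"
proof -
  obtain \<phi> where \<phi>: "\<And>n. \<phi> n \<in> test_functions \<Omega>" "L2_tendsto \<phi> y"
    "\<And>i. L2_tendsto (\<lambda>n. partial_deriv i (\<phi> n)) (g i)"
    using assms(1) unfolding H10_grad_def by metis
  show ?thesis
    unfolding H10_grad_def
    using \<phi>(1) L2_tendsto_AE_cong[OF \<phi>(2) _ assms(2)] L2_tendsto_AE_cong[OF \<phi>(3) _ assms(3)]
    by (intro exI[of _ \<phi>]) simp
qed

lemma H10_grad_add:
  assumes "H10_grad y g" "H10_grad z h"
  shows "H10_grad (\<lambda>x. y x + z x) (\<lambda>i x. g i x + h i x)"
proof -
  obtain \<phi> \<eta> where \<phi>: "\<And>n. \<phi> n \<in> test_functions \<Omega>" "L2_tendsto \<phi> y"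
    "\<And>i. L2_tendsto (\<lambda>n. partial_deriv i (\<phi> n)) (g i)"
    and \<eta>: "\<And>n. \<eta> n \<in> test_functions \<Omega>" "L2_tendsto \<eta> z"
    "\<And>i. L2_tendsto (\<lambda>n. partial_deriv i (\<eta> n)) (h i)"
    using assms unfolding H10_grad_def by metis
  have eq: "partial_deriv i (\<lambda>x. \<phi> n x + \<eta> n x) = (\<lambda>x. partial_deriv i (\<phi> n) x + partial_deriv i (\<eta> n) x)"
      for i n
    using test_smooth \<phi>(1) \<eta>(1) by (intro ext partial_deriv_add) auto
  show ?thesis
    unfolding H10_grad_def
    by (intro exI[of _ "\<lambda>n x. \<phi> n x + \<eta> n x"]) (simp add: test_add L2_tendsto_add \<phi> \<eta> eq)
qed

lemma H10_grad_cmult: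
  assumes "H10_grad y g" shows "H10_grad (\<lambda>x. c * y x) (\<lambda>i x. c * g i x)"
proof -
  obtain \<phi> where \<phi>: "\<And>n. \<phi> n \<in> test_functions \<Omega>" "L2_tendsto \<phi> y"
    "\<And>i. L2_tendsto (\<lambda>n. partial_deriv i (\<phi> n)) (g i)"
    using assms unfolding H10_grad_def by metis
  have eq: "partial_deriv i (\<lambda>x. c * \<phi> n x) = (\<lambda>x. c * partial_deriv i (\<phi> n) x)" for i n
    using test_smooth \<phi>(1) by (intro ext partial_deriv_cmult) auto
  show ?thesis
    unfolding H10_grad_def
    by (intro exI[of _ "\<lambda>n x. c * \<phi> n x"]) (simp add: test_mult[OF _ smooth_const] L2_tendsto_cmult \<phi> eq)
qed

text \<open>
  For each \<open>n\<close> a single test function approximates \<open>ys n\<close> and its finitely many derivatives, and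
  these test functions converge to \<open>y\<close>.
\<close>

lemma H10_grad_closed:
  assumes "\<And>n. H10_grad (ys n) (gs n)" "L2_tendsto ys y" "\<And>i. L2_tendsto (\<lambda>n. gs n i) (g i)"
  shows "H10_grad y g"
proof -
  let ?e = "\<lambda>n. inverse (real (Suc n))"
  have "\<exists>\<phi>. \<phi> \<in> test_functions \<Omega> \<and> sq_norm (\<lambda>x. \<phi> x - ys n x) < ?e n
      \<and> (\<forall>i. sq_norm (\<lambda>x. partial_deriv i \<phi> x - gs n i x) < ?e n)" for n
  proof -
    obtain \<phi> where \<phi>: "\<And>m. \<phi> m \<in> test_functions \<Omega>" "L2_tendsto \<phi> (ys n)"
      "\<And>i. L2_tendsto (\<lambda>m. partial_deriv i (\<phi> m)) (gs n i)"
      using assms(1)[of n] unfolding H10_grad_def by blast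
    have "\<forall>\<^sub>F m in sequentially. sq_norm (\<lambda>x. \<phi> m x - ys n x) < ?e n"
      using \<phi>(2) unfolding L2_tendsto_def by (intro order_tendstoD(2)[of _ 0]) auto
    moreover have "\<forall>\<^sub>F m in sequentially. \<forall>i. sq_norm (\<lambda>x. partial_deriv i (\<phi> m) x - gs n i x) < ?e n"
      using \<phi>(3) unfolding L2_tendsto_def
      by (intro eventually_all_finite) (auto intro: order_tendstoD(2)[of _ 0])
    ultimately have "\<forall>\<^sub>F m in sequentially. sq_norm (\<lambda>x. \<phi> m x - ys n x) < ?e n
        \<and> (\<forall>i. sq_norm (\<lambda>x. partial_deriv i (\<phi> m) x - gs n i x) < ?e n)"
      by eventually_elim simp
    from eventually_happens'[OF sequentially_bot this]
    obtain m where "sq_norm (\<lambda>x. \<phi> m x - ys n x) < ?e n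
        \<and> (\<forall>i. sq_norm (\<lambda>x. partial_deriv i (\<phi> m) x - gs n i x) < ?e n)" by blast
    with \<phi>(1) show ?thesis by blast
  qed
  then obtain \<phi> where \<phi>: "\<And>n. \<phi> n \<in> test_functions \<Omega>" "\<And>n. sq_norm (\<lambda>x. \<phi> n x - ys n x) < ?e n"
    "\<And>n i. sq_norm (\<lambda>x. partial_deriv i (\<phi> n) x - gs n i x) < ?e n" by metis
  have transfer: "L2_tendsto vs v"
    if "\<And>n. vs n \<in> L2" "\<And>n. sq_norm (\<lambda>x. vs n x - ws n x) < ?e n" "L2_tendsto ws v" for vs ws v
  proof (rule L2_tendsto_squeeze)
    note L = L2_tendsto_L2[OF that(3)]
    show "sq_norm (\<lambda>x. vs n x - v x) \<le> 2 * ?e n + 2 * sq_norm (\<lambda>x. ws n x - v x)" for n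
      using sq_norm_add_le[OF L2_diff L2_diff, of "vs n" "ws n" "ws n" v] that(1,2)[of n] L by simp
    have "(\<lambda>n. 2 * ?e n + 2 * sq_norm (\<lambda>x. ws n x - v x)) \<longlonglongrightarrow> 2 * 0 + 2 * 0"
      using that(3) unfolding L2_tendsto_def by (intro tendsto_intros LIMSEQ_inverse_real_of_nat) auto
    then show "(\<lambda>n. 2 * ?e n + 2 * sq_norm (\<lambda>x. ws n x - v x)) \<longlonglongrightarrow> 0" by simp
  qed (use that L2_tendsto_L2 in auto)
  have "L2_tendsto \<phi> y" by (rule transfer[OF _ \<phi>(2) assms(2)]) (intro test_L2 \<phi>(1))
  moreover have "L2_tendsto (\<lambda>n. partial_deriv i (\<phi> n)) (g i)" for i
    by (rule transfer[OF _ \<phi>(3) assms(3)]) (intro test_deriv_L2 \<phi>(1))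
  ultimately show ?thesis unfolding H10_grad_def using \<phi>(1) by blast
qed

lemma H10_grad_poincare:
  assumes "H10_grad y g" shows "sq_norm y \<le> poincare_const * sq_norm (g i)"
proof -
  obtain \<phi> where \<phi>: "\<And>n. \<phi> n \<in> test_functions \<Omega>" "L2_tendsto \<phi> y"
    "L2_tendsto (\<lambda>n. partial_deriv i (\<phi> n)) (g i)"
    using assms unfolding H10_grad_def by blast
  have sq: "sq_norm v = (LINT x|\<mu>. v x * v x)" for v by (simp add: sq_norm_def power2_eq_square)
  show ?thesis
  proof (rule LIMSEQ_le)
    show "(\<lambda>n. sq_norm (\<phi> n)) \<longlonglongrightarrow> sq_norm y"
      unfolding sq by (rule L2_tendsto_inner[OF \<phi>(2,2)])
    show "(\<lambda>n. poincare_const * sq_norm (partial_deriv i (\<phi> n))) \<longlonglongrightarrow> poincare_const * sq_norm (g i)"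
      unfolding sq by (intro tendsto_mult_left L2_tendsto_inner \<phi>(3))
  qed (use poincare_test[OF \<phi>(1)] in auto)
qed

text \<open>
  A smooth approximation of the positive part vanishes on the negative half-line, so it maps
  \<open>\<phi> - \<psi>\<close> to a test function again.  Nonnegativity of \<open>\<psi>\<close> is asked for on the domain only, so
  that a quadratic barrier qualifies; therefore the function is extended by zero.
\<close>

lemma ramp_test:
  fixes k :: nat
  assumes "\<phi> \<in> test_functions \<Omega>" "smooth \<psi>" "\<And>x. x \<in> \<Omega> \<Longrightarrow> 0 \<le> \<psi> x"
  defines "w \<equiv> (\<lambda>x. if x \<in> \<Omega> then ramp k (\<phi> x - \<psi> x) else 0)"
  shows "w \<in> test_functions \<Omega>"
    "x \<in> \<Omega> \<Longrightarrow> partial_deriv i w x = ramp_deriv k (\<phi> x - \<psi> x) * (partial_deriv i \<phi> x - partial_deriv i \<psi> x)"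
proof -
  obtain K where K: "compact K" "K \<subseteq> \<Omega>" "\<And>x. x \<notin> K \<Longrightarrow> \<phi> x = 0"
    using test_functions_support[OF assms(1)] by blast
  have s: "smooth (\<lambda>x. \<phi> x - \<psi> x)" using assms(2) test_smooth[OF assms(1)] by (intro smooth_diff)
  have sr: "smooth (\<lambda>x. ramp k (\<phi> x - \<psi> x))"
    unfolding ramp_def by (intro smooth_mult smooth_flat smooth_cmult s)
  have w0: "w x = 0" if "x \<notin> K" for x using K assms(3)[of x] that by (auto simp: w_def ramp_nonpos)
  have "smooth w"
    by (rule smooth_glue[OF sr open_domain, of "- K"])
        (use K w0 in \<open>auto simp: w_def compact_imp_closed open_Compl\<close>)
  then show "w \<in> test_functions \<Omega>" by (rule test_functionsI[OF _ K(1,2) w0])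
  assume x: "x \<in> \<Omega>"
  have "(w has_derivative frechet_derivative (\<lambda>x. ramp k (\<phi> x - \<psi> x)) (at x)) (at x)"
    by (rule has_derivative_transform_within_open[OF smooth_has_derivative[OF sr] open_domain x])
        (simp add: w_def)
  then have "partial_deriv i w x = partial_deriv i (\<lambda>x. ramp k (\<phi> x - \<psi> x)) x"
    by (simp add: partial_deriv_eq) (simp add: partial_deriv_def)
  also have "\<dots> = ramp_deriv k (\<phi> x - \<psi> x) * partial_deriv i (\<lambda>x. \<phi> x - \<psi> x) x"
    by (rule partial_deriv_compose[OF s DERIV_ramp])
  also have "partial_deriv i (\<lambda>x. \<phi> x - \<psi> x) x = partial_deriv i \<phi> x - partial_deriv i \<psi> x"
    using partial_deriv_add[OF test_smooth[OF assms(1)] smooth_cmult[OF assms(2), of "-1"]]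
      partial_deriv_cmult[OF assms(2), of _ "-1"] by simp
  finally show "partial_deriv i w x = ramp_deriv k (\<phi> x - \<psi> x) * (partial_deriv i \<phi> x - partial_deriv i \<psi> x)" .
qed

text \<open>
  Along a subsequence of test functions that converges almost everywhere, the slopes converge
  boundedly; the error of the gradients is damped by slopes of at most one.
\<close>

lemma H10_grad_ramp:
  assumes "H10_grad y g" "smooth \<psi>" "\<And>x. x \<in> \<Omega> \<Longrightarrow> 0 \<le> \<psi> x"
  shows "H10_grad (\<lambda>x. ramp k (y x - \<psi> x)) (\<lambda>i x. ramp_deriv k (y x - \<psi> x) * (g i x - partial_deriv i \<psi> x))"
proof -
  obtain \<phi>0 where \<phi>0: "\<And>n. \<phi>0 n \<in> test_functions \<Omega>" "L2_tendsto \<phi>0 y"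
    "\<And>i. L2_tendsto (\<lambda>n. partial_deriv i (\<phi>0 n)) (g i)"
    using assms unfolding H10_grad_def by blast
  obtain r where r: "strict_mono (r :: nat \<Rightarrow> nat)" "AE x in \<mu>. (\<lambda>n. \<phi>0 (r n) x) \<longlonglongrightarrow> y x"
    by (rule L2_tendsto_AE_subseq[OF \<phi>0(2)])
  define \<phi> where "\<phi> n = \<phi>0 (r n)" for n
  have \<phi>: "\<And>n. \<phi> n \<in> test_functions \<Omega>" "L2_tendsto \<phi> y"
    "\<And>i. L2_tendsto (\<lambda>n. partial_deriv i (\<phi> n)) (g i)" "AE x in \<mu>. (\<lambda>n. \<phi> n x) \<longlonglongrightarrow> y x"
    unfolding \<phi>_def[abs_def] using \<phi>0 r L2_tendsto_subseq[OF \<phi>0(2) r(1)] L2_tendsto_subseq[OF \<phi>0(3) r(1)] by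
        auto
  define w where "w n x = (if x \<in> \<Omega> then ramp k (\<phi> n x - \<psi> x) else 0)" for n x
  have w: "w n \<in> test_functions \<Omega>"
    "x \<in> \<Omega> \<Longrightarrow> partial_deriv i (w n) x = ramp_deriv k (\<phi> n x - \<psi> x)
      * (partial_deriv i (\<phi> n) x - partial_deriv i \<psi> x)" for n x i
    using ramp_test[OF \<phi>(1) assms(2,3), where k=k] unfolding w_def[abs_def] by auto
  note L = H10_grad_L2[OF assms(1)] smooth_L2[OF assms(2)] smooth_L2[OF smooth_partial_deriv[OF assms(2)]]
    test_L2[OF \<phi>(1)] test_deriv_L2[OF \<phi>(1)]
  have mramp: "ramp k \<in> borel_measurable borel" "ramp_deriv k \<in> borel_measurable borel"
    by (intro borel_measurable_continuous_onI continuous_at_imp_continuous_on ballI DERIV_isCont[OF DERIV_ramp],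
        intro borel_measurable_continuous_onI continuous_at_imp_continuous_on ballI isCont_ramp_deriv)
  have meas: "(\<lambda>x. ramp k (v x - \<psi> x)) \<in> borel_measurable \<mu>"
      "(\<lambda>x. ramp_deriv k (v x - \<psi> x)) \<in> borel_measurable \<mu>"
    if "v \<in> L2" for v
    using measurable_compose[OF L2_measurable[OF L2_diff[OF that L(3)]] mramp(1)]
      measurable_compose[OF L2_measurable[OF L2_diff[OF that L(3)]] mramp(2)] by auto
  have "L2_tendsto w (\<lambda>x. ramp k (y x - \<psi> x))"
  proof (rule L2_tendsto_squeeze)
    show rL: "(\<lambda>x. ramp k (y x - \<psi> x)) \<in> L2"
    proof (rule L2_dominated[OF L2_diff[OF L(1) L(3)] meas(1)[OF L(1)]])
      show "AE x in \<mu>. \<bar>ramp k (y x - \<psi> x)\<bar> \<le> \<bar>y x - \<psi> x\<bar>"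
        using ramp_lipschitz[of k _ 0] by (simp add: ramp_nonpos)
    qed
    show "sq_norm (\<lambda>x. w n x - ramp k (y x - \<psi> x)) \<le> sq_norm (\<lambda>x. \<phi> n x - y x)" for n
    proof (rule sq_norm_mono)
      show "AE x in \<mu>. \<bar>w n x - ramp k (y x - \<psi> x)\<bar> \<le> \<bar>\<phi> n x - y x\<bar>"
        by (intro AE_I2) (auto simp: w_def intro!: order_trans[OF ramp_lipschitz])
    qed (intro L2_diff test_L2 w(1) rL L)+
  qed (use \<phi> w(1) test_L2 in \<open>auto simp: L2_tendsto_def\<close>)
  moreover have "L2_tendsto (\<lambda>n. partial_deriv i (w n))
      (\<lambda>x. ramp_deriv k (y x - \<psi> x) * (g i x - partial_deriv i \<psi> x))" for i
  proof -
    let ?A = "\<lambda>n x. ramp_deriv k (\<phi> n x - \<psi> x) * (partial_deriv i (\<phi> n) x - g i x)"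
    let ?B = "\<lambda>n x. ramp_deriv k (\<phi> n x - \<psi> x) * (g i x - partial_deriv i \<psi> x)"
    have bd: "\<bar>ramp_deriv k s * t\<bar> \<le> \<bar>t\<bar>" for s t
      using ramp_deriv_bounds[of k s] by (simp add: abs_mult mult_left_le_one_le)
    have mA: "?A n \<in> borel_measurable \<mu>" and mB: "?B n \<in> borel_measurable \<mu>" for n
      using meas(2)[OF L(5)] L2_measurable L2_diff L by (auto intro!: borel_measurable_times)
    have AL: "?A n \<in> L2" for n
      by (rule L2_dominated[OF L2_diff[OF L(6)[of i n] L(2)[of i]] mA]) (use bd in simp)
    have "L2_tendsto ?A (\<lambda>_. 0)"
    proof (rule L2_tendsto_squeeze)
      show "sq_norm (\<lambda>x. ?A n x - 0) \<le> sq_norm (\<lambda>x. partial_deriv i (\<phi> n) x - g i x)" for n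
        using bd AL[of n] L2_diff[OF L(6)[of i n] L(2)[of i]] by (intro sq_norm_mono) auto
    qed (use AL L2_const \<phi>(3)[of i] in \<open>auto simp: L2_tendsto_def\<close>)
    moreover have "L2_tendsto ?B (\<lambda>x. ramp_deriv k (y x - \<psi> x) * (g i x - partial_deriv i \<psi> x))"
    proof (rule L2_tendsto_dominated)
      show "(\<lambda>x. \<bar>g i x - partial_deriv i \<psi> x\<bar>) \<in> L2"
        by (rule L2_dominated[OF L2_diff[OF L(2)[of i] L(4)[of i]]])
           (use L2_measurable[OF L2_diff[OF L(2)[of i] L(4)[of i]]] in auto)
      show "AE x in \<mu>. (\<lambda>n. ?B n x) \<longlonglongrightarrow> ramp_deriv k (y x - \<psi> x) * (g i x - partial_deriv i \<psi> x)"
        using \<phi>(4)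
      proof eventually_elim
        case (elim x)
        then have "(\<lambda>n. \<phi> n x - \<psi> x) \<longlonglongrightarrow> y x - \<psi> x" by (intro tendsto_intros)
        then show ?case by (intro tendsto_mult_right isCont_tendsto_compose[OF isCont_ramp_deriv])
      qed
      show "(\<lambda>x. ramp_deriv k (y x - \<psi> x) * (g i x - partial_deriv i \<psi> x)) \<in> borel_measurable \<mu>"
        using meas(2)[OF L(1)] L2_measurable[OF L2_diff[OF L(2)[of i] L(4)[of i]]] by
            (intro borel_measurable_times)
    qed (use bd mB in auto)
    ultimately have "L2_tendsto (\<lambda>n x. ?A n x + ?B n x)
        (\<lambda>x. 0 + ramp_deriv k (y x - \<psi> x) * (g i x - partial_deriv i \<psi> x))"
      by (rule L2_tendsto_add)
    then show ?thesis
      by (rule L2_tendsto_AE_cong) (auto intro!: AE_I2 simp: w(2) algebra_simps)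
  qed
  ultimately show ?thesis unfolding H10_grad_def using w(1) by blast
qed

text \<open>
  Stampacchia's formula for the gradient of a positive part.
\<close>

lemma H10_grad_pos_part:
  assumes "H10_grad y g" "smooth \<psi>" "\<And>x. x \<in> \<Omega> \<Longrightarrow> 0 \<le> \<psi> x"
  shows "H10_grad (\<lambda>x. max (y x - \<psi> x) 0) (\<lambda>i x. (if y x > \<psi> x then 1 else 0) * (g i x - partial_deriv i \<psi> x))"
proof (rule H10_grad_closed[OF H10_grad_ramp[OF assms]])
  note L = H10_grad_L2[OF assms(1)] smooth_L2[OF assms(2)] smooth_L2[OF smooth_partial_deriv[OF assms(2)]]
  note ramp = H10_grad_ramp[OF assms]
  have abs_L2: "(\<lambda>x. \<bar>v x\<bar>) \<in> L2" if "v \<in> L2" for v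
    by (rule L2_dominated[OF that]) (use L2_measurable[OF that] in auto)
  show "L2_tendsto (\<lambda>n x. ramp n (y x - \<psi> x)) (\<lambda>x. max (y x - \<psi> x) 0)"
  proof (rule L2_tendsto_dominated[OF abs_L2[OF L2_diff[OF L(1,3)]]])
    show "(\<lambda>x. max (y x - \<psi> x) 0) \<in> borel_measurable \<mu>"
      using L2_measurable[OF L2_diff[OF L(1,3)]] by simp
    show "AE x in \<mu>. \<bar>ramp n (y x - \<psi> x)\<bar> \<le> \<bar>y x - \<psi> x\<bar>" for n
      using ramp_lipschitz[of n _ 0] by (simp add: ramp_nonpos)
  qed (auto intro: ramp_limits L2_measurable H10_grad_L2(1)[OF ramp])
  show "L2_tendsto (\<lambda>n x. ramp_deriv n (y x - \<psi> x) * (g i x - partial_deriv i \<psi> x))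
          (\<lambda>x. (if y x > \<psi> x then 1 else 0) * (g i x - partial_deriv i \<psi> x))" for i
  proof (rule L2_tendsto_dominated[OF abs_L2[OF L2_diff[OF L(2)[of i] L(4)[of i]]]])
    have [measurable]: "y \<in> borel_measurable \<mu>" "\<psi> \<in> borel_measurable \<mu>" "g i \<in> borel_measurable \<mu>"
      "partial_deriv i \<psi> \<in> borel_measurable \<mu>" using L L2_measurable by auto
    show "(\<lambda>x. (if y x > \<psi> x then 1 else 0) * (g i x - partial_deriv i \<psi> x)) \<in> borel_measurable \<mu>"
      by measurable
    show "AE x in \<mu>. (\<lambda>n. ramp_deriv n (y x - \<psi> x) * (g i x - partial_deriv i \<psi> x))
        \<longlonglongrightarrow> (if y x > \<psi> x then 1 else 0) * (g i x - partial_deriv i \<psi> x)"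
    proof (intro AE_I2 tendsto_mult_right)
      fix x
      show "(\<lambda>n. ramp_deriv n (y x - \<psi> x)) \<longlonglongrightarrow> (if y x > \<psi> x then 1 else 0)"
        using ramp_limits(2)[of "y x - \<psi> x"] by simp
    qed
    show "AE x in \<mu>. \<bar>ramp_deriv n (y x - \<psi> x) * (g i x - partial_deriv i \<psi> x)\<bar>
        \<le> \<bar>g i x - partial_deriv i \<psi> x\<bar>" for n
      using ramp_deriv_bounds[of n] by (intro AE_I2) (simp add: abs_mult mult_left_le_one_le)
  qed (rule L2_measurable[OF H10_grad_L2(2)[OF ramp]])
qed

section \<open>The energy form\<close>

abbreviation "H \<equiv> H10 \<Omega>"

definition energy :: "(real ^ 'n \<Rightarrow> real) \<Rightarrow> (real ^ 'n \<Rightarrow> real) \<Rightarrow> real" where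
  "energy y v = - laplacian \<Omega> y v"

lemma H10_L2: "y \<in> H \<Longrightarrow> y \<in> L2"
  using H10_imp_H10_grad H10_grad_L2 by blast

lemma weak_deriv_L2: "y \<in> H \<Longrightarrow> weak_deriv \<Omega> i y \<in> L2"
  using H10_grad_L2(2)[OF H10_imp_H10_grad, where i=i] by blast

lemma H10_add: "y \<in> H \<Longrightarrow> z \<in> H \<Longrightarrow> (\<lambda>x. y x + z x) \<in> H"
  using H10_grad_add[OF H10_imp_H10_grad H10_imp_H10_grad] H10_grad_imp_H10 by blast

lemma H10_cmult: "y \<in> H \<Longrightarrow> (\<lambda>x. c * y x) \<in> H"
  using H10_grad_cmult[OF H10_imp_H10_grad] H10_grad_imp_H10 by blast

lemma H10_diff: "y \<in> H \<Longrightarrow> z \<in> H \<Longrightarrow> (\<lambda>x. y x - z x) \<in> H"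
  using H10_add[OF _ H10_cmult[of _ "-1"]] by simp

lemma H10_zero: "(\<lambda>_. 0) \<in> H"
  using H10_grad_imp_H10[OF test_H10_grad[OF test_zero]] .

lemma energy_eq:
  assumes "H10_grad y g" "H10_grad v h"
  shows "energy y v = (\<Sum>i\<in>UNIV. LINT x|\<mu>. g i x * h i x)"
  unfolding energy_def laplacian_def minus_minus
proof (rule sum.cong[OF refl], rule integral_cong_AE)
  fix i
  have y: "y \<in> H" "v \<in> H" using assms H10_grad_imp_H10 by auto
  show "(\<lambda>x. weak_deriv \<Omega> i y x * weak_deriv \<Omega> i v x) \<in> borel_measurable \<mu>"
    "(\<lambda>x. g i x * h i x) \<in> borel_measurable \<mu>"
    by (intro borel_measurable_times L2_measurable weak_deriv_L2 y H10_grad_L2(2)[OF assms(1)]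
        H10_grad_L2(2)[OF assms(2)])+
  show "AE x in \<mu>. weak_deriv \<Omega> i y x * weak_deriv \<Omega> i v x = g i x * h i x"
    using H10_grad_weak_deriv[OF assms(1), of i] H10_grad_weak_deriv[OF assms(2), of i] by eventually_elim simp
qed

lemma energy_sym: "energy y v = energy v y"
  by (simp add: energy_def laplacian_def mult.commute)

lemma energy_add_right:
  assumes "y \<in> H" "v \<in> H" "w \<in> H"
  shows "energy y (\<lambda>x. v x + w x) = energy y v + energy y w"
proof -
  note g = H10_imp_H10_grad
  have "energy y (\<lambda>x. v x + w x) =
      (\<Sum>i\<in>UNIV. LINT x|\<mu>. weak_deriv \<Omega> i y x * (weak_deriv \<Omega> i v x + weak_deriv \<Omega> i w x))"
    by (rule energy_eq[OF g[OF assms(1)] H10_grad_add[OF g[OF assms(2)] g[OF assms(3)]]])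
  also have "\<dots> = (\<Sum>i\<in>UNIV. (LINT x|\<mu>. weak_deriv \<Omega> i y x * weak_deriv \<Omega> i v x)
      + (LINT x|\<mu>. weak_deriv \<Omega> i y x * weak_deriv \<Omega> i w x))"
    by (rule sum.cong) (simp_all add: distrib_left L2_times_integrable weak_deriv_L2 assms)
  finally show ?thesis by (simp add: energy_eq[OF g g] assms sum.distrib)
qed

lemma energy_cmult_right:
  assumes "y \<in> H" "v \<in> H" shows "energy y (\<lambda>x. c * v x) = c * energy y v"
proof -
  note g = H10_imp_H10_grad
  have "energy y (\<lambda>x. c * v x) = (\<Sum>i\<in>UNIV. LINT x|\<mu>. weak_deriv \<Omega> i y x * (c * weak_deriv \<Omega> i v x))"
    by (rule energy_eq[OF g[OF assms(1)] H10_grad_cmult[OF g[OF assms(2)]]])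
  also have "\<dots> = (\<Sum>i\<in>UNIV. c * (LINT x|\<mu>. weak_deriv \<Omega> i y x * weak_deriv \<Omega> i v x))"
    by (simp add: mult.left_commute)
  finally show ?thesis by (simp add: energy_eq[OF g g] assms sum_distrib_left)
qed

lemma energy_diff_right:
  assumes "y \<in> H" "v \<in> H" "w \<in> H"
  shows "energy y (\<lambda>x. v x - w x) = energy y v - energy y w"
  using energy_add_right[OF assms(1,2) H10_cmult[OF assms(3), of "-1"]]
      energy_cmult_right[OF assms(1,3), of "-1"] by simp

lemma energy_add_left: "y \<in> H \<Longrightarrow> v \<in> H \<Longrightarrow> w \<in> H \<Longrightarrow> energy (\<lambda>x. v x + w x) y = energy v y + energy w y"
  and energy_cmult_left: "y \<in> H \<Longrightarrow> v \<in> H \<Longrightarrow> energy (\<lambda>x. c * v x) y = c * energy v y"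
  and energy_diff_left: "y \<in> H \<Longrightarrow> v \<in> H \<Longrightarrow> w \<in> H \<Longrightarrow> energy (\<lambda>x. v x - w x) y = energy v y - energy w y"
  using energy_add_right energy_cmult_right energy_diff_right by (metis energy_sym)+

lemma energy_self: "y \<in> H \<Longrightarrow> energy y y = (\<Sum>i\<in>UNIV. sq_norm (weak_deriv \<Omega> i y))"
  by (simp add: energy_eq[OF H10_imp_H10_grad H10_imp_H10_grad] sq_norm_def power2_eq_square)

lemma energy_nonneg: "y \<in> H \<Longrightarrow> 0 \<le> energy y y"
  by (simp add: energy_self sum_nonneg sq_norm_nonneg)

lemma sq_norm_le_energy: "y \<in> H \<Longrightarrow> sq_norm (weak_deriv \<Omega> i y) \<le> energy y y"
  by (simp add: energy_self) (rule member_le_sum, auto simp: sq_norm_nonneg)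

lemma poincare: assumes "y \<in> H" shows "sq_norm y \<le> poincare_const * energy y y"
proof -
  have "sq_norm y \<le> poincare_const * sq_norm (weak_deriv \<Omega> undefined y)"
    by (rule H10_grad_poincare[OF H10_imp_H10_grad[OF assms]])
  also have "\<dots> \<le> poincare_const * energy y y"
    using sq_norm_le_energy[OF assms] poincare_const(1) by (intro mult_left_mono) auto
  finally show ?thesis .
qed

lemma energy_eq_0: assumes "y \<in> H" "energy y y \<le> 0" shows "AE x in \<mu>. y x = 0"
proof -
  have "energy y y = 0" using assms energy_nonneg by force
  then have "sq_norm y = 0" using poincare[OF assms(1)] sq_norm_nonneg[of y] by simp
  then show ?thesis using sq_norm_eq_0_iff[OF H10_L2[OF assms(1)]] by blast
qed

lemma H1_norm_le_energy:
  assumes "y \<in> H" shows "(H1_norm \<Omega> y)\<^sup>2 \<le> (poincare_const + 1) * energy y y"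
proof -
  have "(H1_norm \<Omega> y)\<^sup>2 = sq_norm y + energy y y"
    by (simp add: H1_norm_squared energy_self assms sq_norm_nonneg sum_nonneg)
  then show ?thesis using poincare[OF assms] by (simp add: distrib_right)
qed

lemma energy_square_diff:
  assumes "y \<in> H" "z \<in> H"
  shows "energy (\<lambda>x. y x - z x) (\<lambda>x. y x - z x) = energy y y - 2 * energy y z + energy z z"
  using assms energy_sym[of z y]
  by (simp add: energy_diff_left energy_diff_right H10_diff)

lemma energy_square_add:
  assumes "y \<in> H" "z \<in> H"
  shows "energy (\<lambda>x. y x + z x) (\<lambda>x. y x + z x) = energy y y + 2 * energy y z + energy z z"
  using assms energy_sym[of z y]
  by (simp add: energy_add_left energy_add_right H10_add)

lemma energy_le: assumes "y \<in> H" "z \<in> H" shows "2 * \<bar>energy y z\<bar> \<le> energy y y + energy z z"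
  using energy_square_diff[OF assms] energy_square_add[OF assms] energy_nonneg[OF H10_diff[OF assms]]
    energy_nonneg[OF H10_add[OF assms]] by linarith

text \<open>
  Orthogonality of positive and negative part, the fact behind the comparison principle.
\<close>

lemma H10_pos_part:
  assumes "y \<in> H" shows "(\<lambda>x. max (y x) 0) \<in> H"
    "energy y (\<lambda>x. max (y x) 0) = energy (\<lambda>x. max (y x) 0) (\<lambda>x. max (y x) 0)"
proof -
  note g = H10_imp_H10_grad[OF assms]
  have p: "H10_grad (\<lambda>x. max (y x) 0) (\<lambda>i x. (if y x > 0 then 1 else 0) * weak_deriv \<Omega> i y x)"
    using H10_grad_pos_part[OF g smooth_const[of 0]] by (simp add: partial_deriv_const)
  show "(\<lambda>x. max (y x) 0) \<in> H" by (rule H10_grad_imp_H10[OF p])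
  show "energy y (\<lambda>x. max (y x) 0) = energy (\<lambda>x. max (y x) 0) (\<lambda>x. max (y x) 0)"
    unfolding energy_eq[OF g p] energy_eq[OF p p]
    by (intro sum.cong refl Bochner_Integration.integral_cong) auto
qed

text \<open>
  By the Poincare inequality, convergence of the gradients forces convergence of the functions.
\<close>

lemma H10_complete:
  assumes H: "\<And>n. vs n \<in> H"
    and Cauchy: "\<And>e. e > 0 \<Longrightarrow> \<exists>M. \<forall>m\<ge>M. \<forall>n\<ge>M. energy (\<lambda>x. vs m x - vs n x) (\<lambda>x. vs m x - vs n x) < e"
  obtains v where "v \<in> H" "L2_tendsto vs v" "\<And>i. L2_tendsto (\<lambda>n. weak_deriv \<Omega> i (vs n)) (weak_deriv \<Omega> i v)"
proof -
  note D = H10_diff[OF H H]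
  obtain v where v: "L2_tendsto vs v"
  proof (rule L2_complete[of vs])
    fix e :: real assume "e > 0"
    then have "e / poincare_const > 0" using poincare_const(1) by simp
    from Cauchy[OF this] obtain M where M: "\<And>m n. m \<ge> M \<Longrightarrow> n \<ge> M \<Longrightarrow>
        energy (\<lambda>x. vs m x - vs n x) (\<lambda>x. vs m x - vs n x) < e / poincare_const" by blast
    have "sq_norm (\<lambda>x. vs m x - vs n x) < e" if "m \<ge> M" "n \<ge> M" for m n
      using poincare[OF D, of m n] M[OF that] poincare_const(1) by (simp add: field_simps)
    then show "\<exists>M. \<forall>m\<ge>M. \<forall>n\<ge>M. sq_norm (\<lambda>x. vs m x - vs n x) < e" by blast
  qed (use H H10_L2 in auto)
  have wd: "sq_norm (\<lambda>x. weak_deriv \<Omega> i (vs m) x - weak_deriv \<Omega> i (vs n) x)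
      \<le> energy (\<lambda>x. vs m x - vs n x) (\<lambda>x. vs m x - vs n x)" for i m n
  proof -
    have "H10_grad (\<lambda>x. vs m x + - 1 * vs n x) (\<lambda>i x. weak_deriv \<Omega> i (vs m) x + - 1 * weak_deriv \<Omega> i (vs n) x)"
      by (intro H10_grad_add H10_grad_cmult H10_imp_H10_grad H)
    from H10_grad_weak_deriv[OF this, of i]
    have "sq_norm (weak_deriv \<Omega> i (\<lambda>x. vs m x - vs n x))
        = sq_norm (\<lambda>x. weak_deriv \<Omega> i (vs m) x - weak_deriv \<Omega> i (vs n) x)"
      by (intro sq_norm_AE_cong L2_measurable weak_deriv_L2 D) simp
    then show ?thesis using sq_norm_le_energy[OF D, of i m n] by simp
  qed
  have "\<exists>g. L2_tendsto (\<lambda>n. weak_deriv \<Omega> i (vs n)) g" for i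
  proof -
    have "\<exists>M. \<forall>m\<ge>M. \<forall>n\<ge>M. sq_norm (\<lambda>x. weak_deriv \<Omega> i (vs m) x - weak_deriv \<Omega> i (vs n) x) < e" if "e > 0" for e
      using Cauchy[OF that] wd[of i] by (meson le_less_trans)
    then show ?thesis using L2_complete[of "\<lambda>n. weak_deriv \<Omega> i (vs n)"] weak_deriv_L2[OF H] by metis
  qed
  then obtain g where g: "\<And>i. L2_tendsto (\<lambda>n. weak_deriv \<Omega> i (vs n)) (g i)" by metis
  have G: "H10_grad v g" by (rule H10_grad_closed[OF H10_imp_H10_grad[OF H] v g])
  show thesis
  proof (rule that[OF H10_grad_imp_H10[OF G] v])
    show "L2_tendsto (\<lambda>n. weak_deriv \<Omega> i (vs n)) (weak_deriv \<Omega> i v)" for i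
      by (rule L2_tendsto_AE_cong[OF g]) (use H10_grad_weak_deriv[OF G, of i] in \<open>auto elim: eventually_mono\<close>)
  qed
qed

lemma energy_tendsto:
  assumes "\<And>n. vs n \<in> H" "v \<in> H" "\<And>i. L2_tendsto (\<lambda>n. weak_deriv \<Omega> i (vs n)) (weak_deriv \<Omega> i v)"
  shows "(\<lambda>n. energy (vs n) (vs n)) \<longlonglongrightarrow> energy v v"
  unfolding energy_eq[OF H10_imp_H10_grad[OF assms(1)] H10_imp_H10_grad[OF assms(1)]]
    energy_eq[OF H10_imp_H10_grad[OF assms(2)] H10_imp_H10_grad[OF assms(2)]]
  by (intro tendsto_sum L2_tendsto_inner assms(3))

end

section \<open>The obstacle problem\<close>

locale semilinear = bounded_domain \<Omega> for \<Omega> :: "(real ^ 'n) set" +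
  fixes f :: "real \<Rightarrow> real"
  assumes f_mono: "mono f" and f_lipschitz: "\<exists>L. L-lipschitz_on UNIV f"
    and f_convex: "convex_on UNIV f" and f_zero: "f 0 = 0"
begin

definition lip :: real where "lip = (SOME L. L-lipschitz_on UNIV f)"

lemma lip: "0 \<le> lip" "\<bar>f s - f t\<bar> \<le> lip * \<bar>s - t\<bar>"
proof -
  have *: "lip-lipschitz_on UNIV f" unfolding lip_def using someI_ex[OF f_lipschitz] .
  show "0 \<le> lip" by (rule lipschitz_on_nonneg[OF *])
  show "\<bar>f s - f t\<bar> \<le> lip * \<bar>s - t\<bar>"
    using lipschitz_onD[OF *, of s t] by (simp add: dist_real_def)
qed

lemma f_monoD: "s \<le> t \<Longrightarrow> f s \<le> f t"
  using f_mono by (simp add: mono_def)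

lemma f_continuous: "continuous_on UNIV f"
  using f_lipschitz lipschitz_on_continuous_on by blast

lemma f_measurable [measurable]: "f \<in> borel_measurable borel"
  by (rule borel_measurable_continuous_onI[OF f_continuous])

lemma f_abs_le: "\<bar>f t\<bar> \<le> lip * \<bar>t\<bar>"
  using lip(2)[of t 0] by (simp add: f_zero)

lemma f_L2: assumes "y \<in> L2" shows "(\<lambda>x. f (y x)) \<in> L2"
proof (rule L2_dominated[OF L2_cmult[OF assms, of lip]])
  show "(\<lambda>x. f (y x)) \<in> borel_measurable \<mu>"
    using measurable_compose[OF L2_measurable[OF assms] f_measurable] .
  show "AE x in \<mu>. \<bar>f (y x)\<bar> \<le> \<bar>lip * y x\<bar>"
    using f_abs_le lip(1) by (simp add: abs_mult)
qed

definition res :: "(real ^ 'n \<Rightarrow> real) \<Rightarrow> (real ^ 'n \<Rightarrow> real) \<Rightarrow> (real ^ 'n \<Rightarrow> real) \<Rightarrow> real" where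
  "res u y v = energy y v + (LINT x|\<mu>. f (y x) * v x) - (LINT x|\<mu>. u x * v x)"

lemma residual_eq_res: "residual \<Omega> f (L2_functional \<Omega> u) y v = res u y v"
  by (simp add: residual_def res_def energy_def L2_functional_def)

lemma res_add:
  assumes "u \<in> L2" "y \<in> H" "v \<in> H" "w \<in> H"
  shows "res u y (\<lambda>x. v x + w x) = res u y v + res u y w"
proof -
  have "(LINT x|\<mu>. f (y x) * (v x + w x)) = (LINT x|\<mu>. f (y x) * v x) + (LINT x|\<mu>. f (y x) * w x)"
    "(LINT x|\<mu>. u x * (v x + w x)) = (LINT x|\<mu>. u x * v x) + (LINT x|\<mu>. u x * w x)"
    using assms by (simp_all add: distrib_left L2_times_integrable f_L2 H10_L2)
  then show ?thesis using assms by (simp add: res_def energy_add_right)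
qed

lemma res_cmult:
  assumes "y \<in> H" "v \<in> H" shows "res u y (\<lambda>x. c * v x) = c * res u y v"
proof -
  have "(LINT x|\<mu>. f (y x) * (c * v x)) = c * (LINT x|\<mu>. f (y x) * v x)"
    "(LINT x|\<mu>. u x * (c * v x)) = c * (LINT x|\<mu>. u x * v x)"
    by (simp_all add: mult.left_commute)
  then show ?thesis using assms by (simp add: res_def energy_cmult_right algebra_simps)
qed

text \<open>
  The variational inequality of the obstacle problem, and the inequality \<open>- \<Delta> z + f(z) \<le> u\<close> in the
  dual space.
\<close>

definition VI :: "(real ^ 'n \<Rightarrow> ereal) \<Rightarrow> (real ^ 'n \<Rightarrow> real) \<Rightarrow> (real ^ 'n \<Rightarrow> real) \<Rightarrow> bool" where
  "VI p u y \<longleftrightarrow> y \<in> below \<Omega> p \<and> (\<forall>v \<in> below \<Omega> p. res u y (\<lambda>x. v x - y x) \<ge> 0)"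

definition subsolution :: "(real ^ 'n \<Rightarrow> real) \<Rightarrow> (real ^ 'n \<Rightarrow> real) \<Rightarrow> bool" where
  "subsolution u z \<longleftrightarrow> z \<in> H \<and> (\<forall>w\<in>H. (AE x in \<mu>. 0 \<le> w x) \<longrightarrow> res u z w \<le> 0)"

lemma VI_H: "VI p u y \<Longrightarrow> y \<in> H" and VI_le: "VI p u y \<Longrightarrow> AE x in \<mu>. ereal (y x) \<le> p x"
  by (auto simp: VI_def below_def)

lemma VI_D: "VI p u y \<Longrightarrow> v \<in> below \<Omega> p \<Longrightarrow> 0 \<le> res u y (\<lambda>x. v x - y x)"
  by (simp add: VI_def)

text \<open>
  The obstacle acts from above only, so subtracting a nonnegative function is admissible.
\<close>

lemma VI_subsolution:
  assumes "VI p u y" shows "subsolution u y"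
  unfolding subsolution_def
proof (intro conjI ballI impI)
  show y: "y \<in> H" using assms VI_H by blast
  fix w assume w: "w \<in> H" "AE x in \<mu>. 0 \<le> w x"
  have "AE x in \<mu>. ereal (y x - w x) \<le> p x"
    using VI_le[OF assms] w(2) by eventually_elim (auto intro: order_trans[rotated])
  then have "(\<lambda>x. y x - w x) \<in> below \<Omega> p" using y w by (simp add: below_def H10_diff)
  from VI_D[OF assms this] have "0 \<le> res u y (\<lambda>x. (y x - w x) - y x)" .
  also have "(\<lambda>x. (y x - w x) - y x) = (\<lambda>x. - 1 * w x)" by auto
  also have "res u y (\<lambda>x. - 1 * w x) = - res u y w" by (subst res_cmult[OF y w(1)]) simp
  finally show "res u y w \<le> 0" by simp
qed

text \<open>
  The comparison principle.  Testing both problems with \<open>(z - y)\<^sup>+\<close>, which is admissible because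
  \<open>y + (z - y)\<^sup>+ = max y z\<close> stays below the obstacle, leaves only the energy of \<open>(z - y)\<^sup>+\<close>.
\<close>

lemma comparison:
  assumes "VI p u y" "subsolution u z" "AE x in \<mu>. ereal (z x) \<le> p x" "u \<in> L2"
  shows "AE x in \<mu>. z x \<le> y x"
proof -
  have H: "y \<in> H" "z \<in> H" using assms VI_H by (auto simp: subsolution_def)
  define w where "w x = max (z x - y x) 0" for x
  have w: "w \<in> H" "energy (\<lambda>x. z x - y x) w = energy w w"
    using H10_pos_part[OF H10_diff[OF H(2,1)]] unfolding w_def[abs_def] by auto
  have "AE x in \<mu>. ereal (y x + w x) \<le> p x"
    using VI_le[OF assms(1)] assms(3) by eventually_elim (auto simp: w_def max_def)
  then have "(\<lambda>x. y x + w x) \<in> below \<Omega> p" using H w by (simp add: below_def H10_add)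
  from VI_D[OF assms(1) this] have "0 \<le> res u y (\<lambda>x. (y x + w x) - y x)" .
  then have 1: "0 \<le> res u y w" by simp
  have 2: "res u z w \<le> 0" using assms(2) w unfolding subsolution_def by (auto simp: w_def)
  have "0 \<le> (LINT x|\<mu>. f (z x) * w x - f (y x) * w x)"
  proof (rule integral_nonneg_AE, rule AE_I2)
    fix x show "0 \<le> f (z x) * w x - f (y x) * w x"
      using f_monoD[of "y x" "z x"] by (auto simp: w_def max_def mult_right_mono)
  qed
  also have "\<dots> = (LINT x|\<mu>. f (z x) * w x) - (LINT x|\<mu>. f (y x) * w x)"
    by (intro Bochner_Integration.integral_diff L2_times_integrable f_L2 H10_L2 H w)
  finally have "energy z w - energy y w \<le> 0" using 1 2 by (simp add: res_def)
  then have "energy w w \<le> 0" using w H by (simp add: energy_diff_left)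
  then have "AE x in \<mu>. w x = 0" by (rule energy_eq_0[OF w(1)])
  then show ?thesis by eventually_elim (auto simp: w_def max_def split: if_splits)
qed

lemma subsolution_mono:
  assumes "subsolution u z" "AE x in \<mu>. u x \<le> v x" "u \<in> L2" "v \<in> L2" shows "subsolution v z"
  unfolding subsolution_def
proof (intro conjI ballI impI)
  show "z \<in> H" using assms by (simp add: subsolution_def)
  fix w assume w: "w \<in> H" "AE x in \<mu>. 0 \<le> w x"
  have "(LINT x|\<mu>. u x * w x) \<le> (LINT x|\<mu>. v x * w x)"
  proof (rule integral_mono_AE)
    show "AE x in \<mu>. u x * w x \<le> v x * w x" using assms(2) w(2) by eventually_elim (rule mult_right_mono)
  qed (intro L2_times_integrable assms H10_L2 w)+
  moreover have "res u z w \<le> 0" using assms(1) w by (simp add: subsolution_def)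
  ultimately show "res v z w \<le> 0" by (simp add: res_def)
qed

lemma VI_mono:
  assumes "VI p u y" "VI q v z" "AE x in \<mu>. p x \<le> q x" "AE x in \<mu>. u x \<le> v x" "u \<in> L2" "v \<in> L2"
  shows "AE x in \<mu>. y x \<le> z x"
proof (rule comparison[OF assms(2) subsolution_mono[OF VI_subsolution[OF assms(1)] assms(4,5,6)] _ assms(6)])
  show "AE x in \<mu>. ereal (y x) \<le> q x"
    using VI_le[OF assms(1)] assms(3) by eventually_elim (rule order_trans)
qed

lemma VI_unique:
  assumes "VI p u y" "VI p u z" "u \<in> L2" shows "AE x in \<mu>. y x = z x"
  using VI_mono[OF assms(1,2) _ _ assms(3,3)] VI_mono[OF assms(2,1) _ _ assms(3,3)] by auto

lemma subsolution_zero: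
  assumes "AE x in \<mu>. 0 \<le> u x" "u \<in> L2" shows "subsolution u (\<lambda>_. 0)"
  unfolding subsolution_def
proof (intro conjI ballI impI)
  show "(\<lambda>_. 0) \<in> H" by (rule H10_zero)
  fix w assume w: "w \<in> H" "AE x in \<mu>. 0 \<le> w x"
  have "energy (\<lambda>_. 0) w = 0" using energy_cmult_left[OF w(1,1), of 0] by simp
  moreover have "0 \<le> (LINT x|\<mu>. u x * w x)"
    by (rule integral_nonneg_AE) (use assms(1) w(2) in eventually_elim, simp)
  ultimately show "res u (\<lambda>_. 0) w \<le> 0" by (simp add: res_def f_zero)
qed

text \<open>This is where the convexity of the nonlinearity enters.\<close>

lemma subsolution_convex:
  assumes "subsolution u1 z1" "subsolution u2 z2" "0 \<le> t" "t \<le> 1" "u1 \<in> L2" "u2 \<in> L2"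
  shows "subsolution (\<lambda>x. t * u1 x + (1 - t) * u2 x) (\<lambda>x. t * z1 x + (1 - t) * z2 x)"
  unfolding subsolution_def
proof (intro conjI ballI impI)
  have H: "z1 \<in> H" "z2 \<in> H" using assms by (auto simp: subsolution_def)
  show z: "(\<lambda>x. t * z1 x + (1 - t) * z2 x) \<in> H" by (intro H10_add H10_cmult H)
  fix w assume w: "w \<in> H" "AE x in \<mu>. 0 \<le> w x"
  let ?z = "\<lambda>x. t * z1 x + (1 - t) * z2 x"
  note int = L2_times_integrable f_L2 H10_L2 H w assms
  have "energy ?z w = t * energy z1 w + (1 - t) * energy z2 w"
    by (simp add: energy_add_left energy_cmult_left H10_cmult H w)
  moreover have "(LINT x|\<mu>. f (?z x) * w x) \<le> (LINT x|\<mu>. t * (f (z1 x) * w x) + (1 - t) * (f (z2 x) * w x))"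
  proof (rule integral_mono_AE)
    show "AE x in \<mu>. f (?z x) * w x \<le> t * (f (z1 x) * w x) + (1 - t) * (f (z2 x) * w x)"
      using w(2)
    proof eventually_elim
      case (elim x)
      have "f (?z x) \<le> t * f (z1 x) + (1 - t) * f (z2 x)"
        using convex_onD[OF f_convex, of "1 - t" "z1 x" "z2 x"] assms(3,4) by simp
      from mult_right_mono[OF this elim] show ?case by (simp add: algebra_simps)
    qed
    show "integrable \<mu> (\<lambda>x. f (?z x) * w x)" by (intro L2_times_integrable f_L2 H10_L2 z w)
  qed (intro Bochner_Integration.integrable_add integrable_mult_right int)
  moreover have "(LINT x|\<mu>. t * (f (z1 x) * w x) + (1 - t) * (f (z2 x) * w x))
      = t * (LINT x|\<mu>. f (z1 x) * w x) + (1 - t) * (LINT x|\<mu>. f (z2 x) * w x)"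
    using int by simp
  moreover have "(LINT x|\<mu>. (t * u1 x + (1 - t) * u2 x) * w x)
      = t * (LINT x|\<mu>. u1 x * w x) + (1 - t) * (LINT x|\<mu>. u2 x * w x)"
    using int by (simp add: distrib_right mult.assoc)
  moreover have "t * res u1 z1 w + (1 - t) * res u2 z2 w \<le> 0"
    using assms w by (simp add: subsolution_def mult_nonneg_nonpos add_nonpos_nonpos)
  ultimately show "res (\<lambda>x. t * u1 x + (1 - t) * u2 x) ?z w \<le> 0"
    by (simp add: res_def algebra_simps)
qed

text \<open>
  The quadratic barrier \<open>\<psi> = U/2 (C - x\<^sub>i\<^sup>2)\<close> satisfies \<open>- \<Delta> \<psi> = U\<close> and is nonnegative on the
  domain, so that \<open>(z - \<psi>)\<^sup>+\<close> is an admissible test function although \<open>\<psi>\<close> does not vanish on the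
  boundary.
\<close>

lemma subsolution_bound:
  assumes "subsolution u z" "AE x in \<mu>. u x \<le> U" "0 \<le> U" "u \<in> L2"
  shows "AE x in \<mu>. z x \<le> poincare_const * U"
proof -
  let ?C = poincare_const
  obtain i :: 'n where True by simp
  have z: "z \<in> H" using assms by (simp add: subsolution_def)
  note gz = H10_imp_H10_grad[OF z]
  have sc: "smooth (\<lambda>x. x $ i)" by (rule smooth_coord)
  define \<psi> :: "real ^ 'n \<Rightarrow> real" where "\<psi> x = (U / 2) * (?C + (- 1) * (x $ i * x $ i))" for x
  have s: "smooth \<psi>" unfolding \<psi>_def
    by (intro smooth_cmult smooth_add smooth_const smooth_mult smooth_coord)
  have s2: "smooth (\<lambda>x. x $ i * x $ i)" "smooth (\<lambda>x. (- 1) * (x $ i * x $ i))"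
    "smooth (\<lambda>x. ?C + (- 1) * (x $ i * x $ i))"
    by (intro smooth_cmult smooth_add smooth_const smooth_mult smooth_coord)+
  have dpsi: "partial_deriv j \<psi> = (\<lambda>x. (if i = j then - U else 0) * x $ i)" for j
    unfolding \<psi>_def
    by (rule ext, simp only: partial_deriv_cmult[OF s2(3)] partial_deriv_add[OF smooth_const s2(2)]
        partial_deriv_cmult[OF s2(1)] partial_deriv_mult[OF sc sc] partial_deriv_coord partial_deriv_const) simp
  have ddpsi: "partial_deriv j (partial_deriv j \<psi>) x = (if i = j then - U else 0)" for j x
    unfolding dpsi by (subst partial_deriv_cmult[OF sc]) (simp add: partial_deriv_coord)
  have x2: "x $ i * x $ i \<le> ?C" if "x \<in> \<Omega>" for x
  proof -
    have "4 * (x $ i * x $ i) \<le> ?C" using poincare_const(2)[OF that, of i] by (simp add: power2_eq_square)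
    then show ?thesis using zero_le_square[of "x $ i"] by linarith
  qed
  have psi: "0 \<le> \<psi> x" if "x \<in> \<Omega>" for x using x2[OF that] assms(3) by (simp add: \<psi>_def)
  define w where "w x = max (z x - \<psi> x) 0" for x
  define h where "h j x = (if z x > \<psi> x then 1 else 0) * (weak_deriv \<Omega> j z x - partial_deriv j \<psi> x)" for j x
  have wh: "H10_grad w h"
    using H10_grad_pos_part[OF gz s psi] unfolding w_def[abs_def] h_def[abs_def] .
  then have w: "w \<in> H" by (rule H10_grad_imp_H10)
  note L = weak_deriv_L2[OF z] smooth_L2[OF smooth_partial_deriv[OF s]] H10_grad_L2[OF wh] H10_L2[OF z]
  have "energy w w = (\<Sum>j\<in>UNIV. LINT x|\<mu>. h j x * h j x)" by (rule energy_eq[OF wh wh])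
  also have "\<dots> = (\<Sum>j\<in>UNIV. (LINT x|\<mu>. weak_deriv \<Omega> j z x * h j x) - (LINT x|\<mu>. partial_deriv j \<psi> x * h j x))"
  proof (rule sum.cong[OF refl])
    fix j
    have "(LINT x|\<mu>. h j x * h j x) = (LINT x|\<mu>. weak_deriv \<Omega> j z x * h j x - partial_deriv j \<psi> x * h j x)"
      by (intro Bochner_Integration.integral_cong refl) (auto simp: h_def algebra_simps)
    also have "\<dots> = (LINT x|\<mu>. weak_deriv \<Omega> j z x * h j x) - (LINT x|\<mu>. partial_deriv j \<psi> x * h j x)"
      by (intro Bochner_Integration.integral_diff L2_times_integrable L)
    finally show "(LINT x|\<mu>. h j x * h j x) = (LINT x|\<mu>. weak_deriv \<Omega> j z x * h j x)
        - (LINT x|\<mu>. partial_deriv j \<psi> x * h j x)" .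
  qed
  also have "\<dots> = energy z w - (\<Sum>j\<in>UNIV. LINT x|\<mu>. partial_deriv j \<psi> x * h j x)"
    by (simp add: sum_subtractf energy_eq[OF gz wh])
  also have "(\<Sum>j\<in>UNIV. LINT x|\<mu>. partial_deriv j \<psi> x * h j x)
      = (\<Sum>j\<in>UNIV. if i = j then U * (LINT x|\<mu>. w x) else 0)"
    by (rule sum.cong[OF refl]) (subst H10_grad_by_parts[OF wh smooth_partial_deriv[OF s]], simp add: ddpsi)
  also have "\<dots> = U * (LINT x|\<mu>. w x)" by simp
  finally have e: "energy w w = energy z w - U * (LINT x|\<mu>. w x)" .
  have "res u z w \<le> 0" using assms(1) w unfolding subsolution_def by (auto simp: w_def)
  moreover have "0 \<le> (LINT x|\<mu>. f (z x) * w x)"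
  proof (rule integral_nonneg_AE, rule AE_I2)
    fix x assume "x \<in> space \<mu>"
    then have "0 \<le> \<psi> x" using psi by simp
    then show "0 \<le> f (z x) * w x"
      using f_monoD[of 0 "z x"] f_zero by (auto simp: w_def max_def)
  qed
  moreover have "(LINT x|\<mu>. u x * w x) \<le> (LINT x|\<mu>. U * w x)"
  proof (rule integral_mono_AE)
    show "AE x in \<mu>. u x * w x \<le> U * w x"
      using assms(2) by eventually_elim (auto intro!: mult_right_mono simp: w_def)
  qed (use L assms L2_times_integrable L2_integrable in auto)
  ultimately have "energy w w \<le> 0" using e by (simp add: res_def)
  then have "AE x in \<mu>. w x = 0" by (rule energy_eq_0[OF w])
  then show ?thesis
  proof eventually_elim
    case (elim x)
    have "\<psi> x \<le> (U / 2) * ?C" using assms(3) unfolding \<psi>_def by (intro mult_left_mono) auto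
    also have "\<dots> \<le> ?C * U" using assms(3) poincare_const(1) by simp
    finally show ?case using elim by (auto simp: w_def max_def split: if_splits)
  qed
qed

text \<open>
  The antiderivative of the nonlinearity, which makes the variational inequality the minimality
  condition of the functional \<open>J\<close> defined below.
\<close>

definition potential :: "real \<Rightarrow> real" where
  "potential = (SOME F. (\<forall>t. (F has_real_derivative f t) (at t)) \<and> F 0 = 0)"

lemma potential:
  "(potential has_real_derivative f t) (at t)" "potential 0 = 0"
proof -
  have "\<exists>F. \<forall>x::real. -\<infinity> < ereal x \<longrightarrow> ereal x < \<infinity> \<longrightarrow> (F has_vector_derivative f x) (at x)"
    using f_continuous by (intro einterval_antiderivative) (auto simp: continuous_on_eq_continuous_at)
  then obtain F where F: "\<And>x. (F has_real_derivative f x) (at x)"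
    by (auto simp: has_real_derivative_iff_has_vector_derivative)
  have "(\<forall>t. ((\<lambda>t. F t - F 0) has_real_derivative f t) (at t)) \<and> (F 0 - F 0 = 0)"
    using F by (auto intro!: derivative_eq_intros)
  then have "\<exists>G. (\<forall>t. (G has_real_derivative f t) (at t)) \<and> G 0 = 0" by blast
  from someI_ex[OF this] show "(potential has_real_derivative f t) (at t)" "potential 0 = 0"
    unfolding potential_def by auto
qed

lemma potential_tangent: "f s * (t - s) \<le> potential t - potential s"
proof -
  consider "s < t" | "t < s" | "s = t" by linarith
  then show ?thesis
  proof cases
    case 1
    from MVT2[OF 1 potential(1)] obtain z where z: "s < z" "potential t - potential s = (t - s) * f z" by blast
    have "(t - s) * f s \<le> (t - s) * f z" using 1 z f_monoD[of s z] by (intro mult_left_mono) auto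
    then show ?thesis using z by (simp add: mult.commute)
  next
    case 2
    from MVT2[OF 2 potential(1)] obtain z where z: "z < s" "potential s - potential t = (s - t) * f z" by blast
    have "(s - t) * f z \<le> (s - t) * f s" using 2 z f_monoD[of z s] by (intro mult_left_mono) auto
    then show ?thesis using z(2) by (simp add: algebra_simps)
  qed simp
qed

lemma potential_bounds: "0 \<le> potential t" "potential t \<le> lip * t\<^sup>2"
proof -
  show "0 \<le> potential t" using potential_tangent[of 0 t] by (simp add: f_zero potential(2))
  have "potential t \<le> f t * t" using potential_tangent[of t 0] by (simp add: potential(2))
  also have "\<dots> \<le> \<bar>f t\<bar> * \<bar>t\<bar>" by (metis abs_ge_self abs_mult)
  also have "\<dots> \<le> lip * \<bar>t\<bar> * \<bar>t\<bar>" by (intro mult_right_mono f_abs_le) auto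
  finally show "potential t \<le> lip * t\<^sup>2" by (simp add: power2_eq_square mult.assoc)
qed

lemma potential_integrable: assumes "y \<in> L2" shows "integrable \<mu> (\<lambda>x. potential (y x))"
proof (rule Bochner_Integration.integrable_bound)
  show "integrable \<mu> (\<lambda>x. lip * (y x)\<^sup>2)" using assms by (simp add: L2_iff)
  have "potential \<in> borel_measurable borel"
    by (intro borel_measurable_continuous_onI continuous_at_imp_continuous_on ballI
        DERIV_isCont[OF potential(1)])
  then show "(\<lambda>x. potential (y x)) \<in> borel_measurable \<mu>"
    using measurable_compose[OF L2_measurable[OF assms]] by blast
qed (use potential_bounds lip(1) in auto)

definition J :: "(real ^ 'n \<Rightarrow> real) \<Rightarrow> (real ^ 'n \<Rightarrow> real) \<Rightarrow> real" where
  "J u v = energy v v / 2 + (LINT x|\<mu>. potential (v x)) - (LINT x|\<mu>. u x * v x)"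

text \<open>
  The load is absorbed by the energy through the Poincare inequality.
\<close>

lemma J_bounded_below:
  assumes "u \<in> L2" "v \<in> H" shows "- poincare_const * sq_norm u \<le> J u v"
proof -
  let ?C = poincare_const
  have "(LINT x|\<mu>. u x * v x) \<le> (LINT x|\<mu>. ?C * (u x)\<^sup>2 + 1 / (4 * ?C) * (v x)\<^sup>2)"
  proof (rule integral_mono)
    show "u x * v x \<le> ?C * (u x)\<^sup>2 + 1 / (4 * ?C) * (v x)\<^sup>2" for x
    proof -
      have "0 \<le> (2 * ?C * u x - v x)\<^sup>2 / (4 * ?C)" using poincare_const(1) by simp
      then show ?thesis using poincare_const(1) by (simp add: power2_eq_square field_simps)
    qed
  qed (use assms H10_L2 L2_times_integrable in \<open>auto simp: L2_iff\<close>)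
  also have "\<dots> = ?C * sq_norm u + 1 / (4 * ?C) * sq_norm v"
    using assms(1) H10_L2[OF assms(2)] by (simp add: L2_iff sq_norm_def)
  also have "1 / (4 * ?C) * sq_norm v \<le> 1 / (4 * ?C) * (?C * energy v v)"
    using poincare_const(1) poincare[OF assms(2)] by (intro mult_left_mono) auto
  also have "\<dots> = energy v v / 4" using poincare_const(1) by simp
  finally have "(LINT x|\<mu>. u x * v x) \<le> ?C * sq_norm u + energy v v / 4" by simp
  moreover have "0 \<le> (LINT x|\<mu>. potential (v x))" using potential_bounds by simp
  ultimately show ?thesis using energy_nonneg[OF assms(2)] by (simp add: J_def)
qed

text \<open>
  Uniform convexity, which makes minimising sequences Cauchy in energy.
\<close>

lemma J_midpoint:
  assumes "u \<in> L2" "v \<in> H" "w \<in> H"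
  shows "J u (\<lambda>x. 1/2 * (v x + w x)) \<le> (J u v + J u w) / 2 - energy (\<lambda>x. v x - w x) (\<lambda>x. v x - w x) / 8"
proof -
  note int = L2_times_integrable potential_integrable H10_L2 assms
  have m: "(\<lambda>x. 1/2 * (v x + w x)) \<in> H" by (intro H10_cmult H10_add assms)
  have "energy (\<lambda>x. 1/2 * (v x + w x)) (\<lambda>x. 1/2 * (v x + w x)) = (energy v v + 2 * energy v w + energy w w) / 4"
    unfolding energy_cmult_left[OF m H10_add[OF assms(2,3)]]
      energy_cmult_right[OF H10_add[OF assms(2,3)] H10_add[OF assms(2,3)]] energy_square_add[OF assms(2,3)]
    by simp
  moreover have "(LINT x|\<mu>. potential (1/2 * (v x + w x)))
      \<le> (LINT x|\<mu>. 1/2 * potential (v x) + 1/2 * potential (w x))"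
  proof (rule integral_mono)
    show "potential (1/2 * (v x + w x)) \<le> 1/2 * potential (v x) + 1/2 * potential (w x)" for x
    proof -
      let ?m = "1/2 * (v x + w x)"
      have "f ?m * (v x - ?m) + f ?m * (w x - ?m) = f ?m * ((v x - ?m) + (w x - ?m))"
        by (simp only: distrib_left)
      also have "(v x - ?m) + (w x - ?m) = 0" by (simp add: field_simps)
      finally show ?thesis
        using potential_tangent[of ?m "v x"] potential_tangent[of ?m "w x"] by simp
    qed
  qed (use int m in auto)
  moreover have "(LINT x|\<mu>. 1/2 * potential (v x) + 1/2 * potential (w x))
      = (LINT x|\<mu>. potential (v x)) / 2 + (LINT x|\<mu>. potential (w x)) / 2"
    using int by simp
  moreover have "(LINT x|\<mu>. u x * (1/2 * (v x + w x))) = (LINT x|\<mu>. 1/2 * (u x * v x) + 1/2 * (u x * w x))"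
    by (rule arg_cong[where f="integral\<^sup>L \<mu>"]) (auto simp: field_simps)
  moreover have "\<dots> = (LINT x|\<mu>. u x * v x) / 2 + (LINT x|\<mu>. u x * w x) / 2"
    using int by simp
  moreover have "energy (\<lambda>x. v x - w x) (\<lambda>x. v x - w x) = energy v v - 2 * energy v w + energy w w"
    by (rule energy_square_diff[OF assms(2,3)])
  ultimately show ?thesis unfolding J_def by (simp add: field_simps)
qed

text \<open>
  The potential is convex, hence bounded below by its tangent at the limit, and the tangent is
  continuous.
\<close>

lemma J_lower_semicontinuous:
  assumes "u \<in> L2" "\<And>n. vs n \<in> H" "v \<in> H" "L2_tendsto vs v"
    "\<And>i. L2_tendsto (\<lambda>n. weak_deriv \<Omega> i (vs n)) (weak_deriv \<Omega> i v)"
    and le: "\<And>n. J u (vs n) \<le> c n" and c: "c \<longlonglongrightarrow> m"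
  shows "J u v \<le> m"
proof (rule LIMSEQ_le)
  let ?K = "\<lambda>n. energy (vs n) (vs n) / 2 + ((LINT x|\<mu>. potential (v x)) + (LINT x|\<mu>. f (v x) * (vs n x - v x)))
      - (LINT x|\<mu>. u x * vs n x)"
  have L: "vs n \<in> L2" "v \<in> L2" for n using assms H10_L2 by auto
  have "(\<lambda>n. LINT x|\<mu>. f (v x) * (vs n x - v x)) \<longlonglongrightarrow> (LINT x|\<mu>. f (v x) * (v x - v x))"
    by (intro L2_tendsto_inner L2_tendsto_const L2_tendsto_diff assms f_L2 L)
  moreover have "(\<lambda>n. LINT x|\<mu>. u x * vs n x) \<longlonglongrightarrow> (LINT x|\<mu>. u x * v x)"
    by (intro L2_tendsto_inner L2_tendsto_const assms)
  moreover have "(\<lambda>n. energy (vs n) (vs n)) \<longlonglongrightarrow> energy v v"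
    by (rule energy_tendsto[OF assms(2,3,5)])
  ultimately have "?K \<longlonglongrightarrow> energy v v / 2 + ((LINT x|\<mu>. potential (v x)) + (LINT x|\<mu>. f (v x) * (v x - v x)))
      - (LINT x|\<mu>. u x * v x)"
    by (intro tendsto_add tendsto_diff tendsto_divide tendsto_const) auto
  then show "?K \<longlonglongrightarrow> J u v" by (simp add: J_def)
  have "?K n \<le> J u (vs n)" for n
  proof -
    have "(LINT x|\<mu>. potential (v x)) + (LINT x|\<mu>. f (v x) * (vs n x - v x)) =
        (LINT x|\<mu>. potential (v x) + f (v x) * (vs n x - v x))"
      using potential_integrable L2_times_integrable f_L2 L2_diff L by simp
    also have "\<dots> \<le> (LINT x|\<mu>. potential (vs n x))"
    proof (rule integral_mono)
      show "potential (v x) + f (v x) * (vs n x - v x) \<le> potential (vs n x)" for x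
        using potential_tangent[of "v x" "vs n x"] by linarith
      show "integrable \<mu> (\<lambda>x. potential (v x) + f (v x) * (vs n x - v x))"
        by (intro Bochner_Integration.integrable_add potential_integrable L2_times_integrable f_L2 L2_diff L)
    qed (rule potential_integrable[OF L(1)])
    finally show ?thesis by (simp add: J_def)
  qed
  then show "\<exists>N. \<forall>n\<ge>N. ?K n \<le> c n" using le order_trans by blast
qed (rule c)

text \<open>
  Comparing the minimiser with \<open>y + t (v - y)\<close> gives the inequality up to an error of order \<open>t\<close>;
  the tangent at the perturbed point and the Lipschitz bound replace differentiation under the
  integral.
\<close>

lemma J_minimizer_VI:
  assumes u: "u \<in> L2" and y: "y \<in> below \<Omega> p" and min: "\<And>v. v \<in> below \<Omega> p \<Longrightarrow> J u y \<le> J u v"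
  shows "VI p u y"
  unfolding VI_def
proof (intro conjI ballI)
  fix v assume v: "v \<in> below \<Omega> p"
  define d where "d x = v x - y x" for x
  have H: "y \<in> H" "v \<in> H" using y v by (auto simp: below_def)
  have d: "d \<in> H" unfolding d_def[abs_def] using H by (intro H10_diff)
  note L = H10_L2[OF H(1)] H10_L2[OF d]
  define K where "K = energy d d / 2 + lip * sq_norm d"
  have key: "0 \<le> res u y d + t * K" if t: "0 < t" "t \<le> 1" for t
  proof -
    have "AE x in \<mu>. ereal (y x + t * d x) \<le> p x"
    proof -
      have "AE x in \<mu>. ereal (y x) \<le> p x" "AE x in \<mu>. ereal (v x) \<le> p x" using y v by (auto simp: below_def)
      then show ?thesis
      proof eventually_elim
        case (elim x)
        have "y x + t * d x = (1 - t) * y x + t * v x" by (simp add: d_def algebra_simps)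
        also have "\<dots> \<le> max (y x) (v x)" using t by (intro convex_bound_le) auto
        finally show ?case using elim by (cases "p x") (auto simp: max_def split: if_splits)
      qed
    qed
    then have yt: "(\<lambda>x. y x + t * d x) \<in> below \<Omega> p" using H d by (simp add: below_def H10_add H10_cmult)
    have ytL: "(\<lambda>x. y x + t * d x) \<in> L2" using L by (intro L2_add L2_cmult)
    have "energy (\<lambda>x. y x + t * d x) (\<lambda>x. y x + t * d x) = energy y y + 2 * (t * energy y d) + t\<^sup>2 * energy d d"
      using energy_square_add[OF H(1) H10_cmult[OF d, of t]] H d
      by (simp add: energy_cmult_right energy_cmult_left H10_cmult power2_eq_square)
    moreover have "(LINT x|\<mu>. potential (y x + t * d x))
        \<le> (LINT x|\<mu>. potential (y x) + t * (f (y x) * d x) + t\<^sup>2 * lip * (d x)\<^sup>2)"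
    proof (rule integral_mono)
      fix x
      have "potential (y x + t * d x) \<le> potential (y x) + t * (f (y x + t * d x) * d x)"
        using potential_tangent[of "y x + t * d x" "y x"] by (simp add: algebra_simps)
      also have "f (y x + t * d x) * d x \<le> f (y x) * d x + t * lip * (d x)\<^sup>2"
      proof -
        have "(f (y x + t * d x) - f (y x)) * d x \<le> \<bar>f (y x + t * d x) - f (y x)\<bar> * \<bar>d x\<bar>"
          by (metis abs_ge_self abs_mult)
        also have "\<dots> \<le> (lip * \<bar>t * d x\<bar>) * \<bar>d x\<bar>"
          using lip(2)[of "y x + t * d x" "y x"] by (intro mult_right_mono) auto
        also have "\<dots> = t * lip * (d x)\<^sup>2" using t by (simp add: abs_mult power2_eq_square)
        finally show ?thesis by (simp add: algebra_simps)
      qed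
      finally show "potential (y x + t * d x) \<le> potential (y x) + t * (f (y x) * d x) + t\<^sup>2 * lip * (d x)\<^sup>2"
        using t by (simp add: algebra_simps power2_eq_square)
    qed (use L ytL potential_integrable L2_times_integrable f_L2 in \<open>auto simp: L2_iff\<close>)
    moreover have "\<dots> = (LINT x|\<mu>. potential (y x)) + t * (LINT x|\<mu>. f (y x) * d x) + t\<^sup>2 * lip * sq_norm d"
      using L potential_integrable L2_times_integrable[OF f_L2] by (simp add: sq_norm_def L2_iff)
    moreover have "(LINT x|\<mu>. u x * (y x + t * d x)) = (LINT x|\<mu>. u x * y x) + t * (LINT x|\<mu>. u x * d x)"
      using L u L2_times_integrable by (simp add: distrib_left mult.left_commute)
    moreover have "t * res u y d = t * energy y d + t * (LINT x|\<mu>. f (y x) * d x) - t * (LINT x|\<mu>. u x * d x)"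
      "t\<^sup>2 * K = t\<^sup>2 * energy d d / 2 + t\<^sup>2 * lip * sq_norm d"
      by (simp_all add: res_def K_def algebra_simps)
    ultimately have "J u (\<lambda>x. y x + t * d x) \<le> J u y + t * res u y d + t\<^sup>2 * K"
      unfolding J_def by linarith
    with min[OF yt] have "0 \<le> t * (res u y d + t * K)" by (simp add: algebra_simps power2_eq_square)
    then show ?thesis using t by (simp add: zero_le_mult_iff)
  qed
  have "(\<lambda>n. res u y d + inverse (real (Suc n)) * K) \<longlonglongrightarrow> res u y d + 0 * K"
    by (intro tendsto_intros LIMSEQ_inverse_real_of_nat)
  moreover have "0 \<le> res u y d + inverse (real (Suc n)) * K" for n
    by (rule key) (auto simp: inverse_eq_divide)
  ultimately have "0 \<le> res u y d" using LIMSEQ_le_const by fastforce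
  then show "0 \<le> res u y (\<lambda>x. v x - y x)" by (simp add: d_def[abs_def])
qed (rule y)

text \<open>
  The zero function is admissible, the infimum is finite, and the constraint set is convex and
  closed under almost-everywhere limits.
\<close>

lemma VI_exists:
  assumes u: "u \<in> L2" and p: "AE x in \<mu>. 0 \<le> p x"
  shows "\<exists>y. VI p u y"
proof -
  let ?K = "below \<Omega> p"
  have zero: "(\<lambda>_. 0) \<in> ?K" using p by (simp add: below_def H10_zero zero_ereal_def)
  have bdd: "bdd_below (J u ` ?K)"
    using J_bounded_below[OF u] by (intro bdd_belowI[of _ "- poincare_const * sq_norm u"])
        (auto simp: below_def)
  define m where "m = Inf (J u ` ?K)"
  have m_le: "m \<le> J u v" if "v \<in> ?K" for v
    unfolding m_def using that bdd by (intro cInf_lower) auto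
  have "\<exists>v\<in>?K. J u v < m + inverse (real (Suc n))" for n
  proof -
    have "Inf (J u ` ?K) < m + inverse (real (Suc n))" by (simp add: m_def)
    then show ?thesis using cInf_lessD[of "J u ` ?K"] zero by blast
  qed
  then obtain v where v: "\<And>n. v n \<in> ?K" "\<And>n. J u (v n) < m + inverse (real (Suc n))" by metis
  have vH: "v n \<in> H" for n using v(1) by (simp add: below_def)
  have est: "energy (\<lambda>x. v j x - v k x) (\<lambda>x. v j x - v k x)
      < 4 * (inverse (real (Suc j)) + inverse (real (Suc k)))" for j k
  proof -
    have "AE x in \<mu>. ereal (1/2 * (v j x + v k x)) \<le> p x"
    proof -
      have "AE x in \<mu>. ereal (v j x) \<le> p x" "AE x in \<mu>. ereal (v k x) \<le> p x" using v by (auto simp: below_def)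
      then show ?thesis
      proof eventually_elim
        case (elim x)
        have "1/2 * (v j x + v k x) \<le> max (v j x) (v k x)" by (simp add: max_def)
        then show ?case using elim by (cases "p x") (auto simp: max_def split: if_splits)
      qed
    qed
    then have "(\<lambda>x. 1/2 * (v j x + v k x)) \<in> ?K" using vH by
        (simp add: below_def H10_add H10_cmult del: times_divide_eq_left)
    define a b E where "a = inverse (real (Suc j))" and "b = inverse (real (Suc k))"
      and "E = energy (\<lambda>x. v j x - v k x) (\<lambda>x. v j x - v k x)"
    from m_le[OF \<open>(\<lambda>x. 1/2 * (v j x + v k x)) \<in> ?K\<close>] J_midpoint[OF u vH vH, of j k]
    have "m \<le> (J u (v j) + J u (v k)) / 2 - E / 8" unfolding E_def by (rule order_trans)
    moreover have "J u (v j) < m + a" "J u (v k) < m + b" using v(2) by (simp_all add: a_def b_def)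
    ultimately show ?thesis unfolding a_def[symmetric] b_def[symmetric] E_def[symmetric] by argo
  qed
  obtain y where y: "y \<in> H" "L2_tendsto v y" "\<And>i. L2_tendsto (\<lambda>n. weak_deriv \<Omega> i (v n)) (weak_deriv \<Omega> i y)"
  proof (rule H10_complete[of v])
    fix e :: real assume e: "e > 0"
    then obtain M where M: "inverse (real (Suc M)) < e / 8" using reals_Archimedean[of "e / 8"] by auto
    have "energy (\<lambda>x. v j x - v k x) (\<lambda>x. v j x - v k x) < e" if "j \<ge> M" "k \<ge> M" for j k
    proof -
      have "inverse (real (Suc j)) \<le> inverse (real (Suc M))" "inverse (real (Suc k)) \<le> inverse (real (Suc M))"
        using that by (auto intro!: le_imp_inverse_le)
      then show ?thesis using est[of j k] M by argo
    qed
    then show "\<exists>M. \<forall>j\<ge>M. \<forall>k\<ge>M. energy (\<lambda>x. v j x - v k x) (\<lambda>x. v j x - v k x) < e" by blast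
  qed (use vH in auto)
  have "J u y \<le> m"
  proof (rule J_lower_semicontinuous[OF u vH y])
    show "J u (v n) \<le> m + inverse (real (Suc n))" for n using v(2)[of n] by simp
    show "(\<lambda>n. m + inverse (real (Suc n))) \<longlonglongrightarrow> m"
      using tendsto_add[OF tendsto_const LIMSEQ_inverse_real_of_nat, of m] by simp
  qed
  moreover have "y \<in> ?K"
  proof -
    obtain r where r: "strict_mono (r :: nat \<Rightarrow> nat)" "AE x in \<mu>. (\<lambda>n. v (r n) x) \<longlonglongrightarrow> y x"
      by (rule L2_tendsto_AE_subseq[OF y(2)])
    have "AE x in \<mu>. \<forall>n. ereal (v n x) \<le> p x" using v(1) by (simp add: AE_all_countable below_def)
    with r(2) have "AE x in \<mu>. ereal (y x) \<le> p x"
    proof eventually_elim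
      case (elim x)
      then show ?case by (intro LIMSEQ_le_const2[of "\<lambda>n. ereal (v (r n) x)"]) auto
    qed
    then show ?thesis using y(1) by (simp add: below_def)
  qed
  ultimately have "VI p u y" using m_le by (intro J_minimizer_VI[OF u]) force+
  then show ?thesis by blast
qed

lemma obstacle_sol_VI:
  assumes "u \<in> L2" "AE x in \<mu>. 0 \<le> p x"
  shows "VI p u (obstacle_sol \<Omega> f p (L2_functional \<Omega> u))"
  using someI_ex[OF VI_exists[OF assms]]
  unfolding obstacle_sol_def VI_def residual_eq_res .

end

section \<open>Essentially bounded functions\<close>

context bounded_domain
begin

abbreviation "BM \<equiv> borel_measurable \<mu> :: (real ^ 'n \<Rightarrow> real) set"

lemma Linf_AE_le:
  assumes "v \<in> Linf \<Omega>" shows "AE x in \<mu>. \<bar>v x\<bar> \<le> Linf_norm \<Omega> v"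
proof -
  let ?e = "esssup \<mu> (\<lambda>x. ereal \<bar>v x\<bar>)"
  have fin: "?e < \<infinity>" using assms by (simp add: Linf_def)
  have "AE x in \<mu>. ereal \<bar>v x\<bar> \<le> ?e" by (rule esssup_AE)
  then show ?thesis
  proof eventually_elim
    case (elim x)
    then show ?case using fin by (cases "?e") (auto simp: Linf_norm_def)
  qed
qed

lemma LinfI:
  assumes "v \<in> BM" "AE x in \<mu>. \<bar>v x\<bar> \<le> B" shows "v \<in> Linf \<Omega>"
proof -
  have "esssup \<mu> (\<lambda>x. ereal \<bar>v x\<bar>) \<le> ereal B"
    by (rule esssup_I) (use assms in auto)
  also have "\<dots> < \<infinity>" by simp
  finally show ?thesis using assms by (simp add: Linf_def)
qed

lemma Linf_norm_le:
  assumes "v \<in> BM" "AE x in \<mu>. \<bar>v x\<bar> \<le> B" "0 \<le> B" shows "Linf_norm \<Omega> v \<le> B"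
proof -
  have "esssup \<mu> (\<lambda>x. ereal \<bar>v x\<bar>) \<le> ereal B"
    by (rule esssup_I) (use assms in auto)
  then show ?thesis using assms(3) unfolding Linf_norm_def
    by (cases "esssup \<mu> (\<lambda>x. ereal \<bar>v x\<bar>)") auto
qed

lemma Linf_norm_nonneg:
  assumes "v \<in> BM" shows "0 \<le> Linf_norm \<Omega> v"
proof (rule ccontr)
  let ?e = "esssup \<mu> (\<lambda>x. ereal \<bar>v x\<bar>)"
  assume "\<not> 0 \<le> Linf_norm \<Omega> v"
  then have neg: "?e < 0" and fin: "?e \<noteq> - \<infinity>" by (cases ?e; simp add: Linf_norm_def)+
  have "AE x in \<mu>. ereal \<bar>v x\<bar> \<le> ?e" by (rule esssup_AE)
  then have F: "AE x in \<mu>. False"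
    by eventually_elim (use neg in \<open>meson abs_ge_zero ereal_less_eq(5) leD order_trans\<close>)
  have "?e \<le> c" for c
    by (rule esssup_I) (use assms F in \<open>auto elim: eventually_mono\<close>)
  then have "?e \<le> - \<infinity>" by blast
  with fin show False by simp
qed

lemma Linf_BM: "v \<in> Linf \<Omega> \<Longrightarrow> v \<in> BM"
  by (simp add: Linf_def)

lemma Linf_L2: "v \<in> Linf \<Omega> \<Longrightarrow> v \<in> L2"
  by (rule L2_bounded[OF Linf_BM Linf_AE_le])

lemma Linf_add:
  assumes "v \<in> Linf \<Omega>" "w \<in> Linf \<Omega>" shows "(\<lambda>x. v x + w x) \<in> Linf \<Omega>"
proof (rule LinfI[of _ "Linf_norm \<Omega> v + Linf_norm \<Omega> w"])
  show "AE x in \<mu>. \<bar>v x + w x\<bar> \<le> Linf_norm \<Omega> v + Linf_norm \<Omega> w"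
    using Linf_AE_le[OF assms(1)] Linf_AE_le[OF assms(2)] by eventually_elim linarith
qed (intro borel_measurable_add Linf_BM assms)

lemma Linf_cmult:
  assumes "v \<in> Linf \<Omega>" shows "(\<lambda>x. c * v x) \<in> Linf \<Omega>"
proof (rule LinfI[of _ "\<bar>c\<bar> * Linf_norm \<Omega> v"])
  show "AE x in \<mu>. \<bar>c * v x\<bar> \<le> \<bar>c\<bar> * Linf_norm \<Omega> v"
    using Linf_AE_le[OF assms] by eventually_elim (simp add: abs_mult mult_left_mono)
qed (intro borel_measurable_times borel_measurable_const Linf_BM assms)

lemma Linf_diff: "v \<in> Linf \<Omega> \<Longrightarrow> w \<in> Linf \<Omega> \<Longrightarrow> (\<lambda>x. v x - w x) \<in> Linf \<Omega>"
  using Linf_add[OF _ Linf_cmult[of _ "-1"]] by simp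

lemma Linf_AE_cong: "v \<in> Linf \<Omega> \<Longrightarrow> AE x in \<mu>. v x = w x \<Longrightarrow> w \<in> Linf \<Omega>"
  using Linf_AE_le[of v] measurable_AE_cong[OF Linf_BM, of v w]
  by (intro LinfI[of w "Linf_norm \<Omega> v"]) auto

text \<open>
  A Tarski fixed point theorem for the almost-everywhere order.  The least prefixed point is the
  infimum of a sequence that minimises the integral among all bounded prefixed points; countably
  many functions suffice because any further decrease would lower the integral.
\<close>

lemma least_prefixed_point:
  fixes T :: "(real ^ 'n \<Rightarrow> real) \<Rightarrow> real ^ 'n \<Rightarrow> real"
  assumes meas: "\<And>v. v \<in> BM \<Longrightarrow> T v \<in> BM"
    and mono: "\<And>v w. v \<in> BM \<Longrightarrow> w \<in> BM \<Longrightarrow> AE x in \<mu>. v x \<le> w x \<Longrightarrow> AE x in \<mu>. T v x \<le> T w x"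
    and range: "\<And>v. v \<in> BM \<Longrightarrow> AE x in \<mu>. 0 \<le> T v x \<and> T v x \<le> B"
  shows "\<exists>w\<in>BM. (AE x in \<mu>. T w x = w x)
    \<and> (\<forall>v\<in>BM. (AE x in \<mu>. T v x \<le> v x) \<longrightarrow> (AE x in \<mu>. w x \<le> v x))"
proof -
  define A where "A = {v \<in> BM. (AE x in \<mu>. 0 \<le> v x \<and> v x \<le> B) \<and> (AE x in \<mu>. T v x \<le> v x)}"
  have const: "(\<lambda>_. B) \<in> A"
    using range[of "\<lambda>_. B"] unfolding A_def by (auto elim: eventually_mono)
  have int: "integrable \<mu> v" if "v \<in> A" for v
    using that unfolding A_def by (intro integrable_const_bound[of v B]) (auto elim: eventually_mono)
  have TA: "T v \<in> A" if "v \<in> A" for v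
    using that meas range[of "v"] mono[of "T v" v] unfolding A_def by auto
  let ?I = "\<lambda>v. LINT x|\<mu>. v x"
  have nonneg: "0 \<le> ?I v" if "v \<in> A" for v
    using that unfolding A_def by (intro integral_nonneg_AE) (auto elim: eventually_mono)
  have bdd: "bdd_below (?I ` A)" using nonneg by (auto intro!: bdd_belowI[of _ 0])
  define i where "i = Inf (?I ` A)"
  have i_le: "i \<le> ?I v" if "v \<in> A" for v unfolding i_def using that bdd by (intro cInf_lower) auto
  have "\<exists>v\<in>A. ?I v < i + inverse (real (Suc n))" for n
  proof -
    have "Inf (?I ` A) < i + inverse (real (Suc n))" by (simp add: i_def)
    then show ?thesis using cInf_lessD[of "?I ` A"] const by blast
  qed
  then obtain v where v: "\<And>n. v n \<in> A" "\<And>n. ?I (v n) < i + inverse (real (Suc n))" by metis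
  define w where "w x = (INF n. max 0 (v n x))" for x
  have w_le: "w x \<le> max 0 (v n x)" for x n
    unfolding w_def by (rule cINF_lower) (auto intro: bdd_belowI[of _ 0])
  have vBM: "v n \<in> BM" for n using v(1) by (simp add: A_def)
  have wBM: "w \<in> BM"
  proof -
    have "(\<lambda>x. max 0 (v n x)) \<in> BM" for n using vBM by simp
    then show ?thesis unfolding w_def[abs_def] by (intro borel_measurable_cINF_real) auto
  qed
  have pos: "AE x in \<mu>. \<forall>n. 0 \<le> v n x \<and> v n x \<le> B" using v(1) by (simp add: A_def AE_all_countable)
  have w_le_v: "AE x in \<mu>. \<forall>n. w x \<le> v n x" using pos by eventually_elim (metis w_le max_absorb2)
  have "AE x in \<mu>. T w x \<le> v n x" for n
  proof -
    have "AE x in \<mu>. w x \<le> v n x" using w_le_v by (auto elim: eventually_mono)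
    from mono[OF wBM vBM this] have "AE x in \<mu>. T w x \<le> T (v n) x" .
    moreover have "AE x in \<mu>. T (v n) x \<le> v n x" using v(1) by (simp add: A_def)
    ultimately show ?thesis by eventually_elim simp
  qed
  then have "AE x in \<mu>. \<forall>n. T w x \<le> v n x" by (simp add: AE_all_countable)
  then have Tw: "AE x in \<mu>. T w x \<le> w x"
    by eventually_elim (auto simp: w_def intro!: cINF_greatest max.coboundedI2)
  have w0: "0 \<le> w x" for x unfolding w_def by (rule cINF_greatest) auto
  have wA: "w \<in> A"
  proof -
    have "AE x in \<mu>. 0 \<le> w x \<and> w x \<le> B"
      using w_le_v pos by eventually_elim (use w0 order_trans in blast)
    then show ?thesis using wBM Tw by (simp add: A_def)
  qed
  have Iw: "?I w \<le> i"
  proof (rule LIMSEQ_le_const)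
    show "(\<lambda>n. i + inverse (real (Suc n))) \<longlonglongrightarrow> i"
      using tendsto_add[OF tendsto_const LIMSEQ_inverse_real_of_nat, of i] by simp
    have "?I w \<le> ?I (v n)" for n
      by (rule integral_mono_AE[OF int[OF wA] int[OF v(1)]]) (use w_le_v in \<open>auto elim: eventually_mono\<close>)
    then show "\<exists>N. \<forall>n\<ge>N. ?I w \<le> i + inverse (real (Suc n))" using v(2) by (meson le_less_trans less_imp_le)
  qed
  have eq: "AE x in \<mu>. w x = z x" if z: "z \<in> A" "AE x in \<mu>. z x \<le> w x" for z
  proof -
    have "(LINT x|\<mu>. w x - z x) = 0"
      using integral_mono_AE[OF int[OF z(1)] int[OF wA] z(2)] i_le[OF z(1)] Iw int[OF z(1)] int[OF wA] by simp
    then have "AE x in \<mu>. w x - z x = 0"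
      using z int[OF z(1)] int[OF wA] by (subst (asm) integral_nonneg_eq_0_iff_AE) auto
    then show ?thesis by eventually_elim simp
  qed
  show ?thesis
  proof (intro bexI[OF _ wBM] conjI ballI impI)
    show "AE x in \<mu>. T w x = w x" using eq[OF TA[OF wA] Tw] by eventually_elim simp
    fix z assume z: "z \<in> BM" "AE x in \<mu>. T z x \<le> z x"
    define z' where "z' x = min (z x) (w x)" for x
    have z'BM: "z' \<in> BM" unfolding z'_def[abs_def] using z wBM by simp
    have "AE x in \<mu>. T z' x \<le> T z x" "AE x in \<mu>. T z' x \<le> T w x"
      by (rule mono[OF z'BM z(1)], simp add: z'_def, rule mono[OF z'BM wBM], simp add: z'_def)
    then have "AE x in \<mu>. T z' x \<le> z' x"
      using z(2) Tw by eventually_elim (simp add: z'_def)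
    moreover have "AE x in \<mu>. 0 \<le> z' x \<and> z' x \<le> B"
    proof -
      have "AE x in \<mu>. 0 \<le> w x \<and> w x \<le> B" using wA by (simp add: A_def)
      then show ?thesis using range[OF z(1)] z(2) by eventually_elim (auto simp: z'_def)
    qed
    ultimately have "z' \<in> A" using z'BM by (simp add: A_def)
    from eq[OF this] have "AE x in \<mu>. w x = z' x" by (simp add: z'_def)
    then show "AE x in \<mu>. w x \<le> z x" by eventually_elim (simp add: z'_def min_def split: if_splits)
  qed
qed

text \<open>
  The order reflection \<open>v \<mapsto> B - v\<close> exchanges prefixed and postfixed points.
\<close>

lemma greatest_postfixed_point:
  fixes T :: "(real ^ 'n \<Rightarrow> real) \<Rightarrow> real ^ 'n \<Rightarrow> real"
  assumes meas: "\<And>v. v \<in> BM \<Longrightarrow> T v \<in> BM"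
    and mono: "\<And>v w. v \<in> BM \<Longrightarrow> w \<in> BM \<Longrightarrow> AE x in \<mu>. v x \<le> w x \<Longrightarrow> AE x in \<mu>. T v x \<le> T w x"
    and range: "\<And>v. v \<in> BM \<Longrightarrow> AE x in \<mu>. 0 \<le> T v x \<and> T v x \<le> B"
  shows "\<exists>w\<in>BM. (AE x in \<mu>. T w x = w x)
    \<and> (\<forall>v\<in>BM. (AE x in \<mu>. v x \<le> T v x) \<longrightarrow> (AE x in \<mu>. v x \<le> w x))"
proof -
  have BMd: "(\<lambda>x. B - v x) \<in> BM" if "v \<in> BM" for v using that by simp
  have "\<exists>w\<in>BM. (AE x in \<mu>. B - T (\<lambda>x. B - w x) x = w x)
    \<and> (\<forall>v\<in>BM. (AE x in \<mu>. B - T (\<lambda>x. B - v x) x \<le> v x) \<longrightarrow> (AE x in \<mu>. w x \<le> v x))"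
  proof (rule least_prefixed_point[of "\<lambda>v x. B - T (\<lambda>x. B - v x) x" B])
    show "(\<lambda>x. B - T (\<lambda>x. B - v x) x) \<in> BM" if "v \<in> BM" for v by (intro BMd meas that)
    fix v z assume vz: "v \<in> BM" "z \<in> BM" "AE x in \<mu>. v x \<le> z x"
    have "AE x in \<mu>. T (\<lambda>x. B - z x) x \<le> T (\<lambda>x. B - v x) x"
      by (rule mono[OF BMd BMd]) (use vz in auto)
    then show "AE x in \<mu>. B - T (\<lambda>x. B - v x) x \<le> B - T (\<lambda>x. B - z x) x" by eventually_elim simp
  next
    fix v assume "v \<in> BM"
    from range[OF BMd[OF this]] show "AE x in \<mu>. 0 \<le> B - T (\<lambda>x. B - v x) x \<and> B - T (\<lambda>x. B - v x) x \<le> B"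
      by eventually_elim simp
  qed
  then obtain w where w: "w \<in> BM" "AE x in \<mu>. B - T (\<lambda>x. B - w x) x = w x"
    "\<And>v. v \<in> BM \<Longrightarrow> AE x in \<mu>. B - T (\<lambda>x. B - v x) x \<le> v x \<Longrightarrow> AE x in \<mu>. w x \<le> v x"
    by blast
  show ?thesis
  proof (intro bexI[OF _ BMd[OF w(1)]] conjI ballI impI)
    show "AE x in \<mu>. T (\<lambda>x. B - w x) x = B - w x" using w(2) by eventually_elim simp
    fix v assume v: "v \<in> BM" "AE x in \<mu>. v x \<le> T v x"
    have "AE x in \<mu>. B - T (\<lambda>x. B - (B - v x)) x \<le> B - v x" using v(2) by eventually_elim simp
    from w(3)[OF BMd[OF v(1)] this] show "AE x in \<mu>. v x \<le> B - w x" by eventually_elim simp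
  qed
qed

end

section \<open>The impulse control obstacle\<close>

lemma ereal_le_if_reals_le:
  fixes X Y :: ereal
  assumes "\<And>a. ereal a \<le> X \<Longrightarrow> ereal a \<le> Y" shows "X \<le> Y"
proof (cases X)
  case PInf
  then have "ereal a \<le> Y" for a using assms by simp
  then show ?thesis using ereal_top by (metis top_ereal_def top_greatest)
qed (use assms in auto)

locale impulse_control = semilinear \<Omega> f for \<Omega> :: "(real ^ 'n) set" and f :: "real \<Rightarrow> real" +
  fixes \<kappa> :: real and c0 :: "real ^ 'n \<Rightarrow> real"
  assumes kappa_nonneg: "0 \<le> \<kappa>"
    and c0_measurable: "c0 \<in> borel_measurable lebesgue"
    and c0_nonneg: "AE x in lebesgue. 0 \<le> c0 x"
begin

abbreviation shifts :: "real ^ 'n \<Rightarrow> (real ^ 'n) set" where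
  "shifts x \<equiv> {\<xi>. 0 \<le> \<xi> \<and> x + \<xi> \<in> \<Omega>}"

lemma shifts_sets: "shifts x \<in> sets lebesgue"
proof -
  have "closed {\<xi> :: real ^ 'n. 0 \<le> \<xi>}"
    unfolding less_eq_vec_def by (intro closed_Collect_all closed_Collect_le continuous_intros)
  moreover have "open ((\<lambda>\<xi>. x + \<xi>) -` \<Omega>)"
    by (rule open_vimage[OF open_domain]) (intro continuous_intros)
  ultimately have "{\<xi> :: real ^ 'n. 0 \<le> \<xi>} \<inter> ((\<lambda>\<xi>. x + \<xi>) -` \<Omega>) \<in> sets borel"
    by (intro sets.Int borel_closed borel_open)
  moreover have "shifts x = {\<xi> :: real ^ 'n. 0 \<le> \<xi>} \<inter> ((\<lambda>\<xi>. x + \<xi>) -` \<Omega>)" by auto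
  ultimately show ?thesis by simp
qed

text \<open>
  Null sets are translation invariant, so an almost-everywhere inequality on the domain holds for
  almost every shift of each single point.
\<close>

lemma AE_shift:
  assumes "AE z in \<mu>. P z" shows "AE \<xi> in lebesgue_on (shifts x). P (x + \<xi>)"
proof -
  have "AE z in lebesgue. z \<in> \<Omega> \<longrightarrow> P z"
    using assms domain_sets by (subst (asm) AE_restrict_space_iff) auto
  then have "{z. \<not> (z \<in> \<Omega> \<longrightarrow> P z)} \<in> null_sets lebesgue"
    by (simp add: completion.AE_iff_null_sets)
  then have "negligible {z. \<not> (z \<in> \<Omega> \<longrightarrow> P z)}" by (simp add: negligible_iff_null_sets)
  then have "negligible ((+) (- x) ` {z. \<not> (z \<in> \<Omega> \<longrightarrow> P z)})" by (rule negligible_translation)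
  moreover have "{\<xi>. \<not> (x + \<xi> \<in> \<Omega> \<longrightarrow> P (x + \<xi>))} \<subseteq> (+) (- x) ` {z. \<not> (z \<in> \<Omega> \<longrightarrow> P z)}"
    by (force simp: image_iff intro: exI[of _ "x + _"])
  ultimately have "negligible {\<xi>. \<not> (x + \<xi> \<in> \<Omega> \<longrightarrow> P (x + \<xi>))}" by (rule negligible_subset)
  then have "AE \<xi> in lebesgue. x + \<xi> \<in> \<Omega> \<longrightarrow> P (x + \<xi>)"
    by (simp add: completion.AE_iff_null_sets negligible_iff_null_sets)
  then show ?thesis
    using shifts_sets by (subst AE_restrict_space_iff) (auto elim: eventually_mono)
qed

lemma measurable_shift:
  assumes "y \<in> BM" shows "(\<lambda>\<xi>. y (x + \<xi>)) \<in> borel_measurable (lebesgue_on (shifts x))"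
proof -
  have "(\<lambda>z. if z \<in> \<Omega> then y z else 0) \<in> borel_measurable lebesgue"
    using borel_measurable_if_I[OF assms] domain_sets by simp
  moreover have "(\<lambda>\<xi>. x + \<xi>) \<in> lebesgue \<rightarrow>\<^sub>M lebesgue"
    using lebesgue_affine_measurable[of "\<lambda>_. 1" x] by (simp add: euclidean_representation)
  ultimately have "(\<lambda>\<xi>. if x + \<xi> \<in> \<Omega> then y (x + \<xi>) else 0) \<in> borel_measurable lebesgue"
    using measurable_compose by fastforce
  then have "(\<lambda>\<xi>. if x + \<xi> \<in> \<Omega> then y (x + \<xi>) else 0) \<in> borel_measurable (lebesgue_on (shifts x))"
    by (rule measurable_restrict_space1)
  then show ?thesis by (rule measurable_cong[THEN iffD1, rotated]) (simp add: space_restrict_space)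
qed

text \<open>
  Each property of the obstacle below is an almost-everywhere inequality through this
  description of its real lower bounds.
\<close>

lemma Theta_ge_iff:
  assumes "y \<in> BM"
  shows "ereal a \<le> Theta \<Omega> \<kappa> c0 y x \<longleftrightarrow> (AE \<xi> in lebesgue_on (shifts x). a \<le> \<kappa> + c0 \<xi> + y (x + \<xi>))"
proof -
  let ?M = "lebesgue_on (shifts x)"
  let ?g = "\<lambda>\<xi>. - ereal (c0 \<xi> + y (x + \<xi>))"
  have "(\<lambda>\<xi>. c0 \<xi> + y (x + \<xi>)) \<in> borel_measurable ?M"
    by (intro borel_measurable_add measurable_shift assms measurable_restrict_space1 c0_measurable)
  from borel_measurable_uminus_ereal[OF borel_measurable_ereal[OF this]]
  have meas: "?g \<in> borel_measurable ?M" .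
  have "ereal a \<le> Theta \<Omega> \<kappa> c0 y x \<longleftrightarrow> esssup ?M ?g \<le> ereal (\<kappa> - a)"
    unfolding Theta_def essinf_def by (cases "esssup ?M ?g") auto
  also have "\<dots> \<longleftrightarrow> (AE \<xi> in ?M. ?g \<xi> \<le> ereal (\<kappa> - a))"
  proof
    assume e: "esssup ?M ?g \<le> ereal (\<kappa> - a)"
    from esssup_AE[of ?g ?M] show "AE \<xi> in ?M. ?g \<xi> \<le> ereal (\<kappa> - a)"
      by eventually_elim (rule order_trans[OF _ e])
  qed (rule esssup_I[OF meas])
  also have "\<dots> \<longleftrightarrow> (AE \<xi> in ?M. a \<le> \<kappa> + c0 \<xi> + y (x + \<xi>))"
    by (intro AE_cong) auto
  finally show ?thesis .
qed

lemma AE_c0_shift: "AE \<xi> in lebesgue_on (shifts x). 0 \<le> c0 \<xi>"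
  using c0_nonneg shifts_sets by (subst AE_restrict_space_iff) (auto elim: eventually_mono)

abbreviation "Obs \<equiv> Phi \<Omega> \<kappa> c0"

lemma cutoff_BM: "v \<in> BM \<Longrightarrow> (\<lambda>x. max (- \<kappa>) (v x)) \<in> BM"
  by simp

lemmas Phi_ge_iff = Theta_ge_iff[OF cutoff_BM, folded Phi_def]

lemma Theta_AE_cong:
  assumes "v \<in> BM" "w \<in> BM" "AE x in \<mu>. v x = w x" shows "Theta \<Omega> \<kappa> c0 v x = Theta \<Omega> \<kappa> c0 w x"
proof (rule antisym; rule ereal_le_if_reals_le)
  fix a
  show "ereal a \<le> Theta \<Omega> \<kappa> c0 w x" if "ereal a \<le> Theta \<Omega> \<kappa> c0 v x"
    using that AE_shift[OF assms(3), of x] unfolding Theta_ge_iff[OF assms(1)] Theta_ge_iff[OF assms(2)]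
    by eventually_elim simp
  show "ereal a \<le> Theta \<Omega> \<kappa> c0 v x" if "ereal a \<le> Theta \<Omega> \<kappa> c0 w x"
    using that AE_shift[OF assms(3), of x] unfolding Theta_ge_iff[OF assms(1)] Theta_ge_iff[OF assms(2)]
    by eventually_elim simp
qed

lemma Phi_mono:
  assumes "v \<in> BM" "w \<in> BM" "AE x in \<mu>. v x \<le> w x" shows "Obs v x \<le> Obs w x"
proof (rule ereal_le_if_reals_le)
  fix a assume "ereal a \<le> Obs v x"
  then show "ereal a \<le> Obs w x"
    using AE_shift[OF assms(3), of x] unfolding Phi_ge_iff[OF assms(1)] Phi_ge_iff[OF assms(2)]
    by eventually_elim auto
qed

lemma Phi_AE_cong: "v \<in> BM \<Longrightarrow> w \<in> BM \<Longrightarrow> AE x in \<mu>. v x = w x \<Longrightarrow> Obs v = Obs w"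
  by (intro ext antisym Phi_mono) auto

lemma Phi_nonneg: assumes "v \<in> BM" shows "0 \<le> Obs v x"
proof -
  have "ereal 0 \<le> Obs v x"
    unfolding Phi_ge_iff[OF assms] using AE_c0_shift by eventually_elim auto
  then show ?thesis by (simp add: zero_ereal_def)
qed

lemma Phi_ge_kappa:
  assumes "v \<in> BM" "AE x in \<mu>. 0 \<le> v x" shows "ereal \<kappa> \<le> Obs v x"
  unfolding Phi_ge_iff[OF assms(1)] using AE_c0_shift AE_shift[OF assms(2)] by eventually_elim auto

text \<open>
  The obstacle is an infimum of affine functionals.  The lower bounds on \<open>v\<close> and \<open>w\<close> make the
  cut-off at \<open>- \<kappa>\<close>, which is convex rather than concave, inactive.
\<close>

lemma Phi_concave:
  assumes "v \<in> BM" "w \<in> BM" "AE x in \<mu>. - \<kappa> \<le> v x" "AE x in \<mu>. - \<kappa> \<le> w x" "0 \<le> t" "t \<le> 1"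
    and "ereal a \<le> Obs v x" "ereal b \<le> Obs w x"
  shows "ereal (t * a + (1 - t) * b) \<le> Obs (\<lambda>x. t * v x + (1 - t) * w x) x"
proof -
  have "(\<lambda>x. t * v x + (1 - t) * w x) \<in> BM" using assms by simp
  note iff = Phi_ge_iff[OF assms(1)] Phi_ge_iff[OF assms(2)] Phi_ge_iff[OF this]
  show ?thesis
    using assms(7,8) AE_shift[OF assms(3), of x] AE_shift[OF assms(4), of x] unfolding iff
  proof eventually_elim
    case (elim \<xi>)
    have "t * a \<le> t * (\<kappa> + c0 \<xi> + v (x + \<xi>))" "(1 - t) * b \<le> (1 - t) * (\<kappa> + c0 \<xi> + w (x + \<xi>))"
      using elim assms(5,6) by (auto intro!: mult_left_mono)
    then have "t * a + (1 - t) * b \<le> \<kappa> + c0 \<xi> + (t * v (x + \<xi>) + (1 - t) * w (x + \<xi>))"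
      by (simp add: algebra_simps)
    then show ?case by auto
  qed
qed

definition \<Psi> :: "(real ^ 'n \<Rightarrow> real) \<Rightarrow> (real ^ 'n \<Rightarrow> real) \<Rightarrow> real ^ 'n \<Rightarrow> real" where
  "\<Psi> v u = Psi \<Omega> \<kappa> c0 f v (L2_functional \<Omega> u)"

lemma Psi_VI: "v \<in> BM \<Longrightarrow> u \<in> L2 \<Longrightarrow> VI (Obs v) u (\<Psi> v u)"
  unfolding \<Psi>_def Psi_def by (intro obstacle_sol_VI) (auto simp: Phi_nonneg)

lemma Psi_H: "v \<in> BM \<Longrightarrow> u \<in> L2 \<Longrightarrow> \<Psi> v u \<in> H"
  by (rule VI_H[OF Psi_VI])

lemma H_BM: "y \<in> H \<Longrightarrow> y \<in> BM"
  by (rule L2_measurable[OF H10_L2])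

lemma Psi_BM: "v \<in> BM \<Longrightarrow> u \<in> L2 \<Longrightarrow> \<Psi> v u \<in> BM"
  by (rule H_BM[OF Psi_H])

lemma Psi_ge:
  assumes "v \<in> BM" "u \<in> L2" "subsolution u z" "AE x in \<mu>. ereal (z x) \<le> Obs v x"
  shows "AE x in \<mu>. z x \<le> \<Psi> v u x"
  by (rule comparison[OF Psi_VI[OF assms(1,2)] assms(3,4,2)])

lemma Psi_mono:
  assumes "v \<in> BM" "w \<in> BM" "u1 \<in> L2" "u2 \<in> L2" "AE x in \<mu>. v x \<le> w x" "AE x in \<mu>. u1 x \<le> u2 x"
  shows "AE x in \<mu>. \<Psi> v u1 x \<le> \<Psi> w u2 x"
  by (rule VI_mono[OF Psi_VI Psi_VI]) (use assms Phi_mono[OF assms(1,2,5)] in auto)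

text \<open>
  The convex combination of two solutions is a subsolution below the combined obstacle.
\<close>

lemma Psi_concave:
  assumes "v \<in> BM" "w \<in> BM" "AE x in \<mu>. - \<kappa> \<le> v x" "AE x in \<mu>. - \<kappa> \<le> w x" "0 \<le> t" "t \<le> 1"
    "u1 \<in> L2" "u2 \<in> L2"
  shows "AE x in \<mu>. t * \<Psi> v u1 x + (1 - t) * \<Psi> w u2 x
      \<le> \<Psi> (\<lambda>x. t * v x + (1 - t) * w x) (\<lambda>x. t * u1 x + (1 - t) * u2 x) x"
proof (rule Psi_ge)
  note P = Psi_VI[OF assms(1,7)] Psi_VI[OF assms(2,8)]
  show "subsolution (\<lambda>x. t * u1 x + (1 - t) * u2 x) (\<lambda>x. t * \<Psi> v u1 x + (1 - t) * \<Psi> w u2 x)"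
    by (intro subsolution_convex VI_subsolution[OF P(1)] VI_subsolution[OF P(2)] assms)
  show "AE x in \<mu>. ereal (t * \<Psi> v u1 x + (1 - t) * \<Psi> w u2 x) \<le> Obs (\<lambda>x. t * v x + (1 - t) * w x) x"
    using VI_le[OF P(1)] VI_le[OF P(2)] by eventually_elim (rule Phi_concave[OF assms(1-6)])
  show "(\<lambda>x. t * u1 x + (1 - t) * u2 x) \<in> L2" by (intro L2_add L2_cmult assms)
qed (use assms in simp)

lemma Psi_nonneg:
  assumes "v \<in> BM" "u \<in> L2" "AE x in \<mu>. 0 \<le> u x" shows "AE x in \<mu>. 0 \<le> \<Psi> v u x"
  by (rule Psi_ge[OF assms(1,2) subsolution_zero[OF assms(3,2)]])
     (use Phi_nonneg[OF assms(1)] in \<open>simp add: zero_ereal_def[symmetric]\<close>)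

lemma Psi_bound:
  assumes "v \<in> BM" "u \<in> L2" "AE x in \<mu>. u x \<le> U" "0 \<le> U" shows "AE x in \<mu>. \<Psi> v u x \<le> poincare_const * U"
  by (rule subsolution_bound[OF VI_subsolution[OF Psi_VI[OF assms(1,2)]] assms(3,4,2)])

section \<open>Minimal and maximal solutions\<close>

abbreviation "sols u \<equiv> qvi_solutions \<Omega> \<kappa> c0 f (L2_functional \<Omega> u)"

lemma Linf_plusD:
  assumes "u \<in> Linf_plus \<Omega>" shows "u \<in> Linf \<Omega>" "u \<in> L2" "AE x in \<mu>. 0 \<le> u x"
  using assms Linf_L2 by (auto simp: Linf_plus_def)

text \<open>
  For nonnegative functions the cut-off in the obstacle is inactive.
\<close>

lemma sols_iff: "y \<in> sols u \<longleftrightarrow> (AE x in \<mu>. 0 \<le> y x) \<and> VI (Obs y) u y"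
proof (cases "y \<in> H \<and> (AE x in \<mu>. 0 \<le> y x)")
  case True
  have "Theta \<Omega> \<kappa> c0 y = Obs y"
    unfolding Phi_def
  proof (intro ext Theta_AE_cong)
    show "AE x in \<mu>. y x = max (- \<kappa>) (y x)"
      using True kappa_nonneg by (auto elim!: eventually_mono)
  qed (use True H_BM in auto)
  then show ?thesis
    using True unfolding qvi_solutions_def VI_def residual_eq_res below_def by auto
next
  case False
  then show ?thesis using VI_H by (auto simp: qvi_solutions_def)
qed

lemma sols_fixed_point:
  assumes "y \<in> sols u" "u \<in> L2" shows "y \<in> H" "AE x in \<mu>. 0 \<le> y x" "AE x in \<mu>. \<Psi> y u x = y x"
proof -
  have VI: "VI (Obs y) u y" and nn: "AE x in \<mu>. 0 \<le> y x" using assms(1) by (simp_all add: sols_iff)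
  show H: "y \<in> H" by (rule VI_H[OF VI])
  show "AE x in \<mu>. 0 \<le> y x" by (rule nn)
  show "AE x in \<mu>. \<Psi> y u x = y x" by (rule VI_unique[OF Psi_VI[OF H_BM[OF H] assms(2)] VI assms(2)])
qed

lemma fixed_point_sols:
  assumes "w \<in> BM" "u \<in> Linf_plus \<Omega>" "AE x in \<mu>. \<Psi> w u x = w x" shows "\<Psi> w u \<in> sols u"
proof -
  note u = Linf_plusD[OF assms(2)]
  have "Obs (\<Psi> w u) = Obs w" by (rule Phi_AE_cong[OF Psi_BM[OF assms(1) u(2)] assms(1,3)])
  then show ?thesis
    using Psi_VI[OF assms(1) u(2)] Psi_nonneg[OF assms(1) u(2,3)] by (simp add: sols_iff)
qed

lemma Psi_range:
  assumes "u \<in> Linf_plus \<Omega>" "v \<in> BM"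
  shows "AE x in \<mu>. 0 \<le> \<Psi> v u x \<and> \<Psi> v u x \<le> poincare_const * Linf_norm \<Omega> u"
proof -
  note u = Linf_plusD[OF assms(1)]
  have "AE x in \<mu>. u x \<le> Linf_norm \<Omega> u" using Linf_AE_le[OF u(1)] by eventually_elim simp
  from Psi_bound[OF assms(2) u(2) this Linf_norm_nonneg[OF Linf_BM[OF u(1)]]] Psi_nonneg[OF assms(2) u(2,3)]
  show ?thesis by eventually_elim simp
qed

abbreviation "smin \<equiv> min_sol \<Omega> \<kappa> c0 f"
abbreviation "smax \<equiv> max_sol \<Omega> \<kappa> c0 f"

text \<open>
  The least prefixed point of \<open>\<Psi>\<close> is a solution, and the comparison with all supersolutions, which
  need not be solutions, is what the estimates below exploit.
\<close>

lemma min_sol: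
  assumes "u \<in> Linf_plus \<Omega>"
  shows "is_ae_least \<Omega> (sols u) (smin u)"
    "\<And>v. v \<in> BM \<Longrightarrow> AE x in \<mu>. \<Psi> v u x \<le> v x \<Longrightarrow> AE x in \<mu>. smin u x \<le> v x"
proof -
  note u = Linf_plusD[OF assms]
  have "\<exists>w\<in>BM. (AE x in \<mu>. \<Psi> w u x = w x)
    \<and> (\<forall>v\<in>BM. (AE x in \<mu>. \<Psi> v u x \<le> v x) \<longrightarrow> (AE x in \<mu>. w x \<le> v x))"
  proof (rule least_prefixed_point)
    show "AE x in \<mu>. \<Psi> v u x \<le> \<Psi> z u x" if "v \<in> BM" "z \<in> BM" "AE x in \<mu>. v x \<le> z x" for v z
      by (rule Psi_mono[OF that(1,2) u(2,2) that(3)]) simp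
  qed (rule Psi_BM[OF _ u(2)] Psi_range[OF assms], assumption)+
  then obtain w where w: "w \<in> BM" "AE x in \<mu>. \<Psi> w u x = w x"
    "\<And>v. v \<in> BM \<Longrightarrow> AE x in \<mu>. \<Psi> v u x \<le> v x \<Longrightarrow> AE x in \<mu>. w x \<le> v x" by blast
  have s: "\<Psi> w u \<in> sols u" by (rule fixed_point_sols[OF w(1) assms w(2)])
  have least: "AE x in \<mu>. \<Psi> w u x \<le> v x" if "v \<in> BM" "AE x in \<mu>. \<Psi> v u x \<le> v x" for v
    using w(3)[OF that] w(2) by eventually_elim simp
  have "is_ae_least \<Omega> (sols u) (\<Psi> w u)"
    unfolding is_ae_least_def
  proof (intro conjI ballI s least)
    fix v assume "v \<in> sols u"
    from sols_fixed_point[OF this u(2)] show "v \<in> BM" "AE x in \<mu>. \<Psi> v u x \<le> v x" using H_BM by auto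
  qed
  then show 1: "is_ae_least \<Omega> (sols u) (smin u)" unfolding min_sol_def by
      (rule someI[of "is_ae_least \<Omega> (sols u)"])
  fix v assume "v \<in> BM" "AE x in \<mu>. \<Psi> v u x \<le> v x"
  from least[OF this] have "AE x in \<mu>. \<Psi> w u x \<le> v x" .
  moreover have "AE x in \<mu>. smin u x \<le> \<Psi> w u x" using 1 s by (auto simp: is_ae_least_def)
  ultimately show "AE x in \<mu>. smin u x \<le> v x" by eventually_elim simp
qed

text \<open>
  Dually, the greatest postfixed point allows comparison with subsolutions of the fixed point
  equation.
\<close>

lemma max_sol:
  assumes "u \<in> Linf_plus \<Omega>"
  shows "is_ae_greatest \<Omega> (sols u) (smax u)"
    "\<And>v. v \<in> BM \<Longrightarrow> AE x in \<mu>. v x \<le> \<Psi> v u x \<Longrightarrow> AE x in \<mu>. v x \<le> smax u x"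
proof -
  note u = Linf_plusD[OF assms]
  have "\<exists>w\<in>BM. (AE x in \<mu>. \<Psi> w u x = w x)
    \<and> (\<forall>v\<in>BM. (AE x in \<mu>. v x \<le> \<Psi> v u x) \<longrightarrow> (AE x in \<mu>. v x \<le> w x))"
  proof (rule greatest_postfixed_point)
    show "AE x in \<mu>. \<Psi> v u x \<le> \<Psi> z u x" if "v \<in> BM" "z \<in> BM" "AE x in \<mu>. v x \<le> z x" for v z
      by (rule Psi_mono[OF that(1,2) u(2,2) that(3)]) simp
  qed (rule Psi_BM[OF _ u(2)] Psi_range[OF assms], assumption)+
  then obtain w where w: "w \<in> BM" "AE x in \<mu>. \<Psi> w u x = w x"
    "\<And>v. v \<in> BM \<Longrightarrow> AE x in \<mu>. v x \<le> \<Psi> v u x \<Longrightarrow> AE x in \<mu>. v x \<le> w x" by blast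
  have s: "\<Psi> w u \<in> sols u" by (rule fixed_point_sols[OF w(1) assms w(2)])
  have greatest: "AE x in \<mu>. v x \<le> \<Psi> w u x" if "v \<in> BM" "AE x in \<mu>. v x \<le> \<Psi> v u x" for v
    using w(3)[OF that] w(2) by eventually_elim simp
  have "is_ae_greatest \<Omega> (sols u) (\<Psi> w u)"
    unfolding is_ae_greatest_def
  proof (intro conjI ballI s greatest)
    fix v assume "v \<in> sols u"
    from sols_fixed_point[OF this u(2)] show "v \<in> BM" "AE x in \<mu>. v x \<le> \<Psi> v u x" using H_BM by auto
  qed
  then show 1: "is_ae_greatest \<Omega> (sols u) (smax u)" unfolding max_sol_def by
      (rule someI[of "is_ae_greatest \<Omega> (sols u)"])
  fix v assume "v \<in> BM" "AE x in \<mu>. v x \<le> \<Psi> v u x"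
  from greatest[OF this] have "AE x in \<mu>. v x \<le> \<Psi> w u x" .
  moreover have "AE x in \<mu>. \<Psi> w u x \<le> smax u x" using 1 s by (auto simp: is_ae_greatest_def)
  ultimately show "AE x in \<mu>. v x \<le> smax u x" by eventually_elim simp
qed

lemma sol_facts:
  assumes "u \<in> Linf_plus \<Omega>" "y \<in> sols u"
  shows "y \<in> H" "y \<in> BM" "AE x in \<mu>. 0 \<le> y x" "AE x in \<mu>. \<Psi> y u x = y x"
    "AE x in \<mu>. y x \<le> poincare_const * Linf_norm \<Omega> u" "y \<in> Linf_plus \<Omega>" "y \<in> L2"
proof -
  note s = sols_fixed_point[OF assms(2) Linf_plusD(2)[OF assms(1)]]
  show H: "y \<in> H" and B: "y \<in> BM" and nn: "AE x in \<mu>. 0 \<le> y x" and fp: "AE x in \<mu>. \<Psi> y u x = y x" and "y \<in> L2"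
    using s H_BM H10_L2 by auto
  show bd: "AE x in \<mu>. y x \<le> poincare_const * Linf_norm \<Omega> u"
    using Psi_range[OF assms(1) B] fp by eventually_elim simp
  have "y \<in> Linf \<Omega>"
  proof (rule LinfI[OF B])
    show "AE x in \<mu>. \<bar>y x\<bar> \<le> poincare_const * Linf_norm \<Omega> u" using nn bd by eventually_elim simp
  qed
  then show "y \<in> Linf_plus \<Omega>" using nn by (simp add: Linf_plus_def)
qed

lemma smin_sols: "u \<in> Linf_plus \<Omega> \<Longrightarrow> smin u \<in> sols u"
  using min_sol(1) by (simp add: is_ae_least_def)

lemma smax_sols: "u \<in> Linf_plus \<Omega> \<Longrightarrow> smax u \<in> sols u"
  using max_sol(1) by (simp add: is_ae_greatest_def)

lemma Linf_plusI: "u \<in> Linf \<Omega> \<Longrightarrow> AE x in \<mu>. 0 \<le> u x \<Longrightarrow> u \<in> Linf_plus \<Omega>"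
  by (simp add: Linf_plus_def)

lemma zero_BM: "(\<lambda>_. 0) \<in> BM"
  by simp

lemma kappa_le: "AE x in \<mu>. 0 \<le> v x \<Longrightarrow> AE x in \<mu>. - \<kappa> \<le> v x"
  using kappa_nonneg by (auto elim!: eventually_mono)

section \<open>Local Lipschitz continuity\<close>

text \<open>
  Concavity between \<open>v\<close> and the zero function, whose image is nonnegative.
\<close>

lemma Psi_scale:
  assumes "v \<in> BM" "AE x in \<mu>. 0 \<le> v x" "u \<in> L2" "0 \<le> t" "t \<le> 1"
  shows "AE x in \<mu>. t * \<Psi> v u x \<le> \<Psi> (\<lambda>x. t * v x) (\<lambda>x. t * u x) x"
proof -
  have "AE x in \<mu>. t * \<Psi> v u x + (1 - t) * \<Psi> (\<lambda>_. 0) (\<lambda>_. 0) x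
      \<le> \<Psi> (\<lambda>x. t * v x + (1 - t) * 0) (\<lambda>x. t * u x + (1 - t) * 0) x"
    by (rule Psi_concave[OF assms(1) zero_BM kappa_le[OF assms(2)] kappa_le _ _ assms(3) L2_const])
        (use assms in auto)
  moreover have "AE x in \<mu>. 0 \<le> \<Psi> (\<lambda>_. 0) (\<lambda>_. 0) x"
    by (rule Psi_nonneg[OF zero_BM L2_const]) simp
  ultimately show ?thesis
  proof eventually_elim
    case (elim x)
    have "0 \<le> (1 - t) * \<Psi> (\<lambda>_. 0) (\<lambda>_. 0) x" using elim(2) assms by simp
    then show ?case using elim(1) by simp
  qed
qed

text \<open>Concavity turns \<open>t u2 \<le> u1\<close> into a subsolution, or a supersolution, for the other datum.\<close>

lemma smax_scale:
  assumes "u1 \<in> Linf_plus \<Omega>" "u2 \<in> Linf_plus \<Omega>" "0 \<le> t" "t \<le> 1" "AE x in \<mu>. t * u2 x \<le> u1 x"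
  shows "AE x in \<mu>. t * smax u2 x \<le> smax u1 x"
proof (rule max_sol(2)[OF assms(1)])
  note y = sol_facts[OF assms(2) smax_sols[OF assms(2)]]
  show tB: "(\<lambda>x. t * smax u2 x) \<in> BM" using y(2) by simp
  have "AE x in \<mu>. \<Psi> (\<lambda>x. t * smax u2 x) (\<lambda>x. t * u2 x) x \<le> \<Psi> (\<lambda>x. t * smax u2 x) u1 x"
    by (rule Psi_mono[OF tB tB L2_cmult]) (use assms Linf_plusD in auto)
  then show "AE x in \<mu>. t * smax u2 x \<le> \<Psi> (\<lambda>x. t * smax u2 x) u1 x"
    using Psi_scale[OF y(2,3) Linf_plusD(2)[OF assms(2)] assms(3,4)] y(4) by eventually_elim simp
qed

lemma smin_scale:
  assumes "u1 \<in> Linf_plus \<Omega>" "u2 \<in> Linf_plus \<Omega>" "0 < t" "t \<le> 1" "AE x in \<mu>. t * u2 x \<le> u1 x"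
  shows "AE x in \<mu>. t * smin u2 x \<le> smin u1 x"
proof -
  note y = sol_facts[OF assms(1) smin_sols[OF assms(1)]]
  let ?z = "\<lambda>x. smin u1 x / t"
  have zB: "?z \<in> BM" using y(2) by simp
  have z0: "AE x in \<mu>. 0 \<le> ?z x" using y(3) assms(3) by (auto elim!: eventually_mono)
  have tz: "(\<lambda>x. t * ?z x) = smin u1" using assms(3) by auto
  have "AE x in \<mu>. t * \<Psi> ?z u2 x \<le> \<Psi> (\<lambda>x. t * ?z x) (\<lambda>x. t * u2 x) x"
    by (rule Psi_scale[OF zB z0]) (use assms Linf_plusD in auto)
  moreover have "AE x in \<mu>. \<Psi> (\<lambda>x. t * ?z x) (\<lambda>x. t * u2 x) x \<le> \<Psi> (smin u1) u1 x"
    unfolding tz by (rule Psi_mono[OF y(2,2) L2_cmult]) (use assms Linf_plusD in auto)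
  ultimately have "AE x in \<mu>. \<Psi> ?z u2 x \<le> ?z x"
    using y(4) by eventually_elim (use assms(3) in \<open>simp add: field_simps\<close>)
  from min_sol(2)[OF assms(2) zB this] show ?thesis
    by eventually_elim (use assms(3) in \<open>simp add: field_simps\<close>)
qed

lemma scaled_datum_le:
  fixes u1 u2 :: "real ^ 'n \<Rightarrow> real"
  assumes "AE x in \<mu>. \<bar>u1 x - u2 x\<bar> \<le> d" "AE x in \<mu>. c \<le> u2 x" "0 < c" "0 \<le> d"
  shows "AE x in \<mu>. (1 - d / c) * u2 x \<le> u1 x"
  using assms(1,2)
proof eventually_elim
  case (elim x)
  have "d = d / c * c" using assms(3) by simp
  also have "\<dots> \<le> d / c * u2 x" using elim(2) assms(3,4) by (intro mult_left_mono) auto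
  finally have "d \<le> d / c * u2 x" .
  then show ?case using elim(1) by (simp add: algebra_simps)
qed

text \<open>
  The scaling property shared by the minimal and the maximal solution map.  It is the only
  property of the selected solutions that the Lipschitz and continuity estimates use.
\<close>

definition selection :: "((real ^ 'n \<Rightarrow> real) \<Rightarrow> real ^ 'n \<Rightarrow> real) \<Rightarrow> bool" where
  "selection S \<longleftrightarrow> (\<forall>u\<in>Linf_plus \<Omega>. S u \<in> sols u)
     \<and> (\<forall>u1\<in>Linf_plus \<Omega>. \<forall>u2\<in>Linf_plus \<Omega>. \<forall>t. 0 < t \<longrightarrow> t \<le> 1 \<longrightarrow> (AE x in \<mu>. t * u2 x \<le> u1 x)
          \<longrightarrow> (AE x in \<mu>. t * S u2 x \<le> S u1 x))"

lemma selection_smin: "selection smin" and selection_smax: "selection smax"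
  unfolding selection_def using smin_sols smax_sols smin_scale smax_scale by auto

lemma selection_sols: "selection S \<Longrightarrow> u \<in> Linf_plus \<Omega> \<Longrightarrow> S u \<in> sols u"
  by (simp add: selection_def)

text \<open>
  The datum \<open>u1\<close> dominates \<open>1 - d/c\<close> times \<open>u2\<close>, and the solutions inherit this; multiplied out,
  the factor costs \<open>d/c\<close> times the uniform bound.
\<close>

lemma selection_stable:
  assumes S: "selection S" and u: "u1 \<in> Linf_plus \<Omega>" "u2 \<in> Linf_plus \<Omega>"
    and d: "AE x in \<mu>. \<bar>u1 x - u2 x\<bar> \<le> d" "0 \<le> d" "d < c"
    and c: "AE x in \<mu>. c \<le> u1 x" "AE x in \<mu>. c \<le> u2 x"
    and U: "AE x in \<mu>. u1 x \<le> U" "AE x in \<mu>. u2 x \<le> U" "0 \<le> U"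
  shows "AE x in \<mu>. (1 - d / c) * S u2 x \<le> S u1 x" "AE x in \<mu>. (1 - d / c) * S u1 x \<le> S u2 x"
    "AE x in \<mu>. \<bar>S u1 x - S u2 x\<bar> \<le> poincare_const * U / c * d"
proof -
  have c0: "0 < c" using d by linarith
  have t: "0 < 1 - d / c" "1 - d / c \<le> 1" using d c0 by (auto simp: field_simps)
  have d': "AE x in \<mu>. \<bar>u2 x - u1 x\<bar> \<le> d" using d(1) by (simp add: abs_minus_commute)
  show 1: "AE x in \<mu>. (1 - d / c) * S u2 x \<le> S u1 x"
    using S u t scaled_datum_le[OF d(1) c(2) c0 d(2)] by (simp add: selection_def)
  show 2: "AE x in \<mu>. (1 - d / c) * S u1 x \<le> S u2 x"
    using S u t scaled_datum_le[OF d' c(1) c0 d(2)] by (simp add: selection_def)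
  have bd: "AE x in \<mu>. S u x \<le> poincare_const * U" if "u \<in> Linf_plus \<Omega>" "AE x in \<mu>. u x \<le> U" for u
  proof -
    note y = sol_facts[OF that(1) selection_sols[OF S that(1)]]
    show ?thesis
      using Psi_bound[OF y(2) Linf_plusD(2)[OF that(1)] that(2) U(3)] y(4) by eventually_elim simp
  qed
  show "AE x in \<mu>. \<bar>S u1 x - S u2 x\<bar> \<le> poincare_const * U / c * d"
    using 1 2 bd[OF u(1) U(1)] bd[OF u(2) U(2)]
  proof eventually_elim
    case (elim x)
    have k: "d / c * S u x \<le> poincare_const * U / c * d" if "S u x \<le> poincare_const * U" for u
    proof -
      have "d / c * S u x \<le> d / c * (poincare_const * U)" using that d c0 by (intro mult_left_mono) auto
      then show ?thesis by (simp add: mult.commute)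
    qed
    show ?case using elim(1,2) k[OF elim(3)] k[OF elim(4)] by (simp add: left_diff_distrib)
  qed
qed

lemma oplusD:
  assumes "u \<in> Linf_oplus \<Omega>"
  obtains c where "0 < c" "AE x in \<mu>. c \<le> u x" "u \<in> Linf_plus \<Omega>" "u \<in> Linf \<Omega>"
proof -
  obtain c where c: "0 < c" "AE x in \<mu>. c \<le> u x" and u: "u \<in> Linf \<Omega>"
    using assms by (auto simp: Linf_oplus_def)
  have "AE x in \<mu>. 0 \<le> u x" using c(2) by eventually_elim (use c(1) in simp)
  then show thesis using that[OF c _ u] u by (simp add: Linf_plus_def)
qed

text \<open>Data near a datum with positive lower bound stay between two fixed positive constants.\<close>

lemma near_oplus:
  assumes "AE x in \<mu>. c \<le> u x" "u \<in> Linf \<Omega>" "AE x in \<mu>. \<bar>v x - u x\<bar> \<le> r" "r \<le> c / 2"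
  shows "AE x in \<mu>. c / 2 \<le> v x" "AE x in \<mu>. v x \<le> Linf_norm \<Omega> u + c"
    "0 \<le> c \<Longrightarrow> AE x in \<mu>. u x \<le> Linf_norm \<Omega> u + c" "0 \<le> c \<Longrightarrow> AE x in \<mu>. c / 2 \<le> u x"
proof -
  show "AE x in \<mu>. c / 2 \<le> v x"
    using assms(1,3) by eventually_elim (use assms(4) in linarith)
  show "AE x in \<mu>. v x \<le> Linf_norm \<Omega> u + c"
    using assms(1) Linf_AE_le[OF assms(2)] assms(3)
    by eventually_elim (use assms(4) in linarith)
  assume "0 \<le> c"
  then show "AE x in \<mu>. u x \<le> Linf_norm \<Omega> u + c"
    using Linf_AE_le[OF assms(2)] by (auto elim: eventually_mono)
  show "AE x in \<mu>. c / 2 \<le> u x"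
    using assms(1) by eventually_elim (use \<open>0 \<le> c\<close> in linarith)
qed

lemma local_lipschitz:
  assumes "u \<in> Linf_oplus \<Omega>"
  shows "\<exists>C>0. \<exists>r>0. \<forall>v1 \<in> Linf_plus \<Omega>. \<forall>v2 \<in> Linf_plus \<Omega>.
        Linf_norm \<Omega> (\<lambda>x. v1 x - u x) \<le> r \<and> Linf_norm \<Omega> (\<lambda>x. v2 x - u x) \<le> r \<longrightarrow>
          Linf_norm \<Omega> (\<lambda>x. smin v1 x - smin v2 x) + Linf_norm \<Omega> (\<lambda>x. smax v1 x - smax v2 x)
        \<le> C * Linf_norm \<Omega> (\<lambda>x. v1 x - v2 x)"
proof -
  obtain c where c: "0 < c" "AE x in \<mu>. c \<le> u x" "u \<in> Linf_plus \<Omega>" "u \<in> Linf \<Omega>" by (rule oplusD[OF assms])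
  define U where "U = Linf_norm \<Omega> u + c"
  have U: "0 \<le> U" using c Linf_norm_nonneg[OF Linf_BM] by (simp add: U_def)
  define K where "K = poincare_const * U / (c / 2)"
  have K: "0 \<le> K" using U c poincare_const(1) by (simp add: K_def)
  show ?thesis
  proof (rule exI[of _ "2 * K + 1"], rule conjI[rotated], rule exI[of _ "c / 8"], intro conjI ballI impI)
    fix v1 v2 assume v: "v1 \<in> Linf_plus \<Omega>" "v2 \<in> Linf_plus \<Omega>"
      and r: "Linf_norm \<Omega> (\<lambda>x. v1 x - u x) \<le> c / 8 \<and> Linf_norm \<Omega> (\<lambda>x. v2 x - u x) \<le> c / 8"
    note vL = Linf_plusD(1)[OF v(1)] Linf_plusD(1)[OF v(2)]
    have near: "AE x in \<mu>. \<bar>v1 x - u x\<bar> \<le> c / 8" "AE x in \<mu>. \<bar>v2 x - u x\<bar> \<le> c / 8"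
    proof -
      show "AE x in \<mu>. \<bar>v1 x - u x\<bar> \<le> c / 8"
        using Linf_AE_le[OF Linf_diff[OF vL(1) c(4)]] by eventually_elim (use r in linarith)
      show "AE x in \<mu>. \<bar>v2 x - u x\<bar> \<le> c / 8"
        using Linf_AE_le[OF Linf_diff[OF vL(2) c(4)]] by eventually_elim (use r in linarith)
    qed
    have c8: "c / 8 \<le> c / 2" using c by simp
    note b1 = near_oplus[OF c(2,4) near(1) c8, folded U_def] and b2
        = near_oplus[OF c(2,4) near(2) c8, folded U_def]
    define d where "d = Linf_norm \<Omega> (\<lambda>x. v1 x - v2 x)"
    have dAE: "AE x in \<mu>. \<bar>v1 x - v2 x\<bar> \<le> d" unfolding d_def by (rule Linf_AE_le[OF Linf_diff[OF vL]])
    have d0: "0 \<le> d" unfolding d_def by (rule Linf_norm_nonneg[OF Linf_BM[OF Linf_diff[OF vL]]])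
    have "d \<le> c / 4" unfolding d_def
    proof (rule Linf_norm_le[OF Linf_BM[OF Linf_diff[OF vL]]])
      show "AE x in \<mu>. \<bar>v1 x - v2 x\<bar> \<le> c / 4" using near by eventually_elim linarith
    qed (use c in simp)
    then have dc: "d < c / 2" using c by simp
    have "Linf_norm \<Omega> (\<lambda>x. S v1 x - S v2 x) \<le> K * d" if S: "selection S" for S
    proof (rule Linf_norm_le)
      show "(\<lambda>x. S v1 x - S v2 x) \<in> BM"
        using sol_facts(2)[OF v(1) selection_sols[OF S v(1)]]
            sol_facts(2)[OF v(2) selection_sols[OF S v(2)]] by simp
      show "AE x in \<mu>. \<bar>S v1 x - S v2 x\<bar> \<le> K * d"
        unfolding K_def by (rule selection_stable(3)[OF S v dAE d0 dc b1(1) b2(1) b1(2) b2(2) U])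
    qed (use K d0 in simp)
    from this[OF selection_smin] this[OF selection_smax]
    show "Linf_norm \<Omega> (\<lambda>x. smin v1 x - smin v2 x) + Linf_norm \<Omega> (\<lambda>x. smax v1 x - smax v2 x)
        \<le> (2 * K + 1) * Linf_norm \<Omega> (\<lambda>x. v1 x - v2 x)"
      unfolding d_def[symmetric] using d0 by (simp add: distrib_right)
  qed (use K c in auto)
qed

section \<open>Convergence in the energy norm\<close>

text \<open>
  Since \<open>t y\<close> stays below the obstacle of \<open>y'\<close> and vice versa, the two variational inequalities can
  be tested with each other up to an error of order \<open>1 - t\<close>.
\<close>

lemma scaled_admissible:
  assumes "y \<in> sols u" "u \<in> Linf_plus \<Omega>" "y' \<in> BM" "0 \<le> t" "t \<le> 1" "AE x in \<mu>. t * y x \<le> y' x"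
  shows "(\<lambda>x. t * y x) \<in> below \<Omega> (Obs y')"
proof -
  note y = sol_facts[OF assms(2,1)]
  have VI: "VI (Obs y) u y" using assms(1) by (simp add: sols_iff)
  have tB: "(\<lambda>x. t * y x) \<in> BM" using y(2) by simp
  have "AE x in \<mu>. ereal (t * y x) \<le> Obs y' x"
    using VI_le[OF VI]
  proof eventually_elim
    case (elim x)
    have "ereal 0 \<le> Obs (\<lambda>_. 0) x" using Phi_nonneg[OF zero_BM] by (simp add: zero_ereal_def)
    from Phi_concave[OF y(2) zero_BM kappa_le[OF y(3)] kappa_le assms(4,5) elim this]
    have "ereal (t * y x) \<le> Obs (\<lambda>x. t * y x) x" by simp
    also have "\<dots> \<le> Obs y' x" by (rule Phi_mono[OF tB assms(3,6)])
    finally show ?case .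
  qed
  then show ?thesis using H10_cmult[OF y(1)] by (simp add: below_def)
qed

text \<open>
  Testing with the zero function.
\<close>

lemma energy_sol_le:
  assumes "y \<in> sols u" "u \<in> Linf_plus \<Omega>" shows "energy y y \<le> (LINT x|\<mu>. u x * y x)"
proof -
  note y = sol_facts[OF assms(2,1)]
  have VI: "VI (Obs y) u y" using assms(1) by (simp add: sols_iff)
  have "(\<lambda>x. 0 * y x) \<in> below \<Omega> (Obs y)"
    by (rule scaled_admissible[OF assms y(2)]) (use y(3) in auto)
  from VI_D[OF VI this] have "0 \<le> res u y (\<lambda>x. - 1 * y x)" by simp
  then have "res u y y \<le> 0" by (subst (asm) res_cmult[OF y(1,1)]) simp
  moreover have "0 \<le> (LINT x|\<mu>. f (y x) * y x)"
  proof (rule integral_nonneg_AE)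
    show "AE x in \<mu>. 0 \<le> f (y x) * y x"
      using y(3) by eventually_elim (use f_monoD[of 0] f_zero in simp)
  qed
  ultimately show ?thesis by (simp add: res_def)
qed

lemma integral_le_const:
  assumes "v \<in> L2" "w \<in> L2" "AE x in \<mu>. \<bar>v x\<bar> \<le> a" "AE x in \<mu>. \<bar>w x\<bar> \<le> b" "0 \<le> a"
  shows "\<bar>LINT x|\<mu>. v x * w x\<bar> \<le> a * b * measure \<mu> \<Omega>"
proof -
  have "\<bar>LINT x|\<mu>. v x * w x\<bar> \<le> (LINT x|\<mu>. \<bar>v x * w x\<bar>)" by simp
  also have "\<dots> \<le> (LINT x|\<mu>. a * b)"
  proof (rule integral_mono_AE)
    show "AE x in \<mu>. \<bar>v x * w x\<bar> \<le> a * b"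
      using assms(3,4) by eventually_elim (use assms(5) in \<open>auto simp: abs_mult intro!: mult_mono\<close>)
  qed (use L2_times_integrable[OF assms(1,2)] in auto)
  also have "\<dots> = a * b * measure \<mu> \<Omega>" by simp
  finally show ?thesis .
qed

lemma energy_stability:
  assumes y: "y \<in> sols u" "y' \<in> sols u'" "u \<in> Linf_plus \<Omega>" "u' \<in> Linf_plus \<Omega>"
    and t: "0 \<le> t" "t \<le> 1" "AE x in \<mu>. t * y x \<le> y' x" "AE x in \<mu>. t * y' x \<le> y x"
    and U: "AE x in \<mu>. u x \<le> U" "AE x in \<mu>. u' x \<le> U" "0 \<le> U"
    and d: "AE x in \<mu>. \<bar>u' x - u x\<bar> \<le> d" "0 \<le> d"
  shows "energy (\<lambda>x. y' x - y x) (\<lambda>x. y' x - y x)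
      \<le> d * (poincare_const * U) * measure \<mu> \<Omega> + (1 - t) * (4 * (U * (poincare_const * U) * measure \<mu> \<Omega>))"
proof -
  note f1 = sol_facts[OF y(3,1)] and f2 = sol_facts[OF y(4,2)]
  note uL = Linf_plusD[OF y(3)] and u'L = Linf_plusD[OF y(4)]
  let ?B = "poincare_const * U"
  define E where "E = U * ?B * measure \<mu> \<Omega>"
  have By: "AE x in \<mu>. 0 \<le> y x \<and> y x \<le> ?B"
    using Psi_bound[OF f1(2) uL(2) U(1,3)] f1(3,4) by eventually_elim simp
  have By': "AE x in \<mu>. 0 \<le> y' x \<and> y' x \<le> ?B"
    using Psi_bound[OF f2(2) u'L(2) U(2,3)] f2(3,4) by eventually_elim simp
  define w where "w x = y' x - y x" for x
  have w: "w \<in> H" unfolding w_def[abs_def] using f1 f2 by (intro H10_diff)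
  have absU: "AE x in \<mu>. \<bar>u x\<bar> \<le> U" "AE x in \<mu>. \<bar>u' x\<bar> \<le> U"
  proof -
    show "AE x in \<mu>. \<bar>u x\<bar> \<le> U" using U(1) uL(3) by eventually_elim simp
    show "AE x in \<mu>. \<bar>u' x\<bar> \<le> U" using U(2) u'L(3) by eventually_elim simp
  qed
  have absB: "AE x in \<mu>. \<bar>y x\<bar> \<le> ?B" "AE x in \<mu>. \<bar>y' x\<bar> \<le> ?B" "AE x in \<mu>. \<bar>w x\<bar> \<le> ?B"
  proof -
    show "AE x in \<mu>. \<bar>y x\<bar> \<le> ?B" using By by eventually_elim simp
    show "AE x in \<mu>. \<bar>y' x\<bar> \<le> ?B" using By' by eventually_elim simp
    show "AE x in \<mu>. \<bar>w x\<bar> \<le> ?B" using By By' by eventually_elim (auto simp: w_def)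
  qed
  have en: "energy y y \<le> E" "energy y' y' \<le> E"
    using energy_sol_le[OF y(1,3)] energy_sol_le[OF y(2,4)]
      integral_le_const[OF uL(2) f1(7) absU(1) absB(1) U(3)]
          integral_le_const[OF u'L(2) f2(7) absU(2) absB(2) U(3)]
    by (simp_all add: E_def)
  \<comment> \<open>the energies are at most \<open>E\<close> by testing with zero, so the error terms are bounded below\<close>
  have low: "- (2 * E) \<le> res v z1 z2"
    if "z1 \<in> H" "z2 \<in> H" "energy z1 z1 \<le> E" "energy z2 z2 \<le> E" "v \<in> L2" "AE x in \<mu>. \<bar>v x\<bar> \<le> U"
      "AE x in \<mu>. \<bar>z2 x\<bar> \<le> ?B" "AE x in \<mu>. 0 \<le> z1 x" "AE x in \<mu>. 0 \<le> z2 x" for v z1 z2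
  proof -
    have "0 \<le> (LINT x|\<mu>. f (z1 x) * z2 x)"
    proof (rule integral_nonneg_AE)
      show "AE x in \<mu>. 0 \<le> f (z1 x) * z2 x"
        using that(8,9) by eventually_elim (use f_monoD[of 0] f_zero in simp)
    qed
    moreover have "\<bar>LINT x|\<mu>. v x * z2 x\<bar> \<le> E"
      unfolding E_def by (rule integral_le_const[OF that(5) H10_L2[OF that(2)] that(6,7) U(3)])
    ultimately show ?thesis using energy_le[OF that(1,2)] that(3,4) by (simp add: res_def)
  qed
  have VI: "VI (Obs y) u y" "VI (Obs y') u' y'" using y by (simp_all add: sols_iff)
  have dec: "res v z (\<lambda>x. t * z1 x - z x) = res v z (\<lambda>x. z1 x - z x) - (1 - t) * res v z z1"
    if "v \<in> L2" "z \<in> H" "z1 \<in> H" for v z z1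
  proof -
    have "(\<lambda>x. t * z1 x - z x) = (\<lambda>x. (z1 x - z x) + (- (1 - t)) * z1 x)" by (auto simp: algebra_simps)
    then show ?thesis
      using res_add[OF that(1,2) H10_diff[OF that(3,2)] H10_cmult[OF that(3)], of "- (1 - t)"]
        res_cmult[OF that(2,3), of v "- (1 - t)"] by (simp add: left_diff_distrib)
  qed
  have 1: "0 \<le> res u' y' (\<lambda>x. y x - y' x) - (1 - t) * res u' y' y"
    using VI_D[OF VI(2) scaled_admissible[OF y(1,3) f2(2) t(1,2,3)]] dec[OF u'L(2) f2(1) f1(1)] by simp
  have 2: "0 \<le> res u y w - (1 - t) * res u y y'"
    using VI_D[OF VI(1) scaled_admissible[OF y(2,4) f1(2) t(1,2,4)]] dec[OF uL(2) f1(1) f2(1)]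
    unfolding w_def[abs_def] by simp
  have "(\<lambda>x. y x - y' x) = (\<lambda>x. - 1 * w x)" by (auto simp: w_def)
  then have 3: "res u' y' (\<lambda>x. y x - y' x) = - res u' y' w" using res_cmult[OF f2(1) w, of u' "- 1"] by simp
  have "0 \<le> (LINT x|\<mu>. f (y' x) * w x - f (y x) * w x)"
  proof (rule integral_nonneg_AE, rule AE_I2)
    fix x show "0 \<le> f (y' x) * w x - f (y x) * w x"
      using f_monoD[of "y x" "y' x"] f_monoD[of "y' x" "y x"] unfolding left_diff_distrib[symmetric] w_def
      by (cases "y x \<le> y' x") (auto intro: mult_nonneg_nonneg mult_nonpos_nonpos)
  qed
  also have "\<dots> = (LINT x|\<mu>. f (y' x) * w x) - (LINT x|\<mu>. f (y x) * w x)"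
    by (intro Bochner_Integration.integral_diff L2_times_integrable f_L2 H10_L2 f1 f2 w)
  finally have 4: "0 \<le> (LINT x|\<mu>. f (y' x) * w x) - (LINT x|\<mu>. f (y x) * w x)" .
  have "(LINT x|\<mu>. u' x * w x) - (LINT x|\<mu>. u x * w x) = (LINT x|\<mu>. (u' x - u x) * w x)"
    by (simp add: left_diff_distrib L2_times_integrable uL u'L H10_L2 w)
  also have "\<dots> \<le> d * ?B * measure \<mu> \<Omega>"
    using integral_le_const[OF L2_diff[OF u'L(2) uL(2)] H10_L2[OF w] d(1) absB(3) d(2)] by simp
  finally have 5: "(LINT x|\<mu>. u' x * w x) - (LINT x|\<mu>. u x * w x) \<le> d * ?B * measure \<mu> \<Omega>" .
  have "energy w w = energy y' w - energy y w"
    using energy_diff_left[OF w f2(1) f1(1)] by (simp add: w_def[abs_def])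
  also have "\<dots> \<le> d * ?B * measure \<mu> \<Omega> - (1 - t) * res u' y' y - (1 - t) * res u y y'"
    using 1 2 3 4 5 by (simp add: res_def)
  also have "\<dots> \<le> d * ?B * measure \<mu> \<Omega> + (1 - t) * (4 * E)"
  proof -
    have "- (2 * E) \<le> res u' y' y" "- (2 * E) \<le> res u y y'"
      by (rule low; use f1 f2 en u'L uL absU absB in blast)+
    then have "0 \<le> (1 - t) * (4 * E + res u' y' y + res u y y')" using t(2) by (intro mult_nonneg_nonneg) auto
    then show ?thesis by (simp add: algebra_simps)
  qed
  finally show ?thesis unfolding w_def E_def .
qed

text \<open>
  The scaling factors tend to one, so the solutions converge strongly in energy, and boundedness
  of the functional does the rest.
\<close>

lemma weak_continuity:
  assumes S: "selection S" and u: "u \<in> Linf_oplus \<Omega>" and us: "\<And>n. us n \<in> Linf_oplus \<Omega>"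
    and conv: "Linf_tendsto \<Omega> us u"
  shows "H10_weak_tendsto \<Omega> (\<lambda>n. S (us n)) (S u)"
proof -
  obtain c where c: "0 < c" "AE x in \<mu>. c \<le> u x" "u \<in> Linf_plus \<Omega>" "u \<in> Linf \<Omega>" by (rule oplusD[OF u])
  have usp: "us n \<in> Linf_plus \<Omega>" "us n \<in> Linf \<Omega>" for n using oplusD[OF us] by blast+
  note s = selection_sols[OF S c(3)] selection_sols[OF S usp(1)]
  note y = sol_facts[OF c(3) s(1)] and yn = sol_facts[OF usp(1) s(2)]
  define U where "U = Linf_norm \<Omega> u + c"
  have U: "0 \<le> U" using c Linf_norm_nonneg[OF Linf_BM] by (simp add: U_def)
  define d where "d n = Linf_norm \<Omega> (\<lambda>x. us n x - u x)" for n
  have d0: "d \<longlonglongrightarrow> 0" using conv by (simp add: Linf_tendsto_def d_def[abs_def])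
  let ?w = "\<lambda>n x. S (us n) x - S u x"
  define K where "K = poincare_const * U * measure \<mu> \<Omega> + 2 / c * (4 * (U * (poincare_const * U) * measure \<mu> \<Omega>))"
  have wH: "?w n \<in> H" for n by (rule H10_diff[OF yn(1) y(1)])
  have ev: "\<forall>\<^sub>F n in sequentially. energy (?w n) (?w n) \<le> K * d n"
  proof -
    have "\<forall>\<^sub>F n in sequentially. d n < c / 2" by (rule order_tendstoD(2)[OF d0]) (use c in simp)
    then show ?thesis
    proof eventually_elim
      case (elim n)
      have dAE: "AE x in \<mu>. \<bar>us n x - u x\<bar> \<le> d n" unfolding d_def by
          (rule Linf_AE_le[OF Linf_diff[OF usp(2) c(4)]])
      have dn: "0 \<le> d n" unfolding d_def by (rule Linf_norm_nonneg[OF Linf_BM[OF Linf_diff[OF usp(2) c(4)]]])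
      have c0: "0 \<le> c" using c by simp
      note b = near_oplus[OF c(2,4) dAE less_imp_le[OF elim], folded U_def] 
      note st = selection_stable[OF S usp(1) c(3) dAE dn elim b(1) b(4)[OF c0] b(2) b(3)[OF c0] U]
      have t: "0 \<le> 1 - d n / (c / 2)" "1 - d n / (c / 2) \<le> 1" using dn elim c by (auto simp: field_simps)
      from energy_stability[OF s c(3) usp(1) t st(1,2) b(3)[OF c0] b(2) U dAE dn]
      show ?case using c by (simp add: K_def algebra_simps)
    qed
  qed
  have e0: "(\<lambda>n. energy (?w n) (?w n)) \<longlonglongrightarrow> 0"
  proof (rule tendsto_sandwich[OF _ ev tendsto_const])
    show "(\<lambda>n. K * d n) \<longlonglongrightarrow> 0" using tendsto_mult_left[OF d0, of K] by simp
  qed (use energy_nonneg[OF wH] in simp)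
  have h0: "(\<lambda>n. H1_norm \<Omega> (?w n)) \<longlonglongrightarrow> 0"
  proof -
    have "(\<lambda>n. (H1_norm \<Omega> (?w n))\<^sup>2) \<longlonglongrightarrow> 0"
    proof (rule tendsto_sandwich[OF _ _ tendsto_const])
      show "(\<lambda>n. (poincare_const + 1) * energy (?w n) (?w n)) \<longlonglongrightarrow> 0"
        using tendsto_mult_left[OF e0, of "poincare_const + 1"] by simp
    qed (use H1_norm_le_energy[OF wH] in simp_all)
    then have "(\<lambda>n. sqrt ((H1_norm \<Omega> (?w n))\<^sup>2)) \<longlonglongrightarrow> sqrt 0" by (rule tendsto_real_sqrt)
    moreover have "0 \<le> H1_norm \<Omega> (?w n)" for n
      by (simp add: H1_norm_squared sq_norm_nonneg sum_nonneg)
    ultimately show ?thesis by simp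
  qed
  have "(\<lambda>n. z (S (us n))) \<longlonglongrightarrow> z (S u)" if z: "z \<in> Hm1 \<Omega>" for z
  proof -
    obtain C where C: "\<And>v. v \<in> H \<Longrightarrow> \<bar>z v\<bar> \<le> C * H1_norm \<Omega> v"
      using z unfolding Hm1_def by blast
    have lin: "z (\<lambda>x. v x + w x) = z v + z w" "z (\<lambda>x. a * v x) = a * z v" if "v \<in> H" "w \<in> H" for v w a
      using z that by (auto simp: Hm1_def)
    have "z (?w n) = z (S (us n)) - z (S u)" for n
      using lin(1)[OF yn(1) H10_cmult[OF y(1), of "-1"], of n] lin(2)[OF y(1,1), of "-1"] by simp
    moreover have "(\<lambda>n. z (?w n)) \<longlonglongrightarrow> 0"
    proof (rule Lim_null_comparison)
      show "\<forall>\<^sub>F n in sequentially. norm (z (?w n)) \<le> C * H1_norm \<Omega> (?w n)" using C[OF wH] by simp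
      show "(\<lambda>n. C * H1_norm \<Omega> (?w n)) \<longlonglongrightarrow> 0" using tendsto_mult_left[OF h0, of C] by simp
    qed
    ultimately have "(\<lambda>n. z (S (us n)) - z (S u)) \<longlonglongrightarrow> 0" by simp
    then show ?thesis by (rule LIM_zero_cancel)
  qed
  then show ?thesis using y(1) yn(1) by (simp add: H10_weak_tendsto_def)
qed

end

section \<open>Monotone difference quotients\<close>

text \<open>
  Difference quotients of a concave function increase as the step decreases, so one step
  sequence determines the limit along all others.
\<close>

lemma quotient_limit:
  fixes q :: "real \<Rightarrow> ereal" and \<sigma> \<tau> :: "nat \<Rightarrow> real"
  assumes \<sigma>: "\<And>k. 0 < \<sigma> k" "\<sigma> \<longlonglongrightarrow> 0" and \<tau>: "\<And>n. 0 < \<tau> n" "\<tau> \<longlonglongrightarrow> 0" and s0: "0 < s0"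
    and up: "\<And>n k. \<tau> n \<le> \<sigma> k \<Longrightarrow> q (\<sigma> k) \<le> q (\<tau> n)"
    and down: "\<And>n k. \<sigma> k \<le> \<tau> n \<Longrightarrow> \<tau> n \<le> s0 \<Longrightarrow> q (\<tau> n) \<le> q (\<sigma> k)"
  shows "(\<lambda>n. q (\<tau> n)) \<longlonglongrightarrow> (SUP k. q (\<sigma> k))"
proof (rule order_tendstoI)
  fix a assume "a < (SUP k. q (\<sigma> k))"
  then obtain k where k: "a < q (\<sigma> k)" by (auto simp: less_SUP_iff)
  have "\<forall>\<^sub>F n in sequentially. \<tau> n < \<sigma> k" by (rule order_tendstoD(2)[OF \<tau>(2) \<sigma>(1)])
  then show "\<forall>\<^sub>F n in sequentially. a < q (\<tau> n)"
    by eventually_elim (use k up less_le_trans less_imp_le in blast)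
next
  fix a assume a: "(SUP k. q (\<sigma> k)) < a"
  have "\<forall>\<^sub>F n in sequentially. \<tau> n < s0" by (rule order_tendstoD(2)[OF \<tau>(2) s0])
  then show "\<forall>\<^sub>F n in sequentially. q (\<tau> n) < a"
  proof eventually_elim
    case (elim n)
    have "\<forall>\<^sub>F k in sequentially. \<sigma> k < \<tau> n" by (rule order_tendstoD(2)[OF \<sigma>(2) \<tau>(1)])
    from eventually_happens'[OF sequentially_bot this] obtain k where "\<sigma> k < \<tau> n" by blast
    then have "q (\<tau> n) \<le> q (\<sigma> k)" using down elim by simp
    also have "\<dots> \<le> (SUP k. q (\<sigma> k))" by (rule SUP_upper) simp
    finally show ?case using a by simp
  qed
qed

lemma scaled_harmonic:
  fixes s :: real
  assumes "0 < s" shows "0 < s / real (k + 2)" "s / real (k + 2) < s" "(\<lambda>k. s / real (k + 2)) \<longlonglongrightarrow> 0"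
    "s / real (Suc k + 2) \<le> s / real (k + 2)"
proof -
  show "0 < s / real (k + 2)" using assms by simp
  have "s * 1 < s * real (k + 2)" using assms by (intro mult_strict_left_mono) auto
  then show "s / real (k + 2) < s" by (simp add: pos_divide_less_eq)
  show "s / real (Suc k + 2) \<le> s / real (k + 2)" using assms by (intro divide_left_mono) auto
  have "(\<lambda>k. s * inverse (real (Suc (Suc k)))) \<longlonglongrightarrow> s * 0"
    by (intro tendsto_mult_left LIMSEQ_Suc[OF LIMSEQ_inverse_real_of_nat])
  then show "(\<lambda>k. s / real (k + 2)) \<longlonglongrightarrow> 0" by (simp add: divide_inverse)
qed

context bounded_domain
begin

lemma Linf_Lq: assumes "v \<in> Linf \<Omega>" "1 \<le> q" shows "v \<in> Lq q \<Omega>"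
proof -
  have [measurable]: "v \<in> BM" using Linf_BM[OF assms(1)] .
  have "integrable \<mu> (\<lambda>x. \<bar>v x\<bar> powr q)"
  proof (rule integrable_const_bound)
    show "AE x in \<mu>. norm (\<bar>v x\<bar> powr q) \<le> Linf_norm \<Omega> v powr q"
      using Linf_AE_le[OF assms(1)] by eventually_elim (use assms(2) in \<open>auto intro!: powr_mono2\<close>)
  qed measurable
  then show ?thesis by (simp add: Lq_def)
qed

text \<open>
  On a finite measure space, bounded pointwise convergence implies both modes of convergence that
  the Hadamard derivative asks for.
\<close>

lemma Linf_dominated_tendsto:
  assumes vs: "\<And>n. vs n \<in> Linf \<Omega>" and D: "D \<in> Linf \<Omega>"
    and lim: "AE x in \<mu>. (\<lambda>n. vs n x) \<longlonglongrightarrow> D x"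
    and bound: "\<And>n. n \<ge> N \<Longrightarrow> AE x in \<mu>. \<bar>vs n x\<bar> \<le> K"
  shows "1 \<le> q \<Longrightarrow> Lq_tendsto q \<Omega> vs D" "Linf_weak_star_tendsto \<Omega> vs D"
proof -
  have m [measurable]: "vs n \<in> BM" "D \<in> BM" for n using vs D Linf_BM by auto
  have lim': "AE x in \<mu>. (\<lambda>n. vs (n + N) x) \<longlonglongrightarrow> D x"
    using lim by eventually_elim (rule LIMSEQ_ignore_initial_segment)
  have bound': "AE x in \<mu>. \<bar>vs (n + N) x\<bar> \<le> K" for n by (rule bound) simp
  show "Lq_tendsto q \<Omega> vs D" if q: "1 \<le> q"
  proof -
    have "(\<lambda>n. LINT x|\<mu>. \<bar>vs (n + N) x - D x\<bar> powr q) \<longlonglongrightarrow> (LINT x|\<mu>. 0)"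
    proof (rule integral_dominated_convergence[where w="\<lambda>_. (K + Linf_norm \<Omega> D) powr q"])
      show "AE x in \<mu>. (\<lambda>n. \<bar>vs (n + N) x - D x\<bar> powr q) \<longlonglongrightarrow> 0"
        using lim'
      proof eventually_elim
        case (elim x)
        have "(\<lambda>n. vs (n + N) x - D x) \<longlonglongrightarrow> 0" using elim by (rule LIM_zero)
        then have "(\<lambda>n. \<bar>vs (n + N) x - D x\<bar>) \<longlonglongrightarrow> 0" by (rule tendsto_rabs_zero)
        then show ?case by (rule tendsto_zero_powrI[OF _ tendsto_const]) (use q in auto)
      qed
      show "AE x in \<mu>. norm (\<bar>vs (n + N) x - D x\<bar> powr q) \<le> (K + Linf_norm \<Omega> D) powr q" for n
        using bound'[of n] Linf_AE_le[OF D] by eventually_elim (use q in \<open>auto intro!: powr_mono2\<close>)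
    qed auto
    then have "(\<lambda>n. LINT x|\<mu>. \<bar>vs n x - D x\<bar> powr q) \<longlonglongrightarrow> 0" by (auto intro: LIMSEQ_offset)
    then have "(\<lambda>n. Lq_norm q \<Omega> (\<lambda>x. vs n x - D x)) \<longlonglongrightarrow> 0"
      unfolding Lq_norm_def by (rule tendsto_zero_powrI[OF _ tendsto_const]) (use q in auto)
    then show ?thesis using Linf_Lq vs D q by (simp add: Lq_tendsto_def)
  qed
  have "(\<lambda>n. LINT x|\<mu>. vs n x * w x) \<longlonglongrightarrow> (LINT x|\<mu>. D x * w x)" if w: "w \<in> Lq 1 \<Omega>" for w
  proof -
    have [measurable]: "w \<in> BM" and "integrable \<mu> (\<lambda>x. \<bar>w x\<bar>)" using w by (auto simp: Lq_def)
    have "(\<lambda>n. LINT x|\<mu>. vs (n + N) x * w x) \<longlonglongrightarrow> (LINT x|\<mu>. D x * w x)"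
    proof (rule integral_dominated_convergence[where w="\<lambda>x. K * \<bar>w x\<bar>"])
      show "AE x in \<mu>. (\<lambda>n. vs (n + N) x * w x) \<longlonglongrightarrow> D x * w x"
        using lim' by eventually_elim (rule tendsto_mult_right)
      show "AE x in \<mu>. norm (vs (n + N) x * w x) \<le> K * \<bar>w x\<bar>" for n
        using bound'[of n] by eventually_elim (simp add: abs_mult mult_right_mono)
    qed (use \<open>integrable \<mu> (\<lambda>x. \<bar>w x\<bar>)\<close> in auto)
    then show ?thesis by (rule LIMSEQ_offset)
  qed
  then show "Linf_weak_star_tendsto \<Omega> vs D" using vs D by (simp add: Linf_weak_star_tendsto_def)
qed

lemma L2_tendsto_unique:
  assumes "L2_tendsto vs v" "L2_tendsto vs w" shows "AE x in \<mu>. v x = w x"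
proof -
  have "L2_tendsto (\<lambda>n x. vs n x - vs n x) (\<lambda>x. v x - w x)" by (rule L2_tendsto_diff[OF assms])
  then have L: "(\<lambda>x. v x - w x) \<in> L2" and "(\<lambda>n. sq_norm (\<lambda>x. 0 - (v x - w x))) \<longlonglongrightarrow> 0"
    by (auto simp: L2_tendsto_def)
  then have "sq_norm (\<lambda>x. v x - w x) = 0"
    using sq_norm_minus_commute[of "\<lambda>x. 0" "\<lambda>x. v x - w x"] by (simp add: LIMSEQ_const_iff)
  then have "AE x in \<mu>. v x - w x = 0" using sq_norm_eq_0_iff[OF L] by blast
  then show ?thesis by eventually_elim simp
qed

lemma Lq_tendsto_2:
  assumes "Lq_tendsto 2 \<Omega> vs v" shows "L2_tendsto vs v"
proof -
  have "(\<lambda>n. (sqrt (sq_norm (\<lambda>x. vs n x - v x)))\<^sup>2) \<longlonglongrightarrow> 0\<^sup>2"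
    by (intro tendsto_power) (use assms in \<open>simp add: Lq_tendsto_def Lq_norm_2\<close>)
  then show ?thesis using assms by (simp add: L2_tendsto_def Lq_tendsto_def sq_norm_nonneg)
qed

lemma Linf_tendsto_const: assumes "h \<in> Linf \<Omega>" shows "Linf_tendsto \<Omega> (\<lambda>_. h) h"
proof -
  have "Linf_norm \<Omega> (\<lambda>x. h x - h x) = 0"
    using Linf_norm_le[of "\<lambda>_. 0" 0] Linf_norm_nonneg[of "\<lambda>_. 0"] by simp
  then show ?thesis using assms by (simp add: Linf_tendsto_def)
qed

end

section \<open>Directional differentiability of the maximal solution\<close>

context impulse_control
begin

text \<open>
  A convex combination of two maximal solutions is a subsolution for the combined datum.
\<close>

lemma smax_concave:
  assumes "u1 \<in> Linf_plus \<Omega>" "u2 \<in> Linf_plus \<Omega>" "0 \<le> t" "t \<le> 1"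
    "(\<lambda>x. t * u1 x + (1 - t) * u2 x) \<in> Linf_plus \<Omega>"
  shows "AE x in \<mu>. t * smax u1 x + (1 - t) * smax u2 x \<le> smax (\<lambda>x. t * u1 x + (1 - t) * u2 x) x"
proof (rule max_sol(2)[OF assms(5)])
  note y1 = sol_facts[OF assms(1) smax_sols[OF assms(1)]] and y2 = sol_facts[OF assms(2) smax_sols[OF assms(2)]]
  show "(\<lambda>x. t * smax u1 x + (1 - t) * smax u2 x) \<in> BM" using y1(2) y2(2) by simp
  show "AE x in \<mu>. t * smax u1 x + (1 - t) * smax u2 x
     \<le> \<Psi> (\<lambda>x. t * smax u1 x + (1 - t) * smax u2 x) (\<lambda>x. t * u1 x + (1 - t) * u2 x) x"
    using Psi_concave[OF y1(2) y2(2) kappa_le[OF y1(3)] kappa_le[OF y2(3)] assms(3,4)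
        Linf_plusD(2)[OF assms(1)] Linf_plusD(2)[OF assms(2)]]
      y1(4) y2(4) by eventually_elim simp
qed

lemma abs_quotient_le:
  fixes a t K e :: real
  assumes "\<bar>a\<bar> \<le> K * (t * e)" "0 < t" shows "\<bar>a / t\<bar> \<le> K * e"
  using assms by (simp add: abs_divide pos_divide_le_eq ac_simps)

lemma segment_identity:
  fixes a b s \<tau> :: real
  assumes "0 < s" "s \<le> \<tau>" shows "s / \<tau> * (a + \<tau> * b) + (1 - s / \<tau>) * a = a + s * b"
proof -
  have "\<tau> \<noteq> 0" using assms by linarith
  then show ?thesis by (simp add: field_simps)
qed

lemma segment_plus:
  assumes "u \<in> Linf_plus \<Omega>" "h \<in> Linf \<Omega>" "(\<lambda>x. u x + \<tau> * h x) \<in> Linf_plus \<Omega>" "0 < s" "s \<le> \<tau>"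
  shows "(\<lambda>x. u x + s * h x) \<in> Linf_plus \<Omega>"
proof (rule Linf_plusI)
  show "(\<lambda>x. u x + s * h x) \<in> Linf \<Omega>" by (intro Linf_add Linf_cmult Linf_plusD(1) assms)
  show "AE x in \<mu>. 0 \<le> u x + s * h x"
    using Linf_plusD(3)[OF assms(1)] Linf_plusD(3)[OF assms(3)]
  proof eventually_elim
    case (elim x)
    have "0 \<le> s / \<tau> * (u x + \<tau> * h x) + (1 - s / \<tau>) * u x"
      using elim assms(4,5) by (intro add_nonneg_nonneg mult_nonneg_nonneg[OF _ elim(1)]
          mult_nonneg_nonneg[OF _ elim(2)]) auto
    also have "\<dots> = u x + s * h x" by (rule segment_identity[OF assms(4,5)])
    finally show ?case .
  qed
qed

definition quot :: "((real ^ 'n \<Rightarrow> real) \<Rightarrow> real ^ 'n \<Rightarrow> real) \<Rightarrow> (real ^ 'n \<Rightarrow> real) \<Rightarrow> (real ^ 'n \<Rightarrow> real) \<Rightarrow> real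
    \<Rightarrow> real ^ 'n \<Rightarrow> real" where
  "quot T u h \<tau> x = (T (\<lambda>x. u x + \<tau> * h x) x - T u x) / \<tau>"

lemma quot_mono:
  assumes "u \<in> Linf_plus \<Omega>" "h \<in> Linf \<Omega>" "(\<lambda>x. u x + \<tau> * h x) \<in> Linf_plus \<Omega>" "0 < s" "s \<le> \<tau>"
  shows "AE x in \<mu>. quot smax u h \<tau> x \<le> quot smax u h s x"
proof -
  have eq: "(\<lambda>x. s / \<tau> * (u x + \<tau> * h x) + (1 - s / \<tau>) * u x) = (\<lambda>x. u x + s * h x)"
    by (intro ext segment_identity assms)
  have "AE x in \<mu>. s / \<tau> * smax (\<lambda>x. u x + \<tau> * h x) x + (1 - s / \<tau>) * smax u x \<le> smax (\<lambda>x. u x + s * h x) x"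
    using smax_concave[OF assms(3,1), of "s / \<tau>"] segment_plus[OF assms] assms(4,5) unfolding eq by simp
  then show ?thesis
  proof eventually_elim
    case (elim x)
    then have "s / \<tau> * (smax (\<lambda>x. u x + \<tau> * h x) x - smax u x) \<le> smax (\<lambda>x. u x + s * h x) x - smax u x"
      by (simp add: algebra_simps)
    then have "s * quot smax u h \<tau> x \<le> s * quot smax u h s x"
      using assms(4,5) by (simp add: quot_def)
    then show ?case using assms(4) by simp
  qed
qed

text \<open>
  The derivative as an almost-everywhere limit; the exceptional set may depend on the sequence.
\<close>

definition dir_limit :: "(real ^ 'n \<Rightarrow> real) \<Rightarrow> (real ^ 'n \<Rightarrow> real) \<Rightarrow> (real ^ 'n \<Rightarrow> real) \<Rightarrow> bool" where
  "dir_limit u h D \<longleftrightarrow> D \<in> Linf \<Omega> \<and>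
     (\<forall>\<tau>::nat \<Rightarrow> real. (\<forall>n. 0 < \<tau> n) \<and> \<tau> \<longlonglongrightarrow> 0 \<and> (\<forall>n. (\<lambda>x. u x + \<tau> n * h x) \<in> Linf_plus \<Omega>)
        \<longrightarrow> (AE x in \<mu>. (\<lambda>n. quot smax u h (\<tau> n) x) \<longlonglongrightarrow> D x))"

lemma dir_limit_AE_cong:
  assumes "dir_limit u h D" "AE x in \<mu>. D x = D' x" shows "dir_limit u h D'"
proof -
  have "AE x in \<mu>. (\<lambda>n. quot smax u h (\<tau> n) x) \<longlonglongrightarrow> D' x"
    if "AE x in \<mu>. (\<lambda>n. quot smax u h (\<tau> n) x) \<longlonglongrightarrow> D x" for \<tau> :: "nat \<Rightarrow> real"
    using that assms(2) by eventually_elim simp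
  then show ?thesis using assms(1) Linf_AE_cong[OF _ assms(2)] unfolding dir_limit_def by simp
qed

text \<open>
  The step length \<open>\<sigma>\<close> and the Lipschitz constant \<open>K\<close> are uniform over all directions bounded by \<open>R\<close>.
\<close>

definition uniform_step :: "(real ^ 'n \<Rightarrow> real) \<Rightarrow> real \<Rightarrow> real \<Rightarrow> real \<Rightarrow> bool" where
  "uniform_step u R \<sigma> K \<longleftrightarrow> 0 < \<sigma> \<and> 0 \<le> K
     \<and> (\<forall>\<tau> g. 0 < \<tau> \<longrightarrow> \<tau> \<le> \<sigma> \<longrightarrow> g \<in> Linf \<Omega> \<longrightarrow> (AE x in \<mu>. \<bar>g x\<bar> \<le> R) \<longrightarrow> (\<lambda>x. u x + \<tau> * g x) \<in> Linf_plus \<Omega>)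
     \<and> (\<forall>\<tau> g g' e. 0 < \<tau> \<longrightarrow> \<tau> \<le> \<sigma> \<longrightarrow> g \<in> Linf \<Omega> \<longrightarrow> g' \<in> Linf \<Omega> \<longrightarrow> (AE x in \<mu>. \<bar>g x\<bar> \<le> R)
          \<longrightarrow> (AE x in \<mu>. \<bar>g' x\<bar> \<le> R) \<longrightarrow> (AE x in \<mu>. \<bar>g x - g' x\<bar> \<le> e) \<longrightarrow> 0 \<le> e \<longrightarrow> e \<le> R
          \<longrightarrow> (AE x in \<mu>. \<bar>smax (\<lambda>x. u x + \<tau> * g x) x - smax (\<lambda>x. u x + \<tau> * g' x) x\<bar> \<le> K * (\<tau> * e)))"

lemma uniform_stepD:
  assumes "uniform_step u R \<sigma> K"
  shows "0 < \<sigma>" "0 \<le> K"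
    "0 < \<tau> \<Longrightarrow> \<tau> \<le> \<sigma> \<Longrightarrow> g \<in> Linf \<Omega> \<Longrightarrow> AE x in \<mu>. \<bar>g x\<bar> \<le> R \<Longrightarrow> (\<lambda>x. u x + \<tau> * g x) \<in> Linf_plus \<Omega>"
    "0 < \<tau> \<Longrightarrow> \<tau> \<le> \<sigma> \<Longrightarrow> g \<in> Linf \<Omega> \<Longrightarrow> g' \<in> Linf \<Omega> \<Longrightarrow> AE x in \<mu>. \<bar>g x\<bar> \<le> R
      \<Longrightarrow> AE x in \<mu>. \<bar>g' x\<bar> \<le> R \<Longrightarrow> AE x in \<mu>. \<bar>g x - g' x\<bar> \<le> e \<Longrightarrow> 0 \<le> e \<Longrightarrow> e \<le> R
      \<Longrightarrow> AE x in \<mu>. \<bar>smax (\<lambda>x. u x + \<tau> * g x) x - smax (\<lambda>x. u x + \<tau> * g' x) x\<bar> \<le> K * (\<tau> * e)"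
  using assms unfolding uniform_step_def by simp_all

lemma uniform_step_exists:
  assumes "u \<in> Linf_oplus \<Omega>" "0 \<le> R" shows "\<exists>\<sigma> K. uniform_step u R \<sigma> K"
proof -
  obtain c where c: "0 < c" "AE x in \<mu>. c \<le> u x" "u \<in> Linf_plus \<Omega>" "u \<in> Linf \<Omega>" by (rule oplusD[OF assms(1)])
  define U where "U = Linf_norm \<Omega> u + c"
  have U: "0 \<le> U" using c Linf_norm_nonneg[OF Linf_BM] by (simp add: U_def)
  define \<sigma> where "\<sigma> = c / (4 * (R + 1))"
  have \<sigma>: "0 < \<sigma>" using c assms(2) by (simp add: \<sigma>_def)
  have small: "\<tau> * e \<le> c / 4" if "0 < \<tau>" "\<tau> \<le> \<sigma>" "e \<le> R" for \<tau> e
  proof -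
    have "\<tau> * e \<le> \<tau> * (R + 1)" using that by (intro mult_left_mono) auto
    also have "\<dots> \<le> \<sigma> * (R + 1)" using that assms(2) by (intro mult_right_mono) auto
    also have "\<dots> = c / 4" using assms(2) by (simp add: \<sigma>_def field_simps)
    finally show ?thesis .
  qed
  have near: "AE x in \<mu>. \<bar>u x + \<tau> * g x - u x\<bar> \<le> c / 4"
    if "0 < \<tau>" "\<tau> \<le> \<sigma>" "AE x in \<mu>. \<bar>g x\<bar> \<le> R" for \<tau> and g :: "real ^ 'n \<Rightarrow> real"
    using that(3) by eventually_elim (use small[OF that(1,2)] that(1) in \<open>simp add: abs_mult\<close>)
  have c4: "c / 4 \<le> c / 2" using c by simp
  note b = near_oplus[OF c(2,4) near c4, folded U_def]
  have plus: "(\<lambda>x. u x + \<tau> * g x) \<in> Linf_plus \<Omega>"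
    if "0 < \<tau>" "\<tau> \<le> \<sigma>" "g \<in> Linf \<Omega>" "AE x in \<mu>. \<bar>g x\<bar> \<le> R" for \<tau> g
  proof (rule Linf_plusI)
    show "(\<lambda>x. u x + \<tau> * g x) \<in> Linf \<Omega>" by (intro Linf_add Linf_cmult that c)
    show "AE x in \<mu>. 0 \<le> u x + \<tau> * g x"
      using b(1)[OF that(1,2,4)] by eventually_elim (use c(1) in simp)
  qed
  have K: "0 \<le> poincare_const * U / (c / 2)" using poincare_const(1) U c by simp
  have stable: "AE x in \<mu>. \<bar>smax (\<lambda>x. u x + \<tau> * g x) x - smax (\<lambda>x. u x + \<tau> * g' x) x\<bar>
      \<le> poincare_const * U / (c / 2) * (\<tau> * e)"
    if a: "0 < \<tau>" "\<tau> \<le> \<sigma>" "g \<in> Linf \<Omega>" "g' \<in> Linf \<Omega>" "AE x in \<mu>. \<bar>g x\<bar> \<le> R"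
      "AE x in \<mu>. \<bar>g' x\<bar> \<le> R" "AE x in \<mu>. \<bar>g x - g' x\<bar> \<le> e" "0 \<le> e" "e \<le> R" for \<tau> g g' e
  proof -
    have d: "AE x in \<mu>. \<bar>(u x + \<tau> * g x) - (u x + \<tau> * g' x)\<bar> \<le> \<tau> * e"
      using a(7)
    proof eventually_elim
      case (elim x)
      have "(u x + \<tau> * g x) - (u x + \<tau> * g' x) = \<tau> * (g x - g' x)" by (simp add: algebra_simps)
      then show ?case using elim a(1) by (simp add: abs_mult)
    qed
    have "0 \<le> \<tau> * e" "\<tau> * e < c / 2" using small[OF a(1,2,9)] a(1,8) c(1) by auto
    from selection_stable(3)[OF selection_smax plus[OF a(1,2,3,5)] plus[OF a(1,2,4,6)] d this
        b(1)[OF a(1,2,5)] b(1)[OF a(1,2,6)] b(2)[OF a(1,2,5)] b(2)[OF a(1,2,6)] U]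
    show ?thesis .
  qed
  show ?thesis
    unfolding uniform_step_def
    by (intro exI[of _ \<sigma>] exI[of _ "poincare_const * U / (c / 2)"] conjI allI impI \<sigma> K plus stable)
qed

lemma quot_BM:
  assumes "u \<in> Linf_plus \<Omega>" "(\<lambda>x. u x + \<tau> * h x) \<in> Linf_plus \<Omega>" shows "quot smax u h \<tau> \<in> BM"
  using sol_facts(2)[OF assms(1) smax_sols[OF assms(1)]] sol_facts(2)[OF assms(2) smax_sols[OF assms(2)]]
  unfolding quot_def[abs_def] by simp

text \<open>
  Concavity makes the quotients monotone and Lipschitz continuity makes them bounded.
\<close>

lemma dir_limit_exists:
  assumes u: "u \<in> Linf_oplus \<Omega>" and h: "h \<in> Linf \<Omega>"
  shows "\<exists>D. dir_limit u h D"
proof -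
  have up: "u \<in> Linf_plus \<Omega>" using oplusD[OF u] by blast
  define R where "R = Linf_norm \<Omega> h"
  have R: "0 \<le> R" "AE x in \<mu>. \<bar>h x\<bar> \<le> R"
    unfolding R_def using Linf_norm_nonneg[OF Linf_BM[OF h]] Linf_AE_le[OF h] by auto
  obtain \<sigma> K where step: "uniform_step u R \<sigma> K" using uniform_step_exists[OF u R(1)] by blast
  note \<sigma> = uniform_stepD(1)[OF step] and K = uniform_stepD(2)[OF step]
    and plus = uniform_stepD(3)[OF step] and stable = uniform_stepD(4)[OF step]
  define s where "s k = \<sigma> / real (k + 2)" for k
  have s: "0 < s k" "s k < \<sigma>" "s \<longlonglongrightarrow> 0" for k
    unfolding s_def[abs_def] using scaled_harmonic[OF \<sigma>] by auto
  have sp: "(\<lambda>x. u x + s k * h x) \<in> Linf_plus \<Omega>" for k by (rule plus[OF s(1) less_imp_le[OF s(2)] h R(2)])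
  have zero: "(\<lambda>_. 0) \<in> Linf \<Omega>" by (rule LinfI[of _ 0]) auto
  have "AE x in \<mu>. \<bar>quot smax u h (s k) x\<bar> \<le> K * R" for k
  proof -
    have "AE x in \<mu>. \<bar>smax (\<lambda>x. u x + s k * h x) x - smax (\<lambda>x. u x + s k * 0) x\<bar> \<le> K * (s k * R)"
      by (rule stable[OF s(1) less_imp_le[OF s(2)] h zero R(2)]) (use R in auto)
    then show ?thesis
    proof eventually_elim
      case (elim x)
      from abs_quotient_le[OF elim s(1)] show ?case unfolding quot_def by simp
    qed
  qed
  then have bd: "AE x in \<mu>. \<forall>k. \<bar>quot smax u h (s k) x\<bar> \<le> K * R" by (simp add: AE_all_countable)
  define E where "E x = (SUP k. ereal (quot smax u h (s k) x))" for x
  define D where "D x = real_of_ereal (E x)" for x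
  have E: "AE x in \<mu>. E x = ereal (D x) \<and> \<bar>D x\<bar> \<le> K * R"
    using bd
  proof eventually_elim
    case (elim x)
    have "E x \<le> ereal (K * R)" unfolding E_def by (rule SUP_least) (use elim in \<open>simp add: abs_le_iff\<close>)
    moreover have "ereal (- (K * R)) \<le> ereal (quot smax u h (s 0) x)" using elim[rule_format, of 0] by
        (simp add: abs_le_iff)
    then have "ereal (- (K * R)) \<le> E x" unfolding E_def by (rule SUP_upper2[of 0, rotated]) simp
    ultimately show ?case unfolding D_def by (cases "E x") (auto simp: abs_le_iff)
  qed
  have [measurable]: "quot smax u h (s k) \<in> BM" for k by (rule quot_BM[OF up sp])
  have "D \<in> BM" unfolding D_def[abs_def] E_def by measurable
  then have DL: "D \<in> Linf \<Omega>" by (rule LinfI[of _ "K * R"]) (use E in \<open>auto elim: eventually_mono\<close>)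
  moreover have "AE x in \<mu>. (\<lambda>n. quot smax u h (\<tau> n) x) \<longlonglongrightarrow> D x"
    if \<tau>: "\<And>n. 0 < \<tau> n" "\<tau> \<longlonglongrightarrow> 0" "\<And>n. (\<lambda>x. u x + \<tau> n * h x) \<in> Linf_plus \<Omega>" for \<tau> :: "nat \<Rightarrow> real"
  proof -
    have 1: "AE x in \<mu>. \<forall>n k. \<tau> n \<le> s k \<longrightarrow> quot smax u h (s k) x \<le> quot smax u h (\<tau> n) x"
      unfolding AE_all_countable
    proof (intro allI)
      fix n k
      show "AE x in \<mu>. \<tau> n \<le> s k \<longrightarrow> quot smax u h (s k) x \<le> quot smax u h (\<tau> n) x"
        using quot_mono[OF up h sp \<tau>(1), of n k] by (cases "\<tau> n \<le> s k") auto
    qed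
    have 2: "AE x in \<mu>. \<forall>n k. s k \<le> \<tau> n \<longrightarrow> quot smax u h (\<tau> n) x \<le> quot smax u h (s k) x"
      unfolding AE_all_countable
    proof (intro allI)
      fix n k
      show "AE x in \<mu>. s k \<le> \<tau> n \<longrightarrow> quot smax u h (\<tau> n) x \<le> quot smax u h (s k) x"
        using quot_mono[OF up h \<tau>(3) s(1), of k n] by (cases "s k \<le> \<tau> n") auto
    qed
    show ?thesis
      using 1 2 E
    proof eventually_elim
      case (elim x)
      have "(\<lambda>n. ereal (quot smax u h (\<tau> n) x)) \<longlonglongrightarrow> E x"
        unfolding E_def by (rule quotient_limit[OF s(1,3) \<tau>(1,2) zero_less_one]) (use elim in auto)
      then show ?case using elim by simp
    qed
  qed
  ultimately have "dir_limit u h D" unfolding dir_limit_def by blast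
  then show ?thesis by blast
qed

text \<open>
  Lipschitz continuity makes the perturbation of the direction negligible, so that the
  almost-everywhere limits along fixed directions already give the Hadamard derivative.
\<close>

lemma hadamard_of_dir_limit:
  assumes T: "\<And>v. v \<in> Linf_plus \<Omega> \<Longrightarrow> AE x in \<mu>. T v x = smax v x"
    and u: "u \<in> Linf_oplus \<Omega>" and h: "h \<in> Linf \<Omega>" and D: "dir_limit u h D"
  shows "has_hadamard_deriv \<Omega> T u h D"
proof -
  have up: "u \<in> Linf_plus \<Omega>" using oplusD[OF u] by blast
  have DL: "D \<in> Linf \<Omega>" using D by (simp add: dir_limit_def)
  define R where "R = Linf_norm \<Omega> h + 1"
  have R: "1 \<le> R" "AE x in \<mu>. \<bar>h x\<bar> \<le> R - 1"
    unfolding R_def using Linf_norm_nonneg[OF Linf_BM[OF h]] Linf_AE_le[OF h] by auto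
  then have R0: "0 \<le> R" "AE x in \<mu>. \<bar>h x\<bar> \<le> R" by (auto elim: eventually_mono)
  obtain \<sigma> K where step: "uniform_step u R \<sigma> K" using uniform_step_exists[OF u R0(1)] by blast
  note \<sigma> = uniform_stepD(1)[OF step] and K = uniform_stepD(2)[OF step]
    and plus = uniform_stepD(3)[OF step] and stable = uniform_stepD(4)[OF step]
  have zero: "(\<lambda>_. 0) \<in> Linf \<Omega>" by (rule LinfI[of _ 0]) auto
  show ?thesis
    unfolding has_hadamard_deriv_def Let_def
  proof (intro conjI allI impI; (elim conjE)?)
    show "D \<in> Linf \<Omega>" by (rule DL)
    fix \<tau> :: "nat \<Rightarrow> real" and hs :: "nat \<Rightarrow> real ^ 'n \<Rightarrow> real"
    assume \<tau>: "\<forall>n. 0 < \<tau> n" "\<tau> \<longlonglongrightarrow> 0" and hs: "Linf_tendsto \<Omega> hs h"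
      and pl: "\<forall>n. (\<lambda>x. u x + \<tau> n * hs n x) \<in> Linf_plus \<Omega>"
    let ?v = "\<lambda>n x. (T (\<lambda>x. u x + \<tau> n * hs n x) x - T u x) / \<tau> n"
    let ?w = "\<lambda>n x. (smax (\<lambda>x. u x + \<tau> n * hs n x) x - smax u x) / \<tau> n"
    have vw: "AE x in \<mu>. ?w n x = ?v n x" for n
      using T[OF up] T[OF spec[OF pl, of n]] by eventually_elim simp
    have smaxL: "smax v \<in> Linf \<Omega>" if "v \<in> Linf_plus \<Omega>" for v
      using sol_facts(6)[OF that smax_sols[OF that]] Linf_plusD by blast
    have "?w n \<in> Linf \<Omega>" for n
      using Linf_cmult[OF Linf_diff[OF smaxL[OF spec[OF pl, of n]] smaxL[OF up]], of "1 / \<tau> n"] by simp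
    then have vL: "?v n \<in> Linf \<Omega>" for n using Linf_AE_cong[OF _ vw[of n]] by blast
    define e where "e n = Linf_norm \<Omega> (\<lambda>x. hs n x - h x)" for n
    have hsL: "hs n \<in> Linf \<Omega>" for n using hs by (simp add: Linf_tendsto_def)
    have eAE: "AE x in \<mu>. \<bar>hs n x - h x\<bar> \<le> e n" for n unfolding e_def by
        (rule Linf_AE_le[OF Linf_diff[OF hsL h]])
    have e0: "0 \<le> e n" for n unfolding e_def by (rule Linf_norm_nonneg[OF Linf_BM[OF Linf_diff[OF hsL h]]])
    have elim0: "e \<longlonglongrightarrow> 0" using hs by (simp add: Linf_tendsto_def e_def[abs_def])
    have "\<forall>\<^sub>F n in sequentially. e n < 1 \<and> \<tau> n < \<sigma>"
      using order_tendstoD(2)[OF elim0 zero_less_one] order_tendstoD(2)[OF \<tau>(2) \<sigma>] by eventually_elim simp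
    then obtain N where N: "\<And>n. n \<ge> N \<Longrightarrow> e n < 1" "\<And>n. n \<ge> N \<Longrightarrow> \<tau> n < \<sigma>"
      by (auto simp: eventually_sequentially)
    have hsR: "AE x in \<mu>. \<bar>hs n x\<bar> \<le> R" if "n \<ge> N" for n
      using eAE[of n] R(2) by eventually_elim (use N(1)[OF that] in linarith)
    have close: "AE x in \<mu>. \<bar>?v n x - quot smax u h (\<tau> n) x\<bar> \<le> K * e n" if n: "n \<ge> N" for n
    proof -
      have "e n \<le> R" using N(1)[OF n] R(1) by simp
      have "AE x in \<mu>. \<bar>smax (\<lambda>x. u x + \<tau> n * hs n x) x - smax (\<lambda>x. u x + \<tau> n * h x) x\<bar> \<le> K * (\<tau> n * e n)"
        by (rule stable[OF spec[OF \<tau>(1)] less_imp_le[OF N(2)[OF n]] hsL h hsR[OF n] R0(2) eAE e0 \<open>e n \<le> R\<close>])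
      then show ?thesis using vw[of n]
      proof eventually_elim
        case (elim x)
        have t: "0 < \<tau> n" using \<tau>(1) by blast
        have "?v n x - quot smax u h (\<tau> n) x = (smax (\<lambda>x. u x + \<tau> n * hs n x) x - smax (\<lambda>x. u x + \<tau> n * h x)
            x) / \<tau> n"
          unfolding elim(2)[symmetric] quot_def by (simp add: diff_divide_distrib)
        then show ?case using abs_quotient_le[OF elim(1) t] by simp
      qed
    qed
    have bound: "AE x in \<mu>. \<bar>?v n x\<bar> \<le> K * R" if n: "n \<ge> N" for n
    proof -
      have "AE x in \<mu>. \<bar>smax (\<lambda>x. u x + \<tau> n * hs n x) x - smax (\<lambda>x. u x + \<tau> n * 0) x\<bar> \<le> K * (\<tau> n * R)"
        by (rule stable[OF spec[OF \<tau>(1)] less_imp_le[OF N(2)[OF n]] hsL zero hsR[OF n]])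
            (use hsR[OF n] R0 in auto)
      then show ?thesis using vw[of n]
      proof eventually_elim
        case (elim x)
        have t: "0 < \<tau> n" using \<tau>(1) by blast
        from abs_quotient_le[OF elim(1) t] show ?case unfolding elim(2)[symmetric] by simp
      qed
    qed
    have "AE x in \<mu>. (\<lambda>n. quot smax u h (\<tau> (n + N)) x) \<longlonglongrightarrow> D x"
    proof -
      have "(\<lambda>x. u x + \<tau> (n + N) * h x) \<in> Linf_plus \<Omega>" for n
        using plus[OF spec[OF \<tau>(1)] _ h R0(2), of "n + N"] N(2)[of "n + N"] by simp
      moreover have "(\<lambda>n. \<tau> (n + N)) \<longlonglongrightarrow> 0" by (rule LIMSEQ_ignore_initial_segment[OF \<tau>(2)])
      ultimately show ?thesis
        using D \<tau>(1) unfolding dir_limit_def by (elim conjE allE[of _ "\<lambda>n. \<tau> (n + N)"]) blast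
    qed
    moreover have "AE x in \<mu>. \<forall>n. \<bar>?v (n + N) x - quot smax u h (\<tau> (n + N)) x\<bar> \<le> K * e (n + N)"
      unfolding AE_all_countable using close by simp
    ultimately have lim: "AE x in \<mu>. (\<lambda>n. ?v n x) \<longlonglongrightarrow> D x"
    proof eventually_elim
      case (elim x)
      have "(\<lambda>n. K * e (n + N)) \<longlonglongrightarrow> K * 0"
        by (intro tendsto_mult_left LIMSEQ_ignore_initial_segment elim0)
      then have "(\<lambda>n. K * e (n + N)) \<longlonglongrightarrow> 0" by simp
      then have "(\<lambda>n. ?v (n + N) x - quot smax u h (\<tau> (n + N)) x) \<longlonglongrightarrow> 0"
        by (rule Lim_null_comparison[rotated]) (unfold real_norm_def, rule always_eventually[OF elim(2)])
      from tendsto_add[OF this elim(1)] have "(\<lambda>n. ?v (n + N) x) \<longlonglongrightarrow> D x" by simp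
      then show ?case by (rule LIMSEQ_offset)
    qed
    show "Lq_tendsto q \<Omega> ?v D" if "1 \<le> q" for q
      by (rule Linf_dominated_tendsto(1)[OF vL DL lim bound that])
    show "Linf_weak_star_tendsto \<Omega> ?v D"
      by (rule Linf_dominated_tendsto(2)[OF vL DL lim bound])
  qed
qed

text \<open>
  The constant sequence of directions is admissible for small steps, since the datum is bounded away
  from zero, and limits in the square norm are unique.
\<close>

lemma hadamard_unique:
  assumes "has_hadamard_deriv \<Omega> T u h D" "has_hadamard_deriv \<Omega> T u h D'" "u \<in> Linf_oplus \<Omega>" "h \<in> Linf \<Omega>"
  shows "AE x in \<mu>. D x = D' x"
proof -
  obtain \<sigma> K where step: "uniform_step u (Linf_norm \<Omega> h) \<sigma> K"
    using uniform_step_exists[OF assms(3) Linf_norm_nonneg[OF Linf_BM[OF assms(4)]]] by blast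
  note \<sigma> = uniform_stepD(1)[OF step] and plus = uniform_stepD(3)[OF step _ _ assms(4) Linf_AE_le[OF assms(4)]]
  note s = scaled_harmonic[OF \<sigma>]
  let ?v = "\<lambda>n x. (T (\<lambda>x. u x + \<sigma> / real (n + 2) * h x) x - T u x) / (\<sigma> / real (n + 2))"
  have "Lq_tendsto 2 \<Omega> ?v D''" if "has_hadamard_deriv \<Omega> T u h D''" for D''
  proof -
    have "(\<lambda>x. u x + \<sigma> / real (n + 2) * h x) \<in> Linf_plus \<Omega>" for n using plus[OF s(1) less_imp_le[OF s(2)]] .
    then show ?thesis
      using that s(1,3) Linf_tendsto_const[OF assms(4)] unfolding has_hadamard_deriv_def Let_def
      by (elim conjE allE[of _ "\<lambda>n. \<sigma> / real (n + 2)"] allE[of _ "\<lambda>_. h"] impE allE[of _ 2]) auto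
  qed
  from Lq_tendsto_2[OF this[OF assms(1)]] Lq_tendsto_2[OF this[OF assms(2)]]
  show ?thesis by (rule L2_tendsto_unique)
qed

lemma hadamard_iff_dir_limit:
  assumes T: "\<And>v. v \<in> Linf_plus \<Omega> \<Longrightarrow> AE x in \<mu>. T v x = smax v x"
    and u: "u \<in> Linf_oplus \<Omega>" and h: "h \<in> Linf \<Omega>"
  shows "has_hadamard_deriv \<Omega> T u h D \<longleftrightarrow> dir_limit u h D"
proof
  assume H: "has_hadamard_deriv \<Omega> T u h D"
  obtain D0 where D0: "dir_limit u h D0" using dir_limit_exists[OF u h] by blast
  have "has_hadamard_deriv \<Omega> T u h D0" by (rule hadamard_of_dir_limit[OF T u h D0])
  from hadamard_unique[OF this H u h] show "dir_limit u h D" by (rule dir_limit_AE_cong[OF D0])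
qed (rule hadamard_of_dir_limit[OF T u h])

end

context impulse_control
begin

section \<open>Positive fixed costs\<close>

text \<open>
  If \<open>t Y\<close> lies below the minimal solution, then so does a larger multiple of \<open>Y\<close>: the
  obstacle of \<open>t Y\<close> exceeds \<open>t\<close> times that of \<open>Y\<close> by \<open>(1 - t) \<kappa>\<close>, which leaves room for the
  fraction \<open>(1 - t) \<eta>\<close> of \<open>Y\<close>.  The gap \<open>1 - t\<close> shrinks geometrically.
\<close>

lemma smax_le_smin:
  assumes kappa: "0 < \<kappa>" and u: "u \<in> Linf_plus \<Omega>"
  shows "AE x in \<mu>. smax u x \<le> smin u x"
proof -
  note uL = Linf_plusD[OF u]
  define Y where "Y = smax u"
  define y where "y = smin u"
  have s: "Y \<in> sols u" "y \<in> sols u" unfolding Y_def y_def using u by (auto intro: smax_sols smin_sols)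
  note Y = sol_facts[OF u s(1)] and y = sol_facts[OF u s(2)]
  have VI: "VI (Obs Y) u Y" using s by (simp add: sols_iff)
  define B where "B = poincare_const * Linf_norm \<Omega> u"
  have B: "0 \<le> B" "AE x in \<mu>. Y x \<le> B"
    unfolding B_def using poincare_const(1) Linf_norm_nonneg[OF Linf_BM[OF uL(1)]] Y(5) by auto
  \<comment> \<open>the factor by which \<open>Y\<close> fits below the fixed costs; the summand one guards against \<open>B = 0\<close>\<close>
  define \<eta> where "\<eta> = min 1 (\<kappa> / (B + 1))"
  have \<eta>: "0 < \<eta>" "\<eta> \<le> 1" using kappa B by (auto simp: \<eta>_def)
  have \<eta>B: "\<eta> * B \<le> \<kappa>"
  proof -
    have "\<eta> * B \<le> \<kappa> / (B + 1) * (B + 1)" using B \<eta> kappa by (intro mult_mono) (auto simp: \<eta>_def)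
    then show ?thesis using B by simp
  qed
  have step: "AE x in \<mu>. (t + (1 - t) * \<eta>) * Y x \<le> y x"
    if t: "0 \<le> t" "t \<le> 1" and le: "AE x in \<mu>. t * Y x \<le> y x" for t
  proof -
    let ?r = "t + (1 - t) * \<eta>"
    have r: "0 \<le> ?r" "?r \<le> 1"
    proof -
      show "0 \<le> ?r" using t \<eta> by simp
      have "(1 - t) * \<eta> \<le> (1 - t) * 1" using t \<eta> by (intro mult_left_mono) auto
      then show "?r \<le> 1" by simp
    qed
    have tB: "(\<lambda>x. t * Y x) \<in> BM" using Y(2) by simp
    have "subsolution (\<lambda>x. ?r * u x + (1 - ?r) * 0) (\<lambda>x. ?r * Y x + (1 - ?r) * 0)"
      by (rule subsolution_convex[OF VI_subsolution[OF VI] subsolution_zero r uL(2) L2_const])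
          (auto intro: L2_const)
    then have "subsolution (\<lambda>x. ?r * u x) (\<lambda>x. ?r * Y x)" by simp
    moreover have "AE x in \<mu>. ?r * u x \<le> u x"
      using uL(3) by eventually_elim (rule mult_left_le_one_le[OF _ r])
    ultimately have sub: "subsolution u (\<lambda>x. ?r * Y x)"
      by (rule subsolution_mono[OF _ _ L2_cmult[OF uL(2)] uL(2)])
    have "AE x in \<mu>. ereal (?r * Y x) \<le> Obs (\<lambda>x. t * Y x) x"
      using VI_le[OF VI] Y(3) B(2)
    proof eventually_elim
      case (elim x)
      have "ereal \<kappa> \<le> Obs (\<lambda>_. 0) x" by (rule Phi_ge_kappa[OF zero_BM]) simp
      from Phi_concave[OF Y(2) zero_BM kappa_le[OF Y(3)] kappa_le t elim(1) this]
      have "ereal (t * Y x + (1 - t) * \<kappa>) \<le> Obs (\<lambda>x. t * Y x) x" by simp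
      moreover have "?r * Y x \<le> t * Y x + (1 - t) * \<kappa>"
      proof -
        have "\<eta> * Y x \<le> \<eta> * B" using elim(3) \<eta> by (intro mult_left_mono) auto
        then have "(1 - t) * (\<eta> * Y x) \<le> (1 - t) * \<kappa>" using \<eta>B t by (intro mult_left_mono) auto
        then show ?thesis by (simp add: distrib_right)
      qed
      ultimately show ?case by (metis ereal_less_eq(3) order_trans)
    qed
    from Psi_ge[OF tB uL(2) sub this] have "AE x in \<mu>. ?r * Y x \<le> \<Psi> (\<lambda>x. t * Y x) u x" .
    moreover have "AE x in \<mu>. \<Psi> (\<lambda>x. t * Y x) u x \<le> \<Psi> y u x"
      by (rule Psi_mono[OF tB y(2) uL(2,2) le]) simp
    ultimately show ?thesis using y(4) by eventually_elim simp
  qed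
  have "AE x in \<mu>. (1 - (1 - \<eta>) ^ n) * Y x \<le> y x" for n
  proof (induction n)
    case 0
    then show ?case using y(3) by simp
  next
    case (Suc n)
    have p: "0 \<le> (1 - \<eta>) ^ n" "(1 - \<eta>) ^ n \<le> 1" using \<eta> by (auto intro: power_le_one)
    have eq: "1 - (1 - \<eta>) ^ n + (1 - (1 - (1 - \<eta>) ^ n)) * \<eta> = 1 - (1 - \<eta>) ^ Suc n" by (simp add: algebra_simps)
    have "AE x in \<mu>. (1 - (1 - \<eta>) ^ n + (1 - (1 - (1 - \<eta>) ^ n)) * \<eta>) * Y x \<le> y x"
      by (rule step[OF _ _ Suc]) (use p in auto)
    then show ?case unfolding eq .
  qed
  then have "AE x in \<mu>. \<forall>n. (1 - (1 - \<eta>) ^ n) * Y x \<le> y x" by (simp add: AE_all_countable)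
  then have "AE x in \<mu>. Y x \<le> y x"
  proof eventually_elim
    case (elim x)
    have "(\<lambda>n. (1 - \<eta>) ^ n) \<longlonglongrightarrow> 0" using \<eta> by (intro LIMSEQ_realpow_zero) auto
    then have "(\<lambda>n. (1 - (1 - \<eta>) ^ n) * Y x) \<longlonglongrightarrow> (1 - 0) * Y x"
      by (intro tendsto_mult_right tendsto_diff tendsto_const)
    then show ?case using elim by (intro LIMSEQ_le_const2[of "\<lambda>n. (1 - (1 - \<eta>) ^ n) * Y x"]) auto
  qed
  then show ?thesis by (simp add: Y_def y_def)
qed

abbreviation "ssol \<equiv> the_sol \<Omega> \<kappa> c0 f"

lemma unique_solution:
  assumes "0 < \<kappa>" "u \<in> Linf_plus \<Omega>"
  shows "ssol u \<in> sols u" "\<And>y. y \<in> sols u \<Longrightarrow> AE x in \<mu>. y x = ssol u x"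
    "AE x in \<mu>. smin u x = ssol u x" "AE x in \<mu>. smax u x = ssol u x" "AE x in \<mu>. ssol u x = smax u x"
proof -
  have "\<exists>y. y \<in> sols u" using smax_sols[OF assms(2)] by blast
  then show s: "ssol u \<in> sols u" unfolding the_sol_def by (rule someI_ex)
  have sm: "AE x in \<mu>. y x = smax u x" if "y \<in> sols u" for y
  proof -
    have "AE x in \<mu>. smin u x \<le> y x" "AE x in \<mu>. y x \<le> smax u x"
      using min_sol(1)[OF assms(2)] max_sol(1)[OF assms(2)] that by
          (auto simp: is_ae_least_def is_ae_greatest_def)
    then show ?thesis using smax_le_smin[OF assms] by eventually_elim simp
  qed
  show e: "AE x in \<mu>. y x = ssol u x" if "y \<in> sols u" for y
    using sm[OF that] sm[OF s] by eventually_elim simp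
  show "AE x in \<mu>. smin u x = ssol u x" "AE x in \<mu>. smax u x = ssol u x"
    by (rule e, rule smin_sols[OF assms(2)], rule e, rule smax_sols[OF assms(2)])
  show "AE x in \<mu>. ssol u x = smax u x" by (rule sm[OF s])
qed

section \<open>The derivative as a least element\<close>

definition Psi_quot :: "(real ^ 'n \<Rightarrow> real) \<Rightarrow> (real ^ 'n \<Rightarrow> real) \<Rightarrow> (real ^ 'n \<Rightarrow> real) \<Rightarrow> (real ^ 'n \<Rightarrow> real)
    \<Rightarrow> real \<Rightarrow> real ^ 'n \<Rightarrow> real" where
  "Psi_quot v u h1 h2 \<tau> x = (\<Psi> (\<lambda>x. v x + \<tau> * h1 x) (\<lambda>x. u x + \<tau> * h2 x) x - \<Psi> v u x) / \<tau>"

lemma is_Psi_deriv_iff: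
  "is_Psi_deriv \<Omega> \<kappa> c0 f \<tau>0 v u h1 h2 d \<longleftrightarrow>
     (AE x in \<mu>. - \<infinity> < d x) \<and>
     (\<forall>\<tau>::nat \<Rightarrow> real. (\<forall>n. 0 < \<tau> n \<and> \<tau> n < \<tau>0) \<and> \<tau> \<longlonglongrightarrow> 0 \<longrightarrow>
        (AE x in \<mu>. (\<lambda>n. ereal (Psi_quot v u h1 h2 (\<tau> n) x)) \<longlonglongrightarrow> d x))"
  by (simp add: is_Psi_deriv_def Psi_quot_def \<Psi>_def)

lemma Psi_quot_mono:
  assumes "v \<in> BM" "h1 \<in> BM" "u \<in> L2" "h2 \<in> L2" "0 < s" "s \<le> \<tau>"
    "AE x in \<mu>. - \<kappa> \<le> v x" "AE x in \<mu>. - \<kappa> \<le> v x + \<tau> * h1 x"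
  shows "AE x in \<mu>. Psi_quot v u h1 h2 \<tau> x \<le> Psi_quot v u h1 h2 s x"
proof -
  have eq: "(\<lambda>x. s / \<tau> * (a x + \<tau> * b x) + (1 - s / \<tau>) * a x) = (\<lambda>x. a x + s * b x)" for a b ::
      "real ^ 'n \<Rightarrow> real"
    by (intro ext segment_identity assms)
  have B: "(\<lambda>x. v x + \<tau> * h1 x) \<in> BM" using assms by simp
  have L: "(\<lambda>x. u x + \<tau> * h2 x) \<in> L2" by (intro L2_add L2_cmult assms)
  have "AE x in \<mu>. s / \<tau> * \<Psi> (\<lambda>x. v x + \<tau> * h1 x) (\<lambda>x. u x + \<tau> * h2 x) x + (1 - s / \<tau>) * \<Psi> v u x
      \<le> \<Psi> (\<lambda>x. v x + s * h1 x) (\<lambda>x. u x + s * h2 x) x"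
    using Psi_concave[OF B assms(1,8,7) _ _ L assms(3), of "s / \<tau>"] assms(5,6) unfolding eq by simp
  then show ?thesis
  proof eventually_elim
    case (elim x)
    then have "s / \<tau> * (\<Psi> (\<lambda>x. v x + \<tau> * h1 x) (\<lambda>x. u x + \<tau> * h2 x) x - \<Psi> v u x)
        \<le> \<Psi> (\<lambda>x. v x + s * h1 x) (\<lambda>x. u x + s * h2 x) x - \<Psi> v u x"
      by (simp add: algebra_simps)
    then have "s * Psi_quot v u h1 h2 \<tau> x \<le> s * Psi_quot v u h1 h2 s x"
      using assms(5,6) by (simp add: Psi_quot_def)
    then show ?case using assms(5) by simp
  qed
qed

text \<open>
  Fixed costs \<open>\<kappa> > 0\<close> keep \<open>v + \<tau> h1\<close> above \<open>- \<kappa>\<close> for small steps, where \<open>\<Psi>\<close> is concave, so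
  the quotients have a supremum as their limit.
\<close>

lemma Psi_deriv_exists:
  assumes kappa: "0 < \<kappa>" and v: "v \<in> BM" "AE x in \<mu>. 0 \<le> v x" and h1: "h1 \<in> Linf \<Omega>"
    and u: "u \<in> L2" "h2 \<in> L2" and \<tau>0: "0 < \<tau>0"
  shows "is_Psi_deriv \<Omega> \<kappa> c0 f \<tau>0 v u h1 h2 (Psi_deriv \<Omega> \<kappa> c0 f \<tau>0 v u h1 h2)"
proof -
  let ?q = "Psi_quot v u h1 h2"
  define R where "R = Linf_norm \<Omega> h1 + 1"
  have R: "0 < R" "AE x in \<mu>. \<bar>h1 x\<bar> \<le> R"
    unfolding R_def using Linf_norm_nonneg[OF Linf_BM[OF h1]] Linf_AE_le[OF h1] by auto
  define s0 where "s0 = min \<tau>0 (\<kappa> / R)"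
  have s0: "0 < s0" using kappa R \<tau>0 by (simp add: s0_def)
  have low: "AE x in \<mu>. - \<kappa> \<le> v x + \<tau> * h1 x" if \<tau>: "0 < \<tau>" "\<tau> \<le> s0" for \<tau>
    using v(2) R(2)
  proof eventually_elim
    case (elim x)
    have "\<tau> * R \<le> \<kappa>" using \<tau> R(1) by (simp add: s0_def pos_le_divide_eq)
    moreover have "\<bar>\<tau> * h1 x\<bar> \<le> \<tau> * R" using elim \<tau> by (simp add: abs_mult mult_left_mono)
    ultimately show ?case using elim(1) by linarith
  qed
  have mono: "AE x in \<mu>. ?q \<tau> x \<le> ?q s x" if "0 < s" "s \<le> \<tau>" "\<tau> \<le> s0" for s \<tau>
    by (rule Psi_quot_mono[OF v(1) Linf_BM[OF h1] u that(1,2) kappa_le[OF v(2)] low]) (use that in auto)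
  define s where "s k = s0 / real (k + 2)" for k
  have s: "0 < s k" "s k < s0" "s \<longlonglongrightarrow> 0" for k
    unfolding s_def[abs_def] using scaled_harmonic[OF s0] by auto
  define d where "d x = (SUP k. ereal (?q (s k) x))" for x
  have "is_Psi_deriv \<Omega> \<kappa> c0 f \<tau>0 v u h1 h2 d"
    unfolding is_Psi_deriv_iff
  proof (intro conjI allI impI)
    have "ereal (?q (s 0) x) \<le> d x" for x unfolding d_def by (rule SUP_upper) simp
    then have "- \<infinity> < d x" for x by (rule less_le_trans[rotated]) simp
    then show "AE x in \<mu>. - \<infinity> < d x" by simp
    fix \<tau> :: "nat \<Rightarrow> real" assume a: "(\<forall>n. 0 < \<tau> n \<and> \<tau> n < \<tau>0) \<and> \<tau> \<longlonglongrightarrow> 0"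
    then have \<tau>: "\<And>n. 0 < \<tau> n" "\<tau> \<longlonglongrightarrow> 0" by auto
    have 1: "AE x in \<mu>. \<forall>n k. \<tau> n \<le> s k \<longrightarrow> ?q (s k) x \<le> ?q (\<tau> n) x"
      unfolding AE_all_countable
    proof (intro allI)
      fix n k
      show "AE x in \<mu>. \<tau> n \<le> s k \<longrightarrow> ?q (s k) x \<le> ?q (\<tau> n) x"
        using mono[OF \<tau>(1) _ less_imp_le[OF s(2)], of n k] by (cases "\<tau> n \<le> s k") auto
    qed
    have 2: "AE x in \<mu>. \<forall>n k. s k \<le> \<tau> n \<longrightarrow> \<tau> n \<le> s0 \<longrightarrow> ?q (\<tau> n) x \<le> ?q (s k) x"
      unfolding AE_all_countable
    proof (intro allI)
      fix n k
      show "AE x in \<mu>. s k \<le> \<tau> n \<longrightarrow> \<tau> n \<le> s0 \<longrightarrow> ?q (\<tau> n) x \<le> ?q (s k) x"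
        using mono[OF s(1), of k "\<tau> n"] by (cases "s k \<le> \<tau> n \<and> \<tau> n \<le> s0") auto
    qed
    show "AE x in \<mu>. (\<lambda>n. ereal (?q (\<tau> n) x)) \<longlonglongrightarrow> d x"
      using 1 2
    proof eventually_elim
      case (elim x)
      show ?case unfolding d_def by (rule quotient_limit[OF s(1,3) \<tau> s0]) (use elim in auto)
    qed
  qed
  then show ?thesis unfolding Psi_deriv_def by (rule someI[of "is_Psi_deriv \<Omega> \<kappa> c0 f \<tau>0 v u h1 h2"])
qed

text \<open>
  A supersolution for the perturbed datum lies above the perturbed minimal solution, which is the
  unique solution.
\<close>

lemma candidate_ge:
  assumes kappa: "0 < \<kappa>" and u: "u \<in> Linf_oplus \<Omega>" and h: "h \<in> Linf \<Omega>" and \<tau>0: "0 < \<tau>0"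
    and plus: "(\<lambda>x. u x + \<tau>0 * h x) \<in> Linf_plus \<Omega>" and D: "dir_limit u h D"
    and \<zeta>: "\<zeta> \<in> deriv_candidates \<Omega> \<kappa> c0 f \<tau>0 u h"
  shows "AE x in \<mu>. D x \<le> \<zeta> x"
proof -
  have up: "u \<in> Linf_plus \<Omega>" using oplusD[OF u] by blast
  obtain \<zeta>s \<tau> where \<zeta>s: "\<And>n. \<zeta>s n \<in> Linf \<Omega>" and \<tau>: "\<And>n. 0 < \<tau> n" "\<And>n. \<tau> n < \<tau>0" "\<tau> \<longlonglongrightarrow> (0 :: real)"
    and conv: "\<And>q. 1 \<le> q \<Longrightarrow> Lq_tendsto q \<Omega> \<zeta>s \<zeta>"
    and sup: "\<And>n. is_supersolution \<Omega> \<kappa> c0 f (L2_functional \<Omega> (\<lambda>x. u x + \<tau> n * h x))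
        (\<lambda>x. ssol u x + \<tau> n * \<zeta>s n x)"
    using \<zeta> unfolding deriv_candidates_def by blast
  have seg: "(\<lambda>x. u x + \<tau> n * h x) \<in> Linf_plus \<Omega>" for n
    by (rule segment_plus[OF up h plus \<tau>(1) less_imp_le[OF \<tau>(2)]])
  have le: "AE x in \<mu>. quot smax u h (\<tau> n) x \<le> \<zeta>s n x" for n
  proof -
    let ?v = "\<lambda>x. ssol u x + \<tau> n * \<zeta>s n x"
    have "?v \<in> BM" "AE x in \<mu>. \<Psi> ?v (\<lambda>x. u x + \<tau> n * h x) x \<le> ?v x"
      using sup[of n] L2_measurable unfolding is_supersolution_def \<Psi>_def Psi_def by auto
    from min_sol(2)[OF seg this] have "AE x in \<mu>. smin (\<lambda>x. u x + \<tau> n * h x) x \<le> ?v x" .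
    then show ?thesis
      using unique_solution(3,4)[OF kappa seg[of n]] unique_solution(4)[OF kappa up]
    proof eventually_elim
      case (elim x)
      then show ?case using \<tau>(1)[of n] by (simp add: quot_def pos_divide_le_eq mult.commute)
    qed
  qed
  then have all: "AE x in \<mu>. \<forall>n. quot smax u h (\<tau> n) x \<le> \<zeta>s n x" by (simp add: AE_all_countable)
  have lim: "AE x in \<mu>. (\<lambda>n. quot smax u h (\<tau> n) x) \<longlonglongrightarrow> D x"
    using D \<tau>(1,3) seg unfolding dir_limit_def by blast
  have "Lq_tendsto 2 \<Omega> \<zeta>s \<zeta>" by (rule conv) simp
  from Lq_tendsto_2[OF this]
  obtain r where r: "strict_mono (r :: nat \<Rightarrow> nat)" "AE x in \<mu>. (\<lambda>n. \<zeta>s (r n) x) \<longlonglongrightarrow> \<zeta> x"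
    by (rule L2_tendsto_AE_subseq)
  show ?thesis
    using all lim r(2)
  proof eventually_elim
    case (elim x)
    have "(\<lambda>n. quot smax u h (\<tau> (r n)) x) \<longlonglongrightarrow> D x"
      using LIMSEQ_subseq_LIMSEQ[OF elim(2) r(1)] by (simp add: o_def)
    then show ?case by (rule LIMSEQ_le[OF _ elim(3)]) (use elim(1) in auto)
  qed
qed

text \<open>
  The difference quotients of the solution map are themselves admissible: \<open>\<Psi>'\<close> in the direction
  \<open>\<zeta>\<^sub>n\<close> lies between \<open>\<zeta>\<^sub>n\<close>, by concavity, and the limit \<open>D\<close>, by monotonicity.
\<close>

lemma dir_limit_candidate:
  assumes kappa: "0 < \<kappa>" and u: "u \<in> Linf_oplus \<Omega>" and h: "h \<in> Linf \<Omega>" and \<tau>0: "0 < \<tau>0"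
    and plus: "(\<lambda>x. u x + \<tau>0 * h x) \<in> Linf_plus \<Omega>" and D: "dir_limit u h D"
  shows "D \<in> deriv_candidates \<Omega> \<kappa> c0 f \<tau>0 u h"
proof -
  have up: "u \<in> Linf_plus \<Omega>" using oplusD[OF u] by blast
  define \<tau> where "\<tau> n = \<tau>0 / real (n + 2)" for n
  have \<tau>: "0 < \<tau> n" "\<tau> n < \<tau>0" "\<tau> \<longlonglongrightarrow> 0" "\<tau> (Suc n) \<le> \<tau> n" for n
    unfolding \<tau>_def[abs_def] using scaled_harmonic[OF \<tau>0] by auto
  have \<tau>_le: "\<tau> m \<le> \<tau> n" if "n \<le> m" for m n
    using that \<tau>(4) by (rule lift_Suc_antimono_le[rotated])
  have seg: "(\<lambda>x. u x + \<tau> n * h x) \<in> Linf_plus \<Omega>" for n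
    by (rule segment_plus[OF up h plus \<tau>(1) less_imp_le[OF \<tau>(2)]])
  define Y where "Y n = ssol (\<lambda>x. u x + \<tau> n * h x)" for n
  define y where "y = ssol u"
  define \<zeta> where "\<zeta> n x = (Y n x - y x) / \<tau> n" for n x
  have ys: "y \<in> sols u" unfolding y_def by (rule unique_solution(1)[OF kappa up])
  have Ys: "Y n \<in> sols (\<lambda>x. u x + \<tau> n * h x)" for n unfolding Y_def by (rule unique_solution(1)[OF kappa seg])
  note y = sol_facts[OF up ys] and Y = sol_facts[OF seg Ys]
  have Y\<zeta>: "(\<lambda>x. y x + \<tau> n * \<zeta> n x) = Y n" for n using \<tau>(1)[of n] by (auto simp: \<zeta>_def)
  have \<zeta>L: "\<zeta> n \<in> Linf \<Omega>" for n
    using Linf_cmult[OF Linf_diff[OF Linf_plusD(1)[OF Y(6)] Linf_plusD(1)[OF y(6)]], of "1 / \<tau> n" n] by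
        (simp add: \<zeta>_def[abs_def])
  have \<zeta>q: "AE x in \<mu>. \<zeta> n x = quot smax u h (\<tau> n) x" for n
    using unique_solution(4)[OF kappa up] unique_solution(4)[OF kappa seg[of n]]
    by eventually_elim (simp add: \<zeta>_def quot_def Y_def y_def)
  have \<zeta>mono: "AE x in \<mu>. \<zeta> n x \<le> \<zeta> m x" if "n \<le> m" for n m
    using quot_mono[OF up h seg \<tau>(1) \<tau>_le[OF that]] \<zeta>q[of n] \<zeta>q[of m] by eventually_elim simp
  have "AE x in \<mu>. (\<lambda>n. quot smax u h (\<tau> n) x) \<longlonglongrightarrow> D x"
    using D \<tau>(1,3) seg unfolding dir_limit_def by blast
  moreover have "AE x in \<mu>. \<forall>n. \<zeta> n x = quot smax u h (\<tau> n) x" using \<zeta>q by (simp add: AE_all_countable)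
  ultimately have \<zeta>lim: "AE x in \<mu>. (\<lambda>n. \<zeta> n x) \<longlonglongrightarrow> D x" by eventually_elim simp
  have "has_hadamard_deriv \<Omega> ssol u h D"
    by (rule hadamard_of_dir_limit[OF unique_solution(5)[OF kappa] u h D])
  then have Lq: "Lq_tendsto q \<Omega> \<zeta> D" if "1 \<le> q" for q
    using that \<tau>(1,3) Linf_tendsto_const[OF h] seg unfolding has_hadamard_deriv_def Let_def \<zeta>_def[abs_def]
        Y_def y_def
    by (elim conjE allE[of _ \<tau>] allE[of _ "\<lambda>_. h"]) simp
  have super: "is_supersolution \<Omega> \<kappa> c0 f (L2_functional \<Omega> (\<lambda>x. u x + \<tau> n * h x)) (\<lambda>x. y x + \<tau> n * \<zeta> n x)" for n
  proof -
    have "AE x in \<mu>. \<Psi> (Y n) (\<lambda>x. u x + \<tau> n * h x) x \<le> Y n x" using Y(4)[of n] by eventually_elim simp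
    then show ?thesis unfolding Y\<zeta> is_supersolution_def using Y(7) by (simp add: \<Psi>_def Psi_def)
  qed
  define d where "d n = Psi_deriv \<Omega> \<kappa> c0 f \<tau>0 y u (\<zeta> n) h" for n
  have d: "AE x in \<mu>. (\<lambda>m. ereal (Psi_quot y u (\<zeta> n) h (\<tau> m) x)) \<longlonglongrightarrow> d n x" for n
    using Psi_deriv_exists[OF kappa y(2,3) \<zeta>L Linf_plusD(2)[OF up] Linf_L2[OF h] \<tau>0, of n] \<tau>(1,2,3)
    unfolding is_Psi_deriv_iff d_def by blast
  have lower: "AE x in \<mu>. \<zeta> n x \<le> Psi_quot y u (\<zeta> n) h (\<tau> m) x" if nm: "n \<le> m" for n m
  proof -
    have k: "AE x in \<mu>. - \<kappa> \<le> y x + \<tau> n * \<zeta> n x" unfolding fun_cong[OF Y\<zeta>] by (rule kappa_le[OF Y(3)])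
    have "AE x in \<mu>. Psi_quot y u (\<zeta> n) h (\<tau> n) x \<le> Psi_quot y u (\<zeta> n) h (\<tau> m) x"
      by (rule Psi_quot_mono[OF y(2) Linf_BM[OF \<zeta>L] Linf_plusD(2)[OF up] Linf_L2[OF h] \<tau>(1) \<tau>_le[OF nm]
          kappa_le[OF y(3)] k])
    moreover have "AE x in \<mu>. Psi_quot y u (\<zeta> n) h (\<tau> n) x = \<zeta> n x"
      using y(4) Y(4)[of n] unfolding Psi_quot_def Y\<zeta> by eventually_elim (simp add: \<zeta>_def)
    ultimately show ?thesis by eventually_elim simp
  qed
  have upper: "AE x in \<mu>. Psi_quot y u (\<zeta> n) h (\<tau> m) x \<le> \<zeta> m x" if nm: "n \<le> m" for n m
  proof -
    have B: "(\<lambda>x. y x + \<tau> m * \<zeta> n x) \<in> BM" using y(2) Linf_BM[OF \<zeta>L] by simp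
    have "AE x in \<mu>. y x + \<tau> m * \<zeta> n x \<le> Y m x"
      using \<zeta>mono[OF nm] unfolding fun_cong[OF Y\<zeta>, symmetric] by eventually_elim (use \<tau>(1) in simp)
    from Psi_mono[OF B Y(2) Linf_plusD(2)[OF seg] Linf_plusD(2)[OF seg] this]
    have "AE x in \<mu>. \<Psi> (\<lambda>x. y x + \<tau> m * \<zeta> n x) (\<lambda>x. u x + \<tau> m * h x) x \<le> \<Psi> (Y m) (\<lambda>x. u x + \<tau> m * h x) x" by
        simp
    then show ?thesis using Y(4)[of m] y(4)
      by eventually_elim (use \<tau>(1)[of m] in \<open>simp add: Psi_quot_def \<zeta>_def divide_right_mono\<close>)
  qed
  have bounds: "AE x in \<mu>. ereal (\<zeta> n x) \<le> d n x \<and> d n x \<le> ereal (D x)" for n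
  proof -
    have "AE x in \<mu>. \<forall>m. n \<le> m \<longrightarrow> \<zeta> n x \<le> Psi_quot y u (\<zeta> n) h (\<tau> m) x \<and> Psi_quot y u (\<zeta> n) h (\<tau> m) x \<le> \<zeta> m x"
      unfolding AE_all_countable
    proof (intro allI)
      fix m
      show "AE x in \<mu>. n \<le> m \<longrightarrow> \<zeta> n x \<le> Psi_quot y u (\<zeta> n) h (\<tau> m) x \<and> Psi_quot y u (\<zeta> n) h (\<tau> m) x \<le> \<zeta> m x"
        using lower[of n m] upper[of n m] by (cases "n \<le> m") auto
    qed
    then show ?thesis using d[of n] \<zeta>lim
    proof eventually_elim
      case (elim x)
      have "(\<lambda>m. ereal (\<zeta> m x)) \<longlonglongrightarrow> ereal (D x)" using elim(3) by simp
      from LIMSEQ_le[OF elim(2) this] have "d n x \<le> ereal (D x)" using elim(1) by auto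
      moreover have "ereal (\<zeta> n x) \<le> d n x" by (rule LIMSEQ_le_const[OF elim(2)]) (use elim(1) in auto)
      ultimately show ?case by simp
    qed
  qed
  then have "AE x in \<mu>. \<forall>n. ereal (\<zeta> n x) \<le> d n x \<and> d n x \<le> ereal (D x)" by (simp add: AE_all_countable)
  then have dlim: "AE x in \<mu>. (\<lambda>n. d n x - ereal (\<zeta> n x)) \<longlonglongrightarrow> 0"
    using \<zeta>lim
  proof eventually_elim
    case (elim x)
    have "(\<lambda>n. ereal (D x - \<zeta> n x)) \<longlonglongrightarrow> ereal (D x - D x)" using elim(2) by (intro tendsto_intros)
    then have D0: "(\<lambda>n. ereal (D x - \<zeta> n x)) \<longlonglongrightarrow> 0" by (simp add: zero_ereal_def)
    have b: "0 \<le> d n x - ereal (\<zeta> n x)" "d n x - ereal (\<zeta> n x) \<le> ereal (D x - \<zeta> n x)" for n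
      using elim(1)[rule_format, of n] by (cases "d n x"; simp)+
    show ?case by (rule tendsto_sandwich[OF _ _ tendsto_const D0]) (use b in auto)
  qed
  have "D \<in> Linf \<Omega>" using D by (simp add: dir_limit_def)
  moreover have "(\<forall>n. \<zeta> n \<in> Linf \<Omega>) \<and> (\<forall>n. 0 < \<tau> n \<and> \<tau> n < \<tau>0)
        \<and> (\<forall>n. (AE x in \<mu>. \<zeta> n x \<le> \<zeta> (Suc n) x) \<and> \<tau> (Suc n) \<le> \<tau> n)
        \<and> \<tau> \<longlonglongrightarrow> 0 \<and> (\<forall>q\<ge>1. Lq_tendsto q \<Omega> \<zeta> D)
        \<and> (\<forall>n. is_supersolution \<Omega> \<kappa> c0 f (L2_functional \<Omega> (\<lambda>x. u x + \<tau> n * h x)) (\<lambda>x. ssol u x + \<tau> n * \<zeta> n x))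
        \<and> (AE x in \<mu>. (\<lambda>n. Psi_deriv \<Omega> \<kappa> c0 f \<tau>0 (ssol u) u (\<zeta> n) h x - ereal (\<zeta> n x)) \<longlonglongrightarrow> 0)"
    using \<zeta>L \<tau> \<zeta>mono[OF le_SucI[OF order_refl]] Lq super dlim unfolding d_def y_def by simp
  ultimately show ?thesis unfolding deriv_candidates_def by blast
qed

lemma dir_limit_iff_least_candidate:
  assumes kappa: "0 < \<kappa>" and u: "u \<in> Linf_oplus \<Omega>" and h: "h \<in> Linf \<Omega>" and \<tau>0: "0 < \<tau>0"
    and plus: "(\<lambda>x. u x + \<tau>0 * h x) \<in> Linf_plus \<Omega>"
  shows "dir_limit u h D \<longleftrightarrow> is_ae_least \<Omega> (deriv_candidates \<Omega> \<kappa> c0 f \<tau>0 u h) D"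
proof -
  have least: "is_ae_least \<Omega> (deriv_candidates \<Omega> \<kappa> c0 f \<tau>0 u h) D" if "dir_limit u h D" for D
    unfolding is_ae_least_def
    using dir_limit_candidate[OF assms that] candidate_ge[OF assms that] by blast
  show ?thesis
  proof
    assume D: "is_ae_least \<Omega> (deriv_candidates \<Omega> \<kappa> c0 f \<tau>0 u h) D"
    obtain D0 where D0: "dir_limit u h D0" using dir_limit_exists[OF u h] by blast
    have "AE x in \<mu>. D0 x \<le> D x" "AE x in \<mu>. D x \<le> D0 x"
      using D least[OF D0] unfolding is_ae_least_def by blast+
    then have "AE x in \<mu>. D0 x = D x" by eventually_elim simp
    then show "dir_limit u h D" by (rule dir_limit_AE_cong[OF D0])
  qed (rule least)
qed

lemma L2_functional_Hm1_plus:
  assumes "u \<in> Linf_plus \<Omega>" shows "L2_functional \<Omega> u \<in> Hm1_plus \<Omega>"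
proof -
  note u = Linf_plusD[OF assms]
  have "\<bar>L2_functional \<Omega> u v\<bar> \<le> sqrt (sq_norm u) * H1_norm \<Omega> v" if v: "v \<in> H" for v
  proof -
    have "\<bar>L2_functional \<Omega> u v\<bar> \<le> sqrt (sq_norm u) * sqrt (sq_norm v)"
      unfolding L2_functional_def by (rule Cauchy_Schwarz_L2[OF u(2) H10_L2[OF v]])
    also have "sqrt (sq_norm v) \<le> H1_norm \<Omega> v"
      unfolding H1_norm_squared by (simp add: sum_nonneg sq_norm_nonneg)
    then have "sqrt (sq_norm u) * sqrt (sq_norm v) \<le> sqrt (sq_norm u) * H1_norm \<Omega> v"
      by (rule mult_left_mono) (simp add: sq_norm_nonneg)
    finally show ?thesis .
  qed
  moreover have "L2_functional \<Omega> u (\<lambda>x. v x + w x) = L2_functional \<Omega> u v + L2_functional \<Omega> u w"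
    if "v \<in> H" "w \<in> H" for v w
    using that u by (simp add: L2_functional_def distrib_left L2_times_integrable H10_L2)
  moreover have "L2_functional \<Omega> u (\<lambda>x. c * v x) = c * L2_functional \<Omega> u v" for c v
    by (simp add: L2_functional_def mult.left_commute)
  moreover have "0 \<le> L2_functional \<Omega> u v" if "AE x in \<mu>. 0 \<le> v x" for v
    unfolding L2_functional_def
    by (rule integral_nonneg_AE) (use that u(3) in eventually_elim, simp)
  ultimately show ?thesis unfolding Hm1_plus_def Hm1_def by blast
qed

end

theorem theorem6p6:
  fixes \<Omega> :: "(real ^ 'n) set"
    and \<kappa> :: real
    and c0 :: "real ^ 'n \<Rightarrow> real"
    and f :: "real \<Rightarrow> real"
  assumes "open \<Omega>" and "bounded \<Omega>" and "\<Omega> \<noteq> {}"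
    and "0 \<le> \<kappa>"
    and "c0 \<in> borel_measurable lebesgue" and "AE x in lebesgue. 0 \<le> c0 x"
    and "mono f" and "\<exists>L. L-lipschitz_on UNIV f" and "convex_on UNIV f" and "f 0 = 0"
  shows
    "(\<forall>u \<in> Linf_plus \<Omega>.
        L2_functional \<Omega> u \<in> Hm1_plus \<Omega>
      \<and> is_ae_least \<Omega> (qvi_solutions \<Omega> \<kappa> c0 f (L2_functional \<Omega> u)) (min_sol \<Omega> \<kappa> c0 f u)
      \<and> is_ae_greatest \<Omega> (qvi_solutions \<Omega> \<kappa> c0 f (L2_functional \<Omega> u)) (max_sol \<Omega> \<kappa> c0 f u)
      \<and> min_sol \<Omega> \<kappa> c0 f u \<in> H10 \<Omega> \<inter> Linf_plus \<Omega>
      \<and> max_sol \<Omega> \<kappa> c0 f u \<in> H10 \<Omega> \<inter> Linf_plus \<Omega>)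
    \<and>
     (\<forall>u \<in> Linf_oplus \<Omega>. \<exists>C>0. \<exists>r>0. \<forall>v1 \<in> Linf_plus \<Omega>. \<forall>v2 \<in> Linf_plus \<Omega>.
        Linf_norm \<Omega> (\<lambda>x. v1 x - u x) \<le> r \<and> Linf_norm \<Omega> (\<lambda>x. v2 x - u x) \<le> r \<longrightarrow>
          Linf_norm \<Omega> (\<lambda>x. min_sol \<Omega> \<kappa> c0 f v1 x - min_sol \<Omega> \<kappa> c0 f v2 x)
        + Linf_norm \<Omega> (\<lambda>x. max_sol \<Omega> \<kappa> c0 f v1 x - max_sol \<Omega> \<kappa> c0 f v2 x)
        \<le> C * Linf_norm \<Omega> (\<lambda>x. v1 x - v2 x))
    \<and>
     (\<forall>u \<in> Linf_oplus \<Omega>. \<forall>us. (\<forall>n. us n \<in> Linf_oplus \<Omega>) \<and> Linf_tendsto \<Omega> us u \<longrightarrow>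
        H10_weak_tendsto \<Omega> (\<lambda>n. min_sol \<Omega> \<kappa> c0 f (us n)) (min_sol \<Omega> \<kappa> c0 f u)
      \<and> H10_weak_tendsto \<Omega> (\<lambda>n. max_sol \<Omega> \<kappa> c0 f (us n)) (max_sol \<Omega> \<kappa> c0 f u))
    \<and>
     (\<forall>u \<in> Linf_oplus \<Omega>. \<forall>h \<in> Linf \<Omega>.
        \<exists>D. has_hadamard_deriv \<Omega> (max_sol \<Omega> \<kappa> c0 f) u h D
          \<and> (\<forall>D'. has_hadamard_deriv \<Omega> (max_sol \<Omega> \<kappa> c0 f) u h D'
                 \<longrightarrow> (AE x in lebesgue_on \<Omega>. D' x = D x)))
    \<and>
     (\<kappa> > 0 \<longrightarrow>
        (\<forall>u \<in> Linf_plus \<Omega>.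
           (\<exists>y \<in> qvi_solutions \<Omega> \<kappa> c0 f (L2_functional \<Omega> u).
              \<forall>y' \<in> qvi_solutions \<Omega> \<kappa> c0 f (L2_functional \<Omega> u). AE x in lebesgue_on \<Omega>. y' x = y x)
         \<and> (AE x in lebesgue_on \<Omega>. min_sol \<Omega> \<kappa> c0 f u x = the_sol \<Omega> \<kappa> c0 f u x)
         \<and> (AE x in lebesgue_on \<Omega>. max_sol \<Omega> \<kappa> c0 f u x = the_sol \<Omega> \<kappa> c0 f u x))
      \<and> (\<forall>u \<in> Linf_oplus \<Omega>. \<forall>h \<in> Linf \<Omega>. \<forall>\<tau>0>0. (\<lambda>x. u x + \<tau>0 * h x) \<in> Linf_plus \<Omega> \<longrightarrow>
           (\<forall>D. (has_hadamard_deriv \<Omega> (the_sol \<Omega> \<kappa> c0 f) u h D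
                   \<longleftrightarrow> has_hadamard_deriv \<Omega> (max_sol \<Omega> \<kappa> c0 f) u h D)
              \<and> (has_hadamard_deriv \<Omega> (the_sol \<Omega> \<kappa> c0 f) u h D
                   \<longleftrightarrow> is_ae_least \<Omega> (deriv_candidates \<Omega> \<kappa> c0 f \<tau>0 u h) D))))"
proof -
  interpret impulse_control \<Omega> f \<kappa> c0
    by unfold_locales (use assms in auto)
  have smax_hadamard: "has_hadamard_deriv \<Omega> smax u h D \<longleftrightarrow> dir_limit u h D"
    if "u \<in> Linf_oplus \<Omega>" "h \<in> Linf \<Omega>" for u h D
    by (rule hadamard_iff_dir_limit[OF _ that]) simp
  have ssol_hadamard: "has_hadamard_deriv \<Omega> ssol u h D \<longleftrightarrow> dir_limit u h D"
    if "0 < \<kappa>" "u \<in> Linf_oplus \<Omega>" "h \<in> Linf \<Omega>" for u h D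
    by (rule hadamard_iff_dir_limit[OF unique_solution(5)[OF that(1)] that(2,3)])
  show ?thesis
  proof (intro conjI ballI impI allI)
    fix u assume u: "u \<in> Linf_plus \<Omega>"
    show "L2_functional \<Omega> u \<in> Hm1_plus \<Omega>" by (rule L2_functional_Hm1_plus[OF u])
    show "is_ae_least \<Omega> (sols u) (smin u)" by (rule min_sol(1)[OF u])
    show "is_ae_greatest \<Omega> (sols u) (smax u)" by (rule max_sol(1)[OF u])
    show "smin u \<in> H10 \<Omega> \<inter> Linf_plus \<Omega>" using sol_facts(1,6)[OF u smin_sols[OF u]] by blast
    show "smax u \<in> H10 \<Omega> \<inter> Linf_plus \<Omega>" using sol_facts(1,6)[OF u smax_sols[OF u]] by blast
  next
    fix u assume "u \<in> Linf_oplus \<Omega>"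
    then show "\<exists>C>0. \<exists>r>0. \<forall>v1 \<in> Linf_plus \<Omega>. \<forall>v2 \<in> Linf_plus \<Omega>.
        Linf_norm \<Omega> (\<lambda>x. v1 x - u x) \<le> r \<and> Linf_norm \<Omega> (\<lambda>x. v2 x - u x) \<le> r \<longrightarrow>
          Linf_norm \<Omega> (\<lambda>x. smin v1 x - smin v2 x) + Linf_norm \<Omega> (\<lambda>x. smax v1 x - smax v2 x)
        \<le> C * Linf_norm \<Omega> (\<lambda>x. v1 x - v2 x)"
      by (rule local_lipschitz)
  next
    fix u us assume u: "u \<in> Linf_oplus \<Omega>" and us: "(\<forall>n. us n \<in> Linf_oplus \<Omega>) \<and> Linf_tendsto \<Omega> us u"
    show "H10_weak_tendsto \<Omega> (\<lambda>n. smin (us n)) (smin u)"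
      by (rule weak_continuity[OF selection_smin u]) (use us in auto)
    show "H10_weak_tendsto \<Omega> (\<lambda>n. smax (us n)) (smax u)"
      by (rule weak_continuity[OF selection_smax u]) (use us in auto)
  next
    fix u h assume u: "u \<in> Linf_oplus \<Omega>" and h: "h \<in> Linf \<Omega>"
    obtain D where "dir_limit u h D" using dir_limit_exists[OF u h] by blast
    then have D: "has_hadamard_deriv \<Omega> smax u h D" using smax_hadamard[OF u h] by blast
    show "\<exists>D. has_hadamard_deriv \<Omega> smax u h D
          \<and> (\<forall>D'. has_hadamard_deriv \<Omega> smax u h D' \<longrightarrow> (AE x in \<mu>. D' x = D x))"
      using D hadamard_unique[OF _ D u h] by blast
  next
    fix u assume k: "0 < \<kappa>" and u: "u \<in> Linf_plus \<Omega>"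
    show "\<exists>y \<in> sols u. \<forall>y' \<in> sols u. AE x in \<mu>. y' x = y x"
      using unique_solution(1,2)[OF k u] by blast
    show "AE x in \<mu>. smin u x = ssol u x" "AE x in \<mu>. smax u x = ssol u x"
      using unique_solution(3,4)[OF k u] by blast+
  next
    fix u h \<tau>0 D
    assume k: "0 < \<kappa>" and u: "u \<in> Linf_oplus \<Omega>" and h: "h \<in> Linf \<Omega>" and \<tau>0: "(0 :: real) < \<tau>0"
      and p: "(\<lambda>x. u x + \<tau>0 * h x) \<in> Linf_plus \<Omega>"
    show "has_hadamard_deriv \<Omega> ssol u h D \<longleftrightarrow> has_hadamard_deriv \<Omega> smax u h D"
      by (simp add: smax_hadamard[OF u h] ssol_hadamard[OF k u h])
    show "has_hadamard_deriv \<Omega> ssol u h D \<longleftrightarrow> is_ae_least \<Omega> (deriv_candidates \<Omega> \<kappa> c0 f \<tau>0 u h) D"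
      by (simp add: ssol_hadamard[OF k u h] dir_limit_iff_least_candidate[OF k u h \<tau>0 p])
  qed
qed

end
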